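(* Given any directed graph $G=(V,E)$ with $n$ vertices, two vertices $s,t$, and $k$ cost functions $c_1,\dots,c_k:E\to\mathbb{R}_{\ge0}$, there is a randomized algorithm running in time $\mathrm{poly}(n)\cdot n^{O(\log n)}$ that returns an $s$-$t$ path $\mathcal{P}$ with $\max_{i\in[k]}c_i(\mathcal{P})\le O(\log n\log k)\cdot \mathrm{OPT}$ with probability at least $1-\left(\frac1k+\frac{1}{k\log n}\right)$, where $\mathrm{OPT}$ is the optimal value of the robust $s$-$t$ path instance.
   Context: Robust $s$-$t$ path problem: given a directed graph $G=(V,E)$, vertices $s,t$, and $k$ cost functions (agents) $c_i:E\to\mathbb{R}_{\ge0}$ with $c_i(\mathcal{P})=\sum_{e\in\mathcal{P}}c_i(e)$, find an $s$-$t$ path $\mathcal{P}$ minimizing $\max_{i\in[k]}c_i(\mathcal{P})$; $\mathrm{OPT}$ is this minimum.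
   Formalization: The running time is bounded by poly(n,k)·n^{O(log n)} instead of poly(n)·n^{O(log n)}: for unbounded k, no algorithm whose time depends on n alone can read enough of the k cost functions to achieve the guarantee. *)

theory Defs
  imports "HOL-Probability.Probability" "Graph_Theory.Pair_Digraph"
begin

section \<open>The robust \<open>s\<close>-\<open>t\<close> path problem\<close>

text \<open>
  Vertices are numbered \<open>0, \<dots>, n - 1\<close>, since the graph is the input of a machine;
  agents are numbered \<open>0, \<dots>, k - 1\<close>. Loops are allowed, parallel arcs are not.
\<close>

definition robust_instance ::
  "nat pair_pre_digraph \<Rightarrow> nat \<Rightarrow> nat \<Rightarrow> nat \<Rightarrow> (nat \<Rightarrow> nat \<times> nat \<Rightarrow> real) \<Rightarrow> bool" where
  "robust_instance G s t k c \<longleftrightarrow>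
     pair_fin_digraph G \<and> pverts G = {..<card (pverts G)} \<and>
     s \<in> pverts G \<and> t \<in> pverts G \<and> 0 < k \<and>
     (\<forall>i<k. \<forall>e\<in>parcs G. 0 \<le> c i e)"

text \<open>A path is a list of arcs that visits no vertex twice; it is empty if \<open>s = t\<close>.\<close>

definition st_paths :: "nat pair_pre_digraph \<Rightarrow> nat \<Rightarrow> nat \<Rightarrow> (nat \<times> nat) list set" where
  "st_paths G s t = {p. pre_digraph.apath (with_proj G) s p t}"

definition path_cost :: "(nat \<times> nat \<Rightarrow> real) \<Rightarrow> (nat \<times> nat) list \<Rightarrow> real" where
  "path_cost ci p = (\<Sum>e\<in>set p. ci e)"

definition robust_cost ::
  "nat \<Rightarrow> (nat \<Rightarrow> nat \<times> nat \<Rightarrow> real) \<Rightarrow> (nat \<times> nat) list \<Rightarrow> real" where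
  "robust_cost k c p = Max ((\<lambda>i. path_cost (c i) p) ` {..<k})"

text \<open>Meaningful only if \<open>t\<close> is reachable from \<open>s\<close>, i.e. if the set of paths is nonempty.\<close>

definition OPT ::
  "nat pair_pre_digraph \<Rightarrow> nat \<Rightarrow> nat \<Rightarrow> nat \<Rightarrow> (nat \<Rightarrow> nat \<times> nat \<Rightarrow> real) \<Rightarrow> real" where
  "OPT G s t k c = Min (robust_cost k c ` st_paths G s t)"


section \<open>A randomized real RAM\<close>

text \<open>
  The memory has cells for natural numbers and cells for real numbers, both with indirect
  addressing. Every command takes one step, and so do the test of a condition, a fair coin flip
  and a procedure call; as the expressions in a program have constant size, this is the
  unit-cost measure up to a constant factor.

  To exclude the well-known artefacts of unit-cost models, there is no multiplication on natural
  numbers, no rounding from reals to natural numbers and no real constant other than the natural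
  numbers (so no information can be hidden in a constant of the program).
\<close>

datatype nexp = NConst nat | NGet nexp | NAdd nexp nexp | NSub nexp nexp

datatype rexp = RConst nat | RGet nexp
  | RAdd rexp rexp | RSub rexp rexp | RMul rexp rexp | RDiv rexp rexp

datatype bexp = NLess nexp nexp | RLess rexp rexp | BNot bexp | BAnd bexp bexp

datatype com =
    NSet nexp nexp
  | RSet nexp rexp
  | Flip nexp
  | Seq com com
  | Cond bexp com com
  | While bexp com
  | Call nat

type_synonym prog = "com list"

record mem =
  nmem :: "nat \<Rightarrow> nat"
  rmem :: "nat \<Rightarrow> real"

primrec nval :: "nexp \<Rightarrow> mem \<Rightarrow> nat" where
  "nval (NConst m) \<sigma> = m"
| "nval (NGet a) \<sigma> = nmem \<sigma> (nval a \<sigma>)"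
| "nval (NAdd a b) \<sigma> = nval a \<sigma> + nval b \<sigma>"
| "nval (NSub a b) \<sigma> = nval a \<sigma> - nval b \<sigma>"

primrec rval :: "rexp \<Rightarrow> mem \<Rightarrow> real" where
  "rval (RConst m) \<sigma> = real m"
| "rval (RGet a) \<sigma> = rmem \<sigma> (nval a \<sigma>)"
| "rval (RAdd a b) \<sigma> = rval a \<sigma> + rval b \<sigma>"
| "rval (RSub a b) \<sigma> = rval a \<sigma> - rval b \<sigma>"
| "rval (RMul a b) \<sigma> = rval a \<sigma> * rval b \<sigma>"
| "rval (RDiv a b) \<sigma> = rval a \<sigma> / rval b \<sigma>"

primrec bval :: "bexp \<Rightarrow> mem \<Rightarrow> bool" where
  "bval (NLess a b) \<sigma> \<longleftrightarrow> nval a \<sigma> < nval b \<sigma>"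
| "bval (RLess a b) \<sigma> \<longleftrightarrow> rval a \<sigma> < rval b \<sigma>"
| "bval (BNot b) \<sigma> \<longleftrightarrow> \<not> bval b \<sigma>"
| "bval (BAnd a b) \<sigma> \<longleftrightarrow> bval a \<sigma> \<and> bval b \<sigma>"

definition nput :: "nat \<Rightarrow> nat \<Rightarrow> mem \<Rightarrow> mem" where
  "nput a x \<sigma> = \<sigma>\<lparr>nmem := (nmem \<sigma>)(a := x)\<rparr>"

definition rput :: "nat \<Rightarrow> real \<Rightarrow> mem \<Rightarrow> mem" where
  "rput a x \<sigma> = \<sigma>\<lparr>rmem := (rmem \<sigma>)(a := x)\<rparr>"

text \<open>
  A configuration consists of the stack of commands still to be executed and the memory.
  The machine has halted when the stack is empty. A program is a list of (possibly mutually
  recursive, parameterless) procedures; a call of a nonexistent procedure does nothing.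
\<close>

type_synonym config = "com list \<times> mem"

fun step :: "prog \<Rightarrow> config \<Rightarrow> config pmf" where
  "step P ([], \<sigma>) = return_pmf ([], \<sigma>)"
| "step P (NSet a e # K, \<sigma>) = return_pmf (K, nput (nval a \<sigma>) (nval e \<sigma>) \<sigma>)"
| "step P (RSet a e # K, \<sigma>) = return_pmf (K, rput (nval a \<sigma>) (rval e \<sigma>) \<sigma>)"
| "step P (Flip a # K, \<sigma>) =
     map_pmf (\<lambda>b. (K, nput (nval a \<sigma>) (of_bool b) \<sigma>)) (bernoulli_pmf (1 / 2))"
| "step P (Seq x y # K, \<sigma>) = return_pmf (x # y # K, \<sigma>)"
| "step P (Cond b x y # K, \<sigma>) = return_pmf ((if bval b \<sigma> then x else y) # K, \<sigma>)"
| "step P (While b x # K, \<sigma>) = return_pmf (if bval b \<sigma> then x # While b x # K else K, \<sigma>)"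
| "step P (Call j # K, \<sigma>) = return_pmf (if j < length P then P ! j # K else K, \<sigma>)"

primrec steps :: "prog \<Rightarrow> nat \<Rightarrow> config \<Rightarrow> config pmf" where
  "steps P 0 \<kappa> = return_pmf \<kappa>"
| "steps P (Suc T) \<kappa> = bind_pmf (step P \<kappa>) (steps P T)"

text \<open>Execution starts with procedure \<open>0\<close>.\<close>

definition run :: "prog \<Rightarrow> mem \<Rightarrow> nat \<Rightarrow> config pmf" where
  "run P \<sigma> T = steps P T ([Call 0], \<sigma>)"

text \<open>Worst-case running time: the bound holds for all outcomes of the coin flips.\<close>

definition halts_within :: "prog \<Rightarrow> mem \<Rightarrow> nat \<Rightarrow> bool" where
  "halts_within P \<sigma> T \<longleftrightarrow> (\<forall>\<kappa>\<in>set_pmf (run P \<sigma> T). fst \<kappa> = [])"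


section \<open>Input and output\<close>

definition cells :: "'a::zero list \<Rightarrow> nat \<Rightarrow> 'a" where
  "cells xs a = (if a < length xs then xs ! a else 0)"

text \<open>
  The input consists of \<open>n\<close>, \<open>k\<close>, \<open>s\<close>, \<open>t\<close> and the adjacency matrix (row by row) in the natural
  number cells, and of the \<open>k\<close> cost matrices in the real cells, where non-arcs get the entry
  \<open>0\<close>. All other cells are \<open>0\<close>.
\<close>

definition input_mem ::
  "nat pair_pre_digraph \<Rightarrow> nat \<Rightarrow> nat \<Rightarrow> nat \<Rightarrow> (nat \<Rightarrow> nat \<times> nat \<Rightarrow> real) \<Rightarrow> mem" where
  "input_mem G s t k c = (let n = card (pverts G) in
     \<lparr>nmem = cells ([n, k, s, t] @ [of_bool ((u, v) \<in> parcs G). u \<leftarrow> [0..<n], v \<leftarrow> [0..<n]]),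
      rmem = cells [if (u, v) \<in> parcs G then c i (u, v) else 0.
                      i \<leftarrow> [0..<k], u \<leftarrow> [0..<n], v \<leftarrow> [0..<n]]\<rparr>)"

text \<open>
  The output is the sequence of vertices of a path: cell \<open>0\<close> contains the number \<open>l\<close> of arcs and
  the cells \<open>1, \<dots>, l + 1\<close> contain the vertices.
\<close>

definition output_path :: "config \<Rightarrow> (nat \<times> nat) list" where
  "output_path \<kappa> = (let N = nmem (snd \<kappa>) in map (\<lambda>j. (N (j + 1), N (j + 2))) [0..<N 0])"

end

theory Submission
  imports Defs
begin

text \<open>
  A deterministic recursive greedy algorithm suffices. For a guess \<open>\<theta>\<close> of the optimum, give agent
  \<open>i\<close> the weight \<open>\<Prod> (1 + c\<^sub>i(e) / (4 L \<theta>))\<close> over the arcs \<open>e\<close> of a walk, where \<open>2\<^sup>L \<ge> n\<close>, and let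
  the potential of a walk be the sum of the weights of all agents. To extend a walk by \<open>2\<^sup>j\<^sup>+\<^sup>1\<close>
  steps to \<open>v\<close>, try every midpoint \<open>m\<close>, extend recursively first to \<open>m\<close> and then to \<open>v\<close>, and keep the
  midpoint that leads to the smallest potential. If \<open>\<theta>\<close> is at least the optimum, then by induction
  the potential increases by a factor less than \<open>2\<close>, because every level of the recursion loses only
  a factor of \<open>1 + O(1 / L)\<close>. So every weight is below \<open>k + 1\<close>, and every agent pays
  \<open>O(L \<theta> log k)\<close>. The recursion has depth \<open>L\<close> and branches \<open>2 n + 2\<close> times per level.
\<close>

section \<open>Recursive greedy walks\<close>

text \<open>A maximum of \<open>k\<close> path costs has no optimal substructure, so the midpoint
  recursion cannot be exact. The product weight serves both ends of the argument: a further step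
  raises it by exactly its current value times the step cost, so increments can be compared linearly
  with those of an optimal path; and the finished product is at least the exponential of half the
  cost, so a weight below \<open>k + 1\<close> gives a logarithmic cost bound. Scaling by
  \<open>4 L \<theta>\<close> makes the optimal path cost at most \<eta> = 1 / (4 L) per agent. Then
  1 - j \<eta> stays at least 3 / 4 on all levels, and the potential, initially \<open>k\<close>,
  grows by at most k / (3 L). The test "potential below 2 k" is self-certifying: a guess that passes
  it yields the cost bound in terms of \<theta> even if \<theta> is below the optimum. So the least
  passing guess from a finite list is taken, without any monotonicity of the test. The machine adds
  its own obstacle: products of natural numbers must be built by addition, and at the start every
  cell of constant address may belong to the input.\<close>

fun step_sum :: "(nat \<Rightarrow> nat \<Rightarrow> real) \<Rightarrow> nat list \<Rightarrow> real" where
  "step_sum y (a # b # xs) = y a b + step_sum y (b # xs)"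
| "step_sum y _ = 0"

fun step_prod :: "(nat \<Rightarrow> nat \<Rightarrow> real) \<Rightarrow> nat list \<Rightarrow> real" where
  "step_prod y (a # b # xs) = (1 + y a b) * step_prod y (b # xs)"
| "step_prod y _ = 1"

section \<open>Costs and weights along walks\<close>

lemma step_sum_append:
  "xs \<noteq> [] \<Longrightarrow> step_sum y (xs @ zs) = step_sum y xs + step_sum y (last xs # zs)"
  by (induction y xs rule: step_sum.induct) auto

lemma step_prod_append:
  "xs \<noteq> [] \<Longrightarrow> step_prod y (xs @ zs) = step_prod y xs * step_prod y (last xs # zs)"
  by (induction y xs rule: step_prod.induct) auto

lemma step_prod_ge_1: "(\<And>a b. 0 \<le> y a b) \<Longrightarrow> 1 \<le> step_prod y xs"
proof (induction y xs rule: step_prod.induct)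
  case (1 y a b xs)
  have "1 * 1 \<le> (1 + y a b) * step_prod y (b # xs)"
    using 1 by (intro mult_mono) auto
  then show ?case by simp
qed auto

lemma step_sum_nonneg: "(\<And>a b. 0 \<le> y a b) \<Longrightarrow> 0 \<le> step_sum y xs"
  by (induction y xs rule: step_sum.induct) auto

text \<open>All factors are at least 1, so dropping the others can only decrease the product. This
  is what lets a single penalty step, with factor \<open>1 + k\<close>, violate the weight
  bound.\<close>

lemma step_prod_factor_le:
  assumes "\<And>a b. 0 \<le> y a b" "(a, b) \<in> set (zip xs (tl xs))"
  shows "1 + y a b \<le> step_prod y xs"
  using assms(2)
proof (induction xs rule: induct_list012)
  case (3 u v xs)
  have ge: "1 \<le> step_prod y (v # xs)" using assms(1) by (rule step_prod_ge_1)
  show ?case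
  proof (cases "(a, b) = (u, v)")
    case True
    have "(1 + y u v) * 1 \<le> (1 + y u v) * step_prod y (v # xs)"
      using ge assms(1)[of u v] by (intro mult_left_mono) auto
    with True show ?thesis by simp
  next
    case False
    then have "1 + y a b \<le> step_prod y (v # xs)" using 3(2,3) by auto
    also have "\<dots> \<le> (1 + y u v) * step_prod y (v # xs)"
      using ge assms(1)[of u v] by (simp add: algebra_simps)
    finally show ?thesis by simp
  qed
qed auto

text \<open>Rests on exp (x / 2) \<le> 1 + x for x between 0 and 1; it turns a bound on the weight
  into a cost bound of twice its logarithm. Steps of cost at most 1 are what remains once penalty
  steps have been excluded.\<close>

lemma exp_half_step_sum_le:
  assumes "\<And>a b. (a, b) \<in> set (zip xs (tl xs)) \<Longrightarrow> 0 \<le> y a b \<and> y a b \<le> 1"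
  shows "exp (step_sum y xs / 2) \<le> step_prod y xs"
  using assms
proof (induction xs rule: induct_list012)
  case (3 u v xs)
  have yb: "0 \<le> y u v" "y u v \<le> 1" using 3(3)[of u v] by simp_all
  have "exp (y u v / 2) \<le> 1 + y u v / 2 + (y u v / 2)\<^sup>2"
    using yb by (intro exp_bound) auto
  also have "(y u v / 2)\<^sup>2 \<le> y u v / 2"
    using mult_right_mono[OF yb(2) yb(1)] yb by (simp add: power2_eq_square)
  finally have e: "exp (y u v / 2) \<le> 1 + y u v" by simp
  have "exp (step_sum y (u # v # xs) / 2) = exp (y u v / 2) * exp (step_sum y (v # xs) / 2)"
    by (simp add: exp_add[symmetric] add_divide_distrib)
  also have "\<dots> \<le> (1 + y u v) * step_prod y (v # xs)"
  proof (rule mult_mono[OF e])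
    show "exp (step_sum y (v # xs) / 2) \<le> step_prod y (v # xs)"
      using 3(3) by (intro 3(2)) simp
  qed (use yb in auto)
  finally show ?case by simp
qed auto

primrec first_argmin :: "(nat \<Rightarrow> real) \<Rightarrow> nat \<Rightarrow> nat" where
  "first_argmin f 0 = 0"
| "first_argmin f (Suc m) =
     (if m = 0 \<or> f m < f (first_argmin f m) then m else first_argmin f m)"

lemma first_argmin_less: "0 < m \<Longrightarrow> first_argmin f m < m"
  by (induction m) (auto simp: less_Suc_eq)

lemma first_argmin_le: "m < n \<Longrightarrow> f (first_argmin f n) \<le> f m"
proof (induction n)
  case (Suc n)
  then show ?case by (cases "m = n") (auto simp: less_Suc_eq intro: order_trans)
qed simp

text \<open>\<open>val\<close> always sees the whole walk with its prefix \<open>xs\<close>, so the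
  second half is chosen in view of what the first half has cost each agent.\<close>

primrec greedy :: "(nat list \<Rightarrow> real) \<Rightarrow> nat \<Rightarrow> nat \<Rightarrow> nat list \<Rightarrow> nat \<Rightarrow> nat list" where
  "greedy val n 0 xs v = xs @ [v]"
| "greedy val n (Suc j) xs v =
     (let f = (\<lambda>m. greedy val n j (greedy val n j xs m) v)
      in f (first_argmin (\<lambda>m. val (f m)) n))"

lemma greedy_extends:
  assumes "0 < n"
  shows "\<exists>zs. greedy val n j xs v = xs @ zs @ [v] \<and> length zs + 1 = 2 ^ j \<and> set zs \<subseteq> {..<n}"
proof (induction j arbitrary: xs v)
  case 0
  show ?case by simp
next
  case (Suc j)
  define m where
    "m = first_argmin (\<lambda>m. val (greedy val n j (greedy val n j xs m) v)) n"
  have m: "m < n" unfolding m_def by (rule first_argmin_less[OF assms])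
  obtain z1 where z1: "greedy val n j xs m = xs @ z1 @ [m]" "length z1 + 1 = 2 ^ j"
    "set z1 \<subseteq> {..<n}" using Suc by blast
  obtain z2 where z2: "greedy val n j (greedy val n j xs m) v = (xs @ z1 @ [m]) @ z2 @ [v]"
    "length z2 + 1 = 2 ^ j" "set z2 \<subseteq> {..<n}" using Suc[of "greedy val n j xs m" v] z1(1) by auto
  have "greedy val n (Suc j) xs v = xs @ (z1 @ [m] @ z2) @ [v]"
    using z2 by (simp add: Let_def m_def[symmetric])
  with z1 z2 m show ?case by (intro exI[of _ "z1 @ [m] @ z2"]) auto
qed

definition potential :: "nat \<Rightarrow> (nat \<Rightarrow> nat \<Rightarrow> nat \<Rightarrow> real) \<Rightarrow> nat list \<Rightarrow> real" where
  "potential k y xs = (\<Sum>i<k. step_prod (y i) xs)"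

text \<open>
  The second half of the walk is judged by the weights that the first half has produced; since
  these weights exceed the original ones by the increase of the potential in the first half, and
  the second half of the reference walk has cost at most \<open>\<eta>\<close> for every agent, this costs only a
  factor of \<open>1 + \<eta> / (1 - j \<eta>)\<close> per level.
\<close>

lemma greedy_potential:
  fixes y :: "nat \<Rightarrow> nat \<Rightarrow> nat \<Rightarrow> real"
  assumes y: "\<And>i a b. 0 \<le> y i a b" and \<eta>: "0 \<le> \<eta>"
  shows "\<lbrakk>xs \<noteq> []; length ys = 2 ^ j; set ys \<subseteq> {..<n};
    \<And>i. i < k \<Longrightarrow> step_sum (y i) (last xs # ys) \<le> \<eta>; real j * \<eta> < 1\<rbrakk>
   \<Longrightarrow> potential k y (greedy (potential k y) n j xs (last ys)) - potential k y xs
      \<le> (\<Sum>i<k. step_prod (y i) xs * step_sum (y i) (last xs # ys)) / (1 - real j * \<eta>)"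
proof (induction j arbitrary: xs ys)
  case 0
  then obtain v where ys: "ys = [v]" by (auto simp: length_Suc_conv)
  \<comment> \<open>A single step raises each weight by exactly weight times step cost, so the bound
    holds with equality.\<close>
  show ?case using 0(1)
    by (simp add: ys potential_def step_prod_append sum_subtractf[symmetric] algebra_simps)
next
  case (Suc j)
  let ?g = "greedy (potential k y) n j" and ?\<Phi> = "potential k y"
  let ?p = "\<lambda>i xs. step_prod (y i) xs" and ?s = "\<lambda>i xs. step_sum (y i) xs"
  define b where "b = 1 / (1 - real j * \<eta>)"
  have j1: "real j * \<eta> + \<eta> < 1" using Suc.prems(5) by (simp add: algebra_simps)
  then have bpos: "0 < b" using \<eta> by (simp add: b_def)
  define ys1 where "ys1 = take (2 ^ j) ys"
  define ys2 where "ys2 = drop (2 ^ j) ys"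
  have ys: "ys = ys1 @ ys2" "length ys1 = 2 ^ j" "length ys2 = 2 ^ j"
    using Suc.prems(2) by (auto simp: ys1_def ys2_def)
  then have ne: "ys1 \<noteq> []" "ys2 \<noteq> []" by auto
  define m where "m = last ys1"
  define v where "v = last ys"
  have v: "v = last ys2" using ys ne by (simp add: v_def)
  have "m \<in> set ys1" using ne by (simp add: m_def)
  then have m: "m < n" using Suc.prems(3) ys(1) by auto
  let ?A = "?g xs m"
  have ex: "\<exists>zs. ?A = xs @ zs @ [m]" using greedy_extends[of n "?\<Phi>" j xs m] m by auto
  then have A: "?A \<noteq> []" "last ?A = m" by auto
  have split: "?s i (last xs # ys) = ?s i (last xs # ys1) + ?s i (m # ys2)" for i
    using step_sum_append[of "last xs # ys1" "y i" ys2] ne by (simp add: ys m_def)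
  have s1: "?s i (last xs # ys1) \<le> \<eta>" and s2: "?s i (m # ys2) \<le> \<eta>" if "i < k" for i
    using Suc.prems(4)[OF that] split[of i] step_sum_nonneg[of "y i" "last xs # ys1", OF y]
      step_sum_nonneg[of "y i" "m # ys2", OF y] by linarith+
  have jl: "real j * \<eta> < 1" using j1 \<eta> by linarith
  have 1: "?\<Phi> ?A - ?\<Phi> xs \<le> (\<Sum>i<k. ?p i xs * ?s i (last xs # ys1)) * b"
    using Suc.IH[OF Suc.prems(1) ys(2) _ s1 jl] Suc.prems(3) ys(1) by (simp add: m_def b_def)
  have 2: "?\<Phi> (?g ?A v) - ?\<Phi> ?A \<le> (\<Sum>i<k. ?p i ?A * ?s i (m # ys2)) * b"
    using Suc.IH[OF A(1) ys(3) _ _ jl] Suc.prems(3) ys(1) s2 A(2) by (simp add: v b_def)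
  have p0: "0 \<le> ?p i xs" for i using step_prod_ge_1[of "y i" xs, OF y] by linarith
  have mono: "?p i xs \<le> ?p i ?A" for i
  proof -
    obtain zs where zs: "?A = xs @ zs @ [m]" using ex by blast
    have "?p i xs * 1 \<le> ?p i xs * ?p i (last xs # zs @ [m])"
      using step_prod_ge_1[of "y i", OF y] p0 by (intro mult_left_mono) auto
    then show ?thesis using step_prod_append[OF Suc.prems(1), of "y i" "zs @ [m]"] zs by simp
  qed
  have "(\<Sum>i<k. (?p i ?A - ?p i xs) * ?s i (m # ys2)) \<le> (\<Sum>i<k. (?p i ?A - ?p i xs) * \<eta>)"
    using mono s2 by (intro sum_mono mult_left_mono) auto
  also have "\<dots> = (?\<Phi> ?A - ?\<Phi> xs) * \<eta>"
    by (simp only: potential_def sum_subtractf[symmetric] sum_distrib_right)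
  also have "\<dots> \<le> (\<Sum>i<k. ?p i xs * ?s i (last xs # ys1)) * b * \<eta>"
    using 1 \<eta> by (intro mult_right_mono) auto
  finally have "(\<Sum>i<k. (?p i ?A - ?p i xs) * ?s i (m # ys2))
      \<le> (\<Sum>i<k. ?p i xs * ?s i (last xs # ys1)) * b * \<eta>" .
  moreover have "(\<Sum>i<k. ?p i ?A * ?s i (m # ys2))
      = (\<Sum>i<k. ?p i xs * ?s i (m # ys2)) + (\<Sum>i<k. (?p i ?A - ?p i xs) * ?s i (m # ys2))"
    by (simp add: sum.distrib[symmetric] algebra_simps)
  ultimately have 3: "(\<Sum>i<k. ?p i ?A * ?s i (m # ys2))
      \<le> (\<Sum>i<k. ?p i xs * ?s i (m # ys2)) + (\<Sum>i<k. ?p i xs * ?s i (last xs # ys1)) * b * \<eta>"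
    by linarith
  define S1 where "S1 = (\<Sum>i<k. ?p i xs * ?s i (last xs # ys1))"
  define S2 where "S2 = (\<Sum>i<k. ?p i xs * ?s i (m # ys2))"
  have S: "0 \<le> S1" "0 \<le> S2" unfolding S1_def S2_def
    using y by (auto intro!: sum_nonneg mult_nonneg_nonneg p0 step_sum_nonneg)
  define b' where "b' = 1 / (1 - real (Suc j) * \<eta>)"
  \<comment> \<open>With z = 1 - j \<eta> this reads (z + \<eta>) / z^2 \<le> 1 / (z - \<eta>), that
    is, z^2 - \<eta>^2 \<le> z^2.\<close>
  have bb: "b * (1 + b * \<eta>) \<le> b'"
  proof -
    define z where "z = 1 - real j * \<eta>"
    have z: "z > 0" "z > \<eta>" using j1 \<eta> by (auto simp: z_def)
    have "b = 1 / z" by (simp add: b_def z_def)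
    then have "b * (1 + b * \<eta>) = (z + \<eta>) / (z * z)" using z by (simp add: field_simps)
    also have "\<dots> \<le> 1 / (z - \<eta>)" using z by (simp add: field_simps)
    also have "\<dots> = b'" by (simp add: b'_def z_def algebra_simps)
    finally show ?thesis .
  qed
  have "?\<Phi> (?g ?A v) - ?\<Phi> xs \<le> S1 * b + (S2 + S1 * b * \<eta>) * b"
    using 1 2 mult_right_mono[OF 3 less_imp_le[OF bpos]]
    unfolding S1_def[symmetric] S2_def[symmetric] by linarith
  also have "\<dots> = S1 * (b * (1 + b * \<eta>)) + S2 * b" by (simp add: algebra_simps)
  also have "\<dots> \<le> S1 * b' + S2 * b'"
  proof -
    have "b \<le> b * (1 + b * \<eta>)" using bpos \<eta> by (simp add: algebra_simps)
    then show ?thesis using bb S by (intro add_mono mult_left_mono) auto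
  qed
  also have "\<dots> = (\<Sum>i<k. ?p i xs * ?s i (last xs # ys)) / (1 - real (Suc j) * \<eta>)"
    by (simp add: S1_def S2_def b'_def split distrib_left sum.distrib add_divide_distrib)
  finally have fin: "?\<Phi> (?g ?A v) - ?\<Phi> xs \<le> \<dots>" .
  \<comment> \<open>The estimate so far concerns the midpoint \<open>m\<close> of the reference
    walk; the selected midpoint does at least as well.\<close>
  have "?\<Phi> (greedy ?\<Phi> n (Suc j) xs v) \<le> ?\<Phi> (?g ?A v)"
    using first_argmin_le[OF m, of "\<lambda>m. ?\<Phi> (?g (?g xs m) v)"] by (simp add: Let_def)
  with fin show ?case by (simp add: v_def)
qed


section \<open>Weakest preconditions with running time\<close>

text \<open>Quantifying over the remaining stack \<open>K\<close> makes executions composable. The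
  result is a point distribution, which suits code without coin flips.\<close>

definition bs :: "prog \<Rightarrow> com \<Rightarrow> mem \<Rightarrow> nat \<Rightarrow> mem \<Rightarrow> bool" where
  "bs P x \<sigma> T \<sigma>' \<longleftrightarrow> (\<forall>K. steps P T (x # K, \<sigma>) = return_pmf (K, \<sigma>'))"

text \<open>Total correctness with a time budget: \<open>bs\<close> counts steps exactly, while
  \<open>t\<close> is only an upper bound and may be rounded up at will.\<close>

definition wp :: "prog \<Rightarrow> com \<Rightarrow> nat \<Rightarrow> (mem \<Rightarrow> bool) \<Rightarrow> mem \<Rightarrow> bool" where
  "wp P x t Q \<sigma> \<longleftrightarrow> (\<exists>T\<le>t. \<exists>\<sigma>'. bs P x \<sigma> T \<sigma>' \<and> Q \<sigma>')"

lemma steps_add: "steps P (a + b) \<kappa> = bind_pmf (steps P a \<kappa>) (steps P b)"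
  by (induction a arbitrary: \<kappa>) (auto simp: bind_return_pmf bind_assoc_pmf intro!: bind_pmf_cong)

lemma steps_halted: "steps P T ([], \<sigma>) = return_pmf ([], \<sigma>)"
  by (induction T) (simp_all add: bind_return_pmf)

lemma wp_run:
  assumes "wp P (Call 0) t Q \<sigma>"
  obtains \<sigma>' where "run P \<sigma> t = return_pmf ([], \<sigma>')" "Q \<sigma>'"
proof -
  obtain T \<sigma>' where T: "T \<le> t" "bs P (Call 0) \<sigma> T \<sigma>'" "Q \<sigma>'"
    using assms by (auto simp: wp_def)
  \<comment> \<open>A halted configuration is a fixed point, so the rest of the budget can be idled
    away.\<close>
  have "run P \<sigma> (T + (t - T)) = return_pmf ([], \<sigma>')"
    using T(2) unfolding run_def steps_add by (simp add: bs_def bind_return_pmf steps_halted)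
  with T that show ?thesis by simp
qed

lemma wp_mono:
  "\<lbrakk>wp P x t Q \<sigma>; t \<le> t'; \<And>\<sigma>'. Q \<sigma>' \<Longrightarrow> Q' \<sigma>'\<rbrakk> \<Longrightarrow> wp P x t' Q' \<sigma>"
  unfolding wp_def by (meson order_trans)

lemma wp_Suc_stepI:
  assumes "\<And>K. step P (x # K, \<sigma>) = return_pmf (y # K, \<sigma>)" "wp P y t Q \<sigma>"
  shows "wp P x (Suc t) Q \<sigma>"
proof -
  obtain T \<sigma>' where T: "T \<le> t" "bs P y \<sigma> T \<sigma>'" "Q \<sigma>'" using assms(2) by (auto simp: wp_def)
  then have "bs P x \<sigma> (Suc T) \<sigma>'" using assms(1) by (simp add: bs_def bind_return_pmf)
  with T show ?thesis unfolding wp_def by (intro exI[of _ "Suc T"]) auto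
qed

lemma wp_Call: "\<lbrakk>j < length P; wp P (P ! j) t Q \<sigma>\<rbrakk> \<Longrightarrow> wp P (Call j) (Suc t) Q \<sigma>"
  by (rule wp_Suc_stepI) auto

lemma wp_Cond: "wp P (if bval b \<sigma> then x else y) t Q \<sigma> \<Longrightarrow> wp P (Cond b x y) (Suc t) Q \<sigma>"
  by (rule wp_Suc_stepI) auto

lemma bs_Seq: "\<lbrakk>bs P x \<sigma> T \<sigma>'; bs P y \<sigma>' T' \<sigma>''\<rbrakk> \<Longrightarrow> bs P (Seq x y) \<sigma> (Suc (T + T')) \<sigma>''"
  unfolding bs_def by (simp add: bind_return_pmf steps_add)

lemma wp_Seq:
  assumes "wp P x t (\<lambda>\<sigma>'. wp P y t' Q \<sigma>') \<sigma>"
  shows "wp P (Seq x y) (Suc (t + t')) Q \<sigma>"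
proof -
  obtain T \<sigma>' where 1: "T \<le> t" "bs P x \<sigma> T \<sigma>'" "wp P y t' Q \<sigma>'" using assms by (auto simp: wp_def)
  then obtain T' \<sigma>'' where 2: "T' \<le> t'" "bs P y \<sigma>' T' \<sigma>''" "Q \<sigma>''" by (auto simp: wp_def)
  have "bs P (Seq x y) \<sigma> (Suc (T + T')) \<sigma>''" using bs_Seq 1 2 by blast
  with 1 2 show ?thesis unfolding wp_def by (meson Suc_le_mono add_mono)
qed

lemma bs_While_False: "\<not> bval b \<sigma> \<Longrightarrow> bs P (While b x) \<sigma> (Suc 0) \<sigma>"
  by (simp add: bs_def bind_return_pmf)

lemma bs_While_True:
  "\<lbrakk>bval b \<sigma>; bs P x \<sigma> T \<sigma>'; bs P (While b x) \<sigma>' T' \<sigma>''\<rbrakk>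
   \<Longrightarrow> bs P (While b x) \<sigma> (Suc (T + T')) \<sigma>''"
  unfolding bs_def by (simp add: bind_return_pmf steps_add)

text \<open>The invariant is indexed by the number of completed iterations, of which there are
  exactly \<open>m\<close>. Each pays one step for its test, and the failing test pays the last one.
  The induction runs from \<open>m\<close> down to 0.\<close>

lemma wp_While:
  assumes "I 0 \<sigma>"
    and step: "\<And>i \<sigma>. i < m \<Longrightarrow> I i \<sigma> \<Longrightarrow> bval b \<sigma> \<and> wp P x t (I (Suc i)) \<sigma>"
    and exit: "\<And>\<sigma>. I m \<sigma> \<Longrightarrow> \<not> bval b \<sigma> \<and> Q \<sigma>"
  shows "wp P (While b x) (m * Suc t + 1) Q \<sigma>"
proof -
  have "wp P (While b x) ((m - i) * Suc t + 1) Q \<sigma>'" if "i \<le> m" "I i \<sigma>'" for i \<sigma>'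
    using that
  proof (induction i arbitrary: \<sigma>' rule: inc_induct)
    case base
    then have "bs P (While b x) \<sigma>' (Suc 0) \<sigma>'" "Q \<sigma>'" using exit by (auto intro!: bs_While_False)
    then show ?case unfolding wp_def by (intro exI[of _ "Suc 0"]) auto
  next
    case (step i)
    then have b: "bval b \<sigma>'" and "wp P x t (I (Suc i)) \<sigma>'" using assms(2) by auto
    then obtain T \<sigma>1 where 1: "T \<le> t" "bs P x \<sigma>' T \<sigma>1" "I (Suc i) \<sigma>1" by (auto simp: wp_def)
    from step.IH[OF 1(3)] obtain T' \<sigma>2 where 2: "T' \<le> (m - Suc i) * Suc t + 1"
      "bs P (While b x) \<sigma>1 T' \<sigma>2" "Q \<sigma>2" unfolding wp_def by blast
    have eq: "(m - i) * Suc t + 1 = Suc (t + ((m - Suc i) * Suc t + 1))"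
      using step by (simp add: Suc_diff_Suc[symmetric] del: mult_Suc_right)
    have "Suc (T + T') \<le> (m - i) * Suc t + 1" unfolding eq using 1 2 by simp
    with bs_While_True[OF b 1(2) 2(2)] 2(3) show ?case unfolding wp_def by blast
  qed
  from this[of 0 \<sigma>] assms(1) show ?thesis by simp
qed

section \<open>Symbolic execution of code without loops and calls\<close>

fun straight :: "com \<Rightarrow> bool" where
  "straight (NSet a e) = True"
| "straight (RSet a e) = True"
| "straight (Seq x y) = (straight x \<and> straight y)"
| "straight (Cond b x y) = (straight x \<and> straight y)"
| "straight _ = False"

fun exec :: "com \<Rightarrow> mem \<Rightarrow> mem" where
  "exec (NSet a e) \<sigma> = nput (nval a \<sigma>) (nval e \<sigma>) \<sigma>"
| "exec (RSet a e) \<sigma> = rput (nval a \<sigma>) (rval e \<sigma>) \<sigma>"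
| "exec (Seq x y) \<sigma> = exec y (exec x \<sigma>)"
| "exec (Cond b x y) \<sigma> = (if bval b \<sigma> then exec x \<sigma> else exec y \<sigma>)"
| "exec _ \<sigma> = \<sigma>"

fun duration :: "com \<Rightarrow> nat" where
  "duration (Seq x y) = Suc (duration x + duration y)"
| "duration (Cond b x y) = Suc (max (duration x) (duration y))"
| "duration _ = 1"

lemma wp_exec: "\<lbrakk>straight x; Q (exec x \<sigma>)\<rbrakk> \<Longrightarrow> wp P x (duration x) Q \<sigma>"
proof (induction x arbitrary: Q \<sigma>)
  case (Seq x y)
  then have "wp P x (duration x) (\<lambda>\<sigma>'. wp P y (duration y) Q \<sigma>') \<sigma>" by simp
  then show ?case by (simp add: wp_Seq)
next
  case (Cond b x y)
  then have "wp P (if bval b \<sigma> then x else y) (max (duration x) (duration y)) Q \<sigma>"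
    by (cases "bval b \<sigma>") (auto intro: wp_mono[of P x "duration x" Q] wp_mono[of P y "duration y" Q])
  then show ?case by (simp add: wp_Cond)
qed (auto simp: wp_def bs_def bind_return_pmf)


section \<open>Memory layout\<close>

definition twice :: "nexp \<Rightarrow> nexp" where "twice e = NAdd e e"

text \<open>The address F + x + 32 e of entry \<open>e\<close> of array \<open>x\<close>, with F
  read from cell 3: five doublings replace the multiplication. For real cells the base H is in cell
  4, and three doublings give the stride 8.\<close>

definition n_addr :: "nat \<Rightarrow> nexp \<Rightarrow> nexp" where
  "n_addr x e = NAdd (NGet (NConst 3)) (NAdd (NConst x) (twice (twice (twice (twice (twice e))))))"

definition r_addr :: "nat \<Rightarrow> nexp \<Rightarrow> nexp" where
  "r_addr x e = NAdd (NGet (NConst 4)) (NAdd (NConst x) (twice (twice (twice e))))"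

definition NA :: "nat \<Rightarrow> nexp \<Rightarrow> nexp" where "NA x e = NGet (n_addr x e)"
definition RA :: "nat \<Rightarrow> nexp \<Rightarrow> rexp" where "RA x e = RGet (r_addr x e)"
definition set_NA :: "nat \<Rightarrow> nexp \<Rightarrow> nexp \<Rightarrow> com" where "set_NA x e v = NSet (n_addr x e) v"
definition set_RA :: "nat \<Rightarrow> nexp \<Rightarrow> rexp \<Rightarrow> com" where "set_RA x e v = RSet (r_addr x e) v"

abbreviation NV :: "nat \<Rightarrow> nexp" where "NV x \<equiv> NA x (NConst 0)"
abbreviation RV :: "nat \<Rightarrow> rexp" where "RV x \<equiv> RA x (NConst 0)"
abbreviation set_NV :: "nat \<Rightarrow> nexp \<Rightarrow> com" where "set_NV x v \<equiv> set_NA x (NConst 0) v"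
abbreviation set_RV :: "nat \<Rightarrow> rexp \<Rightarrow> com" where "set_RV x v \<equiv> set_RA x (NConst 0) v"

definition unequal :: "nexp \<Rightarrow> nexp \<Rightarrow> bexp" where
  "unequal a b = BNot (BAnd (BNot (NLess a b)) (BNot (NLess b a)))"

lemma bval_unequal [simp]: "bval (unequal a b) \<sigma> \<longleftrightarrow> nval a \<sigma> \<noteq> nval b \<sigma>"
  by (auto simp: unequal_def)

lemma straight_set [simp]: "straight (set_NA x e v)" "straight (set_RA x e w)"
  by (simp_all add: set_NA_def set_RA_def)

lemma duration_set [simp]: "duration (set_NA x e v) = 1" "duration (set_RA x e w) = 1"
  by (simp_all add: set_NA_def set_RA_def)

text \<open>
  The input is left in place: it occupies natural number cells below \<open>F\<close> and real cells below
  \<open>H\<close>. Above them the memory is divided into 32 interleaved arrays of natural numbers and 8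
  interleaved arrays of real numbers. Cells \<open>3\<close> and \<open>4\<close> hold \<open>F\<close> and \<open>H\<close>; they are available
  since \<open>t\<close> is moved to the frame, and since the loop \<open>(0, 0)\<close>, stored in cell \<open>4\<close>, is irrelevant.
\<close>

definition layout ::
  "nat \<Rightarrow> nat \<Rightarrow> (nat \<Rightarrow> real) \<Rightarrow> (nat \<Rightarrow> nat) \<Rightarrow> (nat \<Rightarrow> nat \<Rightarrow> nat) \<Rightarrow> (nat \<Rightarrow> nat \<Rightarrow> real) \<Rightarrow> mem" where
  "layout F H rlow low N R =
     \<lparr>nmem = (\<lambda>a. if a < F then low a else N ((a - F) mod 32) ((a - F) div 32)),
      rmem = (\<lambda>a. if a < H then rlow a else R ((a - H) mod 8) ((a - H) div 8))\<rparr>"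

lemma nmem_layout [simp]: "a < F \<Longrightarrow> nmem (layout F H rlow low N R) a = low a"
  by (simp add: layout_def)

lemma rmem_layout [simp]: "a < H \<Longrightarrow> rmem (layout F H rlow low N R) a = rlow a"
  by (simp add: layout_def)

lemma nput_layout [simp]:
  "a < F \<Longrightarrow> nput a x (layout F H rlow low N R) = layout F H rlow (low(a := x)) N R"
  by (auto simp: layout_def nput_def)

lemma nval_twice [simp]: "nval (twice e) \<sigma> = 2 * nval e \<sigma>"
  by (simp add: twice_def)

lemma nval_NA [simp]:
  assumes "3 < F" "low 3 = F" "x < 32"
  shows "nval (NA x e) (layout F H rlow low N R) = N x (nval e (layout F H rlow low N R))"
  using assms by (simp add: NA_def n_addr_def) (simp add: layout_def)

lemma rval_RA [simp]:
  assumes "4 < F" "low 4 = H" "x < 8"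
  shows "rval (RA x e) (layout F H rlow low N R) = R x (nval e (layout F H rlow low N R))"
  using assms by (simp add: RA_def r_addr_def) (simp add: layout_def)

lemma exec_set_NA [simp]:
  assumes "3 < F" "low 3 = F" "x < 32"
  shows "exec (set_NA x e v) (layout F H rlow low N R) =
    layout F H rlow low (N(x := (N x)(nval e (layout F H rlow low N R) := nval v (layout F H rlow low N R)))) R"
proof -
  have "nput (F + (x + 32 * i)) z (layout F H rlow low N R) = layout F H rlow low (N(x := (N x)(i := z))) R"
    for i z
  proof -
    \<comment> \<open>As x < 32, an address in the frame determines array and index, so a write
      affects one entry of one array only.\<close>
    have "a = F + (x + 32 * i) \<longleftrightarrow> \<not> a < F \<and> (a - F) mod 32 = x \<and> (a - F) div 32 = i" for a
      using assms(3) by (auto simp: mod_less)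
    then show ?thesis by (auto simp: layout_def nput_def fun_eq_iff)
  qed
  then show ?thesis using assms by (simp add: set_NA_def n_addr_def)
qed

lemma exec_set_RA [simp]:
  assumes "4 < F" "low 4 = H" "x < 8"
  shows "exec (set_RA x e v) (layout F H rlow low N R) =
    layout F H rlow low N (R(x := (R x)(nval e (layout F H rlow low N R) := rval v (layout F H rlow low N R))))"
proof -
  have "rput (H + (x + 8 * i)) z (layout F H rlow low N R) = layout F H rlow low N (R(x := (R x)(i := z)))"
    for i z
  proof -
    have "a = H + (x + 8 * i) \<longleftrightarrow> \<not> a < H \<and> (a - H) mod 8 = x \<and> (a - H) div 8 = i" for a
      using assms(3) by (auto simp: mod_less)
    then show ?thesis by (auto simp: layout_def rput_def fun_eq_iff)
  qed
  then show ?thesis using assms by (simp add: set_RA_def r_addr_def)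
qed


section \<open>The recursive procedures\<close>

text \<open>
  The arrays \<open>a_dst\<close>, \<open>a_mid\<close>, \<open>a_arg\<close>, \<open>a_old\<close> and \<open>r_best\<close> serve as the stack of the recursion:
  indexed by its level, they hold the vertex to be reached, the current and the best midpoint, the
  length of the walk on entry, and the potential for the best midpoint. Entry \<open>u\<close> of \<open>a_row\<close> is
  \<open>u * n\<close>, as the machine cannot multiply natural numbers.
\<close>

abbreviation (input) "a_tgt \<equiv> (0::nat)"
abbreviation (input) "a_len \<equiv> (2::nat)"
abbreviation (input) "a_walk \<equiv> (3::nat)"
abbreviation (input) "a_lev \<equiv> (4::nat)"
abbreviation (input) "a_dst \<equiv> (5::nat)"
abbreviation (input) "a_mid \<equiv> (6::nat)"
abbreviation (input) "a_arg \<equiv> (7::nat)"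
abbreviation (input) "a_old \<equiv> (8::nat)"
abbreviation (input) "a_ag \<equiv> (9::nat)"
abbreviation (input) "a_off \<equiv> (10::nat)"
abbreviation (input) "a_pos \<equiv> (11::nat)"
abbreviation (input) "a_row \<equiv> (12::nat)"
abbreviation (input) "a_dep \<equiv> (13::nat)"
abbreviation (input) "a_out \<equiv> (14::nat)"
abbreviation (input) "a_olen \<equiv> (15::nat)"
abbreviation (input) "a_fnd \<equiv> (16::nat)"
abbreviation (input) "a_src \<equiv> (17::nat)"
abbreviation (input) "a_cell \<equiv> (18::nat)"
abbreviation (input) "a_mult \<equiv> (19::nat)"
abbreviation (input) "a_acc \<equiv> (20::nat)"

abbreviation (input) "r_th \<equiv> (0::nat)"
abbreviation (input) "r_den \<equiv> (2::nat)"
abbreviation (input) "r_k \<equiv> (3::nat)"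
abbreviation (input) "r_pot \<equiv> (4::nat)"
abbreviation (input) "r_prod \<equiv> (5::nat)"
abbreviation (input) "r_best \<equiv> (6::nat)"
abbreviation (input) "r_bth \<equiv> (7::nat)"

abbreviation "inc x \<equiv> set_NV x (NAdd (NV x) (NConst 1))"

definition nop :: com where "nop = set_NV a_pos (NV a_pos)"

text \<open>The row-major index \<open>e\<close> serves both the adjacency matrix, from cell 4 on,
  and the cost matrix of the agent, from \<open>a_off\<close> on. For \<theta> = 0 the quotient is
  0, since division by zero gives 0 on the machine just as in \<open>step_cost\<close>.\<close>

definition factor_code :: com where
  "factor_code =
    (let u = NA a_walk (NV a_pos); v = NA a_walk (NAdd (NV a_pos) (NConst 1));
         e = NAdd (NA a_row u) v; c = RGet (NAdd (NV a_off) e)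
     in Seq
       (Cond (unequal u v)
         (Cond (BAnd (NLess (NConst 0) (NGet (NAdd (NConst 4) e))) (BNot (RLess (RV r_th) c)))
           (set_RV r_prod (RMul (RV r_prod) (RAdd (RConst 1) (RDiv c (RMul (RV r_den) (RV r_th))))))
           (set_RV r_prod (RMul (RV r_prod) (RAdd (RConst 1) (RV r_k)))))
         nop)
       (inc a_pos))"

definition agent_code :: com where
  "agent_code =
    Seq (Seq (set_RV r_prod (RConst 1)) (set_NV a_pos (NConst 0)))
   (Seq (While (NLess (NAdd (NV a_pos) (NConst 1)) (NV a_len)) factor_code)
        (Seq (set_RV r_pot (RAdd (RV r_pot) (RV r_prod)))
        (Seq (inc a_ag) (set_NV a_off (NAdd (NV a_off) (NA a_row (NGet (NConst 0))))))))"

definition potential_code :: com where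
  "potential_code =
    Seq (Seq (set_RV r_pot (RConst 0)) (Seq (set_NV a_ag (NConst 0)) (set_NV a_off (NConst 0))))
        (While (NLess (NV a_ag) (NGet (NConst 1))) agent_code)"

definition try_code :: com where
  "try_code =
    Seq (Seq (set_NA a_dst (NSub (NV a_lev) (NConst 1)) (NA a_mid (NV a_lev)))
             (set_NV a_lev (NSub (NV a_lev) (NConst 1))))
   (Seq (Call 1)
   (Seq (set_NA a_dst (NV a_lev) (NA a_dst (NAdd (NV a_lev) (NConst 1))))
   (Seq (Call 1)
        (inc a_lev))))"

text \<open>Midpoint 0 is always recorded, as \<open>r_best\<close> may hold anything before it.
  Restoring \<open>a_len\<close> discards the trial extension.\<close>

definition update_code :: com where
  "update_code =
    Seq (Cond (BNot (BAnd (NLess (NConst 0) (NA a_mid (NV a_lev)))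
                          (BNot (RLess (RV r_pot) (RA r_best (NV a_lev))))))
          (Seq (set_RA r_best (NV a_lev) (RV r_pot))
               (set_NA a_arg (NV a_lev) (NA a_mid (NV a_lev))))
          nop)
   (Seq (set_NV a_len (NA a_old (NV a_lev)))
        (set_NA a_mid (NV a_lev) (NAdd (NA a_mid (NV a_lev)) (NConst 1))))"

text \<open>The recursion is repeated for the best midpoint, so that no walk needs to be copied.\<close>

definition greedy_code :: com where
  "greedy_code =
    Cond (NLess (NConst 0) (NV a_lev))
     (Seq (Seq (set_NA a_old (NV a_lev) (NV a_len))
          (Seq (set_NA a_arg (NV a_lev) (NConst 0)) (set_NA a_mid (NV a_lev) (NConst 0))))
     (Seq (While (NLess (NA a_mid (NV a_lev)) (NGet (NConst 0)))
             (Seq try_code (Seq (Call 2) update_code)))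
     (Seq (set_NA a_mid (NV a_lev) (NA a_arg (NV a_lev)))
          try_code)))
     (Seq (set_NA a_walk (NV a_len) (NA a_dst (NConst 0))) (inc a_len))"

definition walk_code :: com where
  "walk_code =
    Seq (Seq (set_NV a_len (NConst 1))
        (Seq (set_NA a_walk (NConst 0) (NGet (NConst 2)))
        (Seq (set_NV a_lev (NV a_dep))
             (set_NA a_dst (NV a_dep) (NV a_tgt)))))
        (Call 1)"

lemma wp_Seq_exec:
  "\<lbrakk>straight x; wp P y t Q (exec x \<sigma>)\<rbrakk> \<Longrightarrow> wp P (Seq x y) (Suc (duration x + t)) Q \<sigma>"
  by (intro wp_Seq wp_exec)

lemma wp_Seq_spec:
  "\<lbrakk>wp P x t R \<sigma>; \<And>\<sigma>'. R \<sigma>' \<Longrightarrow> wp P y t' Q \<sigma>'\<rbrakk> \<Longrightarrow> wp P (Seq x y) (Suc (t + t')) Q \<sigma>"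
  by (rule wp_Seq) (rule wp_mono[OF _ order_refl])

lemma wp_time: "\<lbrakk>wp P x t Q \<sigma>; t \<le> t'\<rbrakk> \<Longrightarrow> wp P x t' Q \<sigma>"
  by (rule wp_mono)

text \<open>
  Waiting is free, so all walks of the same level have the same length. Arcs that are missing or
  too expensive get the penalty \<open>k\<close>: a walk in which all weights are below \<open>k + 1\<close> avoids them.
\<close>

definition step_cost ::
  "(nat \<Rightarrow> nat \<Rightarrow> bool) \<Rightarrow> (nat \<Rightarrow> nat \<Rightarrow> nat \<Rightarrow> real) \<Rightarrow> nat \<Rightarrow> real \<Rightarrow> real \<Rightarrow> nat \<Rightarrow> nat \<Rightarrow> nat \<Rightarrow> real" where
  "step_cost E cost k D \<theta> i u v =
    (if u = v then 0 else if E u v \<and> cost i u v \<le> \<theta> then cost i u v / (D * \<theta>) else real k)"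

text \<open>The program is separated from graph theory: \<open>E\<close> and \<open>cost\<close> are
  just the contents of the input cells. \<open>low\<close> shows these cells after the setup, with F
  and H in cells 3 and 4; therefore \<open>low_E\<close> speaks of distinct vertices only, which
  keeps the overwritten cell 4 out of it.\<close>

locale machine =
  fixes F H n k s t L :: nat and D :: real and rlow low P
    and E :: "nat \<Rightarrow> nat \<Rightarrow> bool" and cost :: "nat \<Rightarrow> nat \<Rightarrow> nat \<Rightarrow> real"
  assumes F [simp]: "4 < F" "4 + n * n \<le> F" and H: "H = k * (n * n)"
    and n: "0 < n" and s: "s < n" and t: "t < n"
    and low [simp]: "low 0 = n" "low (Suc 0) = k" "low 2 = s" "low 3 = F" "low 4 = H"
    and low_E: "\<And>u v. \<lbrakk>u < n; v < n; u \<noteq> v\<rbrakk> \<Longrightarrow> low (4 + (u * n + v)) = of_bool (E u v)"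
    and rlow_cost: "\<And>i u v. \<lbrakk>i < k; u < n; v < n\<rbrakk> \<Longrightarrow>
      rlow (i * (n * n) + (u * n + v)) = (if E u v then cost i u v else 0)"
    and P [simp]: "1 < length P" "2 < length P" "P ! 1 = greedy_code" "P ! 2 = potential_code"
begin

abbreviation st where "st \<equiv> layout F H rlow low"

lemma st_exI: "Q N R \<Longrightarrow> \<exists>N' R'. st N R = st N' R' \<and> Q N' R'"
  by blast

lemma frame_above_header [simp]: "3 < F" "2 < F" "Suc 0 < F" "0 < F"
  using F(1) by linarith+

text \<open>The row table includes index \<open>n\<close>: this entry is n * n, the distance between
  the cost matrices of consecutive agents.\<close>

definition ready :: "(nat \<Rightarrow> nat \<Rightarrow> nat) \<Rightarrow> (nat \<Rightarrow> nat \<Rightarrow> real) \<Rightarrow> bool" where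
  "ready N R \<longleftrightarrow> (\<forall>u\<le>n. N a_row u = u * n) \<and> N a_dep 0 = L \<and> N a_tgt 0 = t \<and>
     R r_den 0 = D \<and> R r_k 0 = real k"

definition walk :: "(nat \<Rightarrow> nat \<Rightarrow> nat) \<Rightarrow> nat list \<Rightarrow> bool" where
  "walk N xs \<longleftrightarrow> N a_len 0 = length xs \<and> (\<forall>p<length xs. N a_walk p = xs ! p) \<and> set xs \<subseteq> {..<n}"

abbreviation \<Phi> :: "real \<Rightarrow> nat list \<Rightarrow> real" where
  "\<Phi> \<theta> \<equiv> potential k (step_cost E cost k D \<theta>)"

section \<open>Evaluation of the potential by the machine\<close>

lemma cell_bound:
  assumes "u < n" "v < n"
  shows "u * n + v < n * n"
proof -
  have "u * n + v < Suc u * n" using assms(2) by simp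
  also have "\<dots> \<le> n * n" using assms(1) by (intro mult_le_mono1) simp
  finally show ?thesis .
qed

lemma exec_factor:
  assumes "ready N R" "walk N xs" "N a_pos 0 = p" "Suc p < length xs" "N a_off 0 = i * (n * n)" "i < k"
  shows "exec factor_code (st N R) = st (N(a_pos := (N a_pos)(0 := Suc p)))
    (R(r_prod := (R r_prod)(0 := R r_prod 0 * (1 + step_cost E cost k D (R r_th 0) i (xs ! p) (xs ! Suc p)))))"
proof -
  let ?u = "xs ! p" and ?v = "xs ! Suc p"
  have w: "N a_walk p = ?u" "N a_walk (Suc p) = ?v" and uv: "?u < n" "?v < n"
    using assms(2,4) by (auto simp: walk_def subset_iff)
  have row: "N a_row ?u = ?u * n" using assms(1) uv by (simp add: ready_def)
  note cb = cell_bound[OF uv]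
  \<comment> \<open>Both reads must be shown to hit the input region, below F and below H, for
    otherwise they would return frame entries.\<close>
  have a: "4 + (?u * n + ?v) < F" using cb F(2) by linarith
  have "i * (n * n) + (?u * n + ?v) < Suc i * (n * n)" using cb by simp
  also have "\<dots> \<le> H" unfolding H using assms(6) by (intro mult_le_mono1) simp
  finally have b: "i * (n * n) + (?u * n + ?v) < H" .
  have kD: "R r_k 0 = real k" "R r_den 0 = D" using assms(1) by (simp_all add: ready_def)
  show ?thesis
    using assms(3,5) a b low_E[OF uv] rlow_cost[OF assms(6) uv]
    by (auto simp: factor_code_def Let_def w row nop_def step_cost_def kD not_less)
qed

lemma straight_factor: "straight factor_code" "duration factor_code = 5"
  by (simp_all add: factor_code_def Let_def nop_def)

lemma step_prod_take:
  "Suc p < length xs \<Longrightarrow>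
    step_prod y (take (Suc (Suc p)) xs) = step_prod y (take (Suc p) xs) * (1 + y (xs ! p) (xs ! Suc p))"
  using step_prod_append[of "take (Suc p) xs" y "[xs ! Suc p]"]
  by (cases "xs = []") (simp_all add: take_Suc_conv_app_nth[of "Suc p"] last_conv_nth min_def)

lemma wp_agent:
  assumes "ready N R" "walk N xs" "xs \<noteq> []" "length xs \<le> B" "N a_ag 0 = i" "N a_off 0 = i * (n * n)" "i < k"
  shows "wp P agent_code (10 * B + 20) (\<lambda>\<sigma>. \<exists>N' R'. \<sigma> = st N' R' \<and>
    (\<forall>x. x \<notin> {a_ag, a_off, a_pos} \<longrightarrow> N' x = N x) \<and> (\<forall>x. x \<notin> {r_pot, r_prod} \<longrightarrow> R' x = R x) \<and>
    N' a_ag 0 = Suc i \<and> N' a_off 0 = Suc i * (n * n) \<and>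
    R' r_pot 0 = R r_pot 0 + step_prod (step_cost E cost k D (R r_th 0) i) xs) (st N R)"
proof -
  let ?y = "step_cost E cost k D (R r_th 0) i"
  define NI where "NI p = N(a_pos := (N a_pos)(0 := p))" for p
  \<comment> \<open>After \<open>p\<close> steps the product is the weight of the prefix with p + 1
    vertices; the prefix with one vertex has weight 1.\<close>
  define RI where "RI p = R(r_prod := (R r_prod)(0 := step_prod ?y (take (Suc p) xs)))" for p
  define I where "I p \<sigma> \<longleftrightarrow> \<sigma> = st (NI p) (RI p)" for p \<sigma>
  have len: "N a_len 0 = length xs" using assms(2) by (simp add: walk_def)
  have NR: "ready (NI p) (RI p)" "walk (NI p) xs" for p
    using assms(1,2) by (auto simp: NI_def RI_def ready_def walk_def)
  have loop: "wp P (While (NLess (NAdd (NV a_pos) (NConst 1)) (NV a_len)) factor_code)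
      ((length xs - 1) * Suc 5 + 1) (I (length xs - 1)) (st (NI 0) (RI 0))"
  proof (rule wp_While)
    show "I 0 (st (NI 0) (RI 0))" by (simp add: I_def)
  next
    fix p \<sigma> assume p: "p < length xs - 1" "I p \<sigma>"
    have sp: "Suc p < length xs" using p by simp
    have "exec factor_code (st (NI p) (RI p)) = st (NI (Suc p)) (RI (Suc p))"
      using exec_factor[OF NR _ sp _ assms(7), of p] assms(6) step_prod_take[OF sp, of ?y]
      by (simp add: NI_def RI_def)
    then show "bval (NLess (NAdd (NV a_pos) (NConst 1)) (NV a_len)) \<sigma> \<and> wp P factor_code 5 (I (Suc p)) \<sigma>"
      using p sp wp_exec[OF straight_factor(1), of "I (Suc p)" \<sigma> P] straight_factor(2)
      by (simp add: I_def NI_def len)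
  next
    fix \<sigma> assume "I (length xs - 1) \<sigma>"
    then show "\<not> bval (NLess (NAdd (NV a_pos) (NConst 1)) (NV a_len)) \<sigma> \<and> I (length xs - 1) \<sigma>"
      using assms(3) by (simp add: I_def NI_def len)
  qed
  have "step_prod ?y (take (Suc 0) xs) = 1" using assms(3) by (cases xs) auto
  then have init: "exec (Seq (set_RV r_prod (RConst 1)) (set_NV a_pos (NConst 0))) (st N R) = st (NI 0) (RI 0)"
    by (simp add: NI_def RI_def)
  show ?thesis unfolding agent_code_def
    apply (rule wp_time)
     apply (rule wp_Seq_exec, simp)
     apply (rule wp_Seq_spec)
      apply (subst init, rule loop)
     apply (rule wp_exec, simp)
    subgoal
      using assms n by (simp add: I_def NI_def RI_def ready_def, intro st_exI) simp
    using assms(4) by simp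
qed

lemma wp_potential:
  assumes "ready N R" "walk N xs" "xs \<noteq> []" "length xs \<le> B"
  shows "wp P (Call 2) (k * (10 * B + 21) + 10) (\<lambda>\<sigma>. \<exists>N' R'. \<sigma> = st N' R' \<and>
    (\<forall>x. x \<notin> {a_ag, a_off, a_pos} \<longrightarrow> N' x = N x) \<and> (\<forall>x. x \<notin> {r_pot, r_prod} \<longrightarrow> R' x = R x) \<and>
    R' r_pot 0 = \<Phi> (R r_th 0) xs) (st N R)"
proof -
  let ?y = "step_cost E cost k D (R r_th 0)"
  define I where "I i \<sigma> \<longleftrightarrow> (\<exists>N' R'. \<sigma> = st N' R' \<and>
    (\<forall>x. x \<notin> {a_ag, a_off, a_pos} \<longrightarrow> N' x = N x) \<and> (\<forall>x. x \<notin> {r_pot, r_prod} \<longrightarrow> R' x = R x) \<and>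
    N' a_ag 0 = i \<and> N' a_off 0 = i * (n * n) \<and> R' r_pot 0 = (\<Sum>j<i. step_prod (?y j) xs))" for i \<sigma>
  have "wp P (While (NLess (NV a_ag) (NGet (NConst 1))) agent_code) (k * Suc (10 * B + 20) + 1) (I k) \<sigma>"
    if "I 0 \<sigma>" for \<sigma>
  proof (rule wp_While[of I, OF that])
    fix i \<sigma> assume i: "i < k" "I i \<sigma>"
    then obtain N' R' where NR: "\<sigma> = st N' R'" "\<forall>x. x \<notin> {a_ag, a_off, a_pos} \<longrightarrow> N' x = N x"
      "\<forall>x. x \<notin> {r_pot, r_prod} \<longrightarrow> R' x = R x" "N' a_ag 0 = i" "N' a_off 0 = i * (n * n)"
      "R' r_pot 0 = (\<Sum>j<i. step_prod (?y j) xs)" by (auto simp: I_def)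
    have r: "ready N' R'" "walk N' xs" using assms(1,2) NR(2,3) by (simp_all add: ready_def walk_def)
    have th: "R' r_th 0 = R r_th 0" using NR(3) by simp
    have "wp P agent_code (10 * B + 20) (I (Suc i)) (st N' R')"
      using wp_agent[OF r assms(3,4) NR(4,5) i(1)]
    proof (rule wp_mono)
      fix \<sigma>' assume "\<exists>N'' R''. \<sigma>' = st N'' R'' \<and>
        (\<forall>x. x \<notin> {a_ag, a_off, a_pos} \<longrightarrow> N'' x = N' x) \<and> (\<forall>x. x \<notin> {r_pot, r_prod} \<longrightarrow> R'' x = R' x) \<and>
        N'' a_ag 0 = Suc i \<and> N'' a_off 0 = Suc i * (n * n) \<and>
        R'' r_pot 0 = R' r_pot 0 + step_prod (step_cost E cost k D (R' r_th 0) i) xs"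
      then obtain N'' R'' where "\<sigma>' = st N'' R''"
        "\<forall>x. x \<notin> {a_ag, a_off, a_pos} \<longrightarrow> N'' x = N' x" "\<forall>x. x \<notin> {r_pot, r_prod} \<longrightarrow> R'' x = R' x"
        "N'' a_ag 0 = Suc i" "N'' a_off 0 = Suc i * (n * n)"
        "R'' r_pot 0 = R' r_pot 0 + step_prod (step_cost E cost k D (R' r_th 0) i) xs" by blast
      then show "I (Suc i) \<sigma>'" using NR(2,3,6) th unfolding I_def
        by (intro exI[of _ N''] exI[of _ R'']) simp
    qed simp
    then show "bval (NLess (NV a_ag) (NGet (NConst 1))) \<sigma> \<and> wp P agent_code (10 * B + 20) (I (Suc i)) \<sigma>"
      using NR i by simp
  next
    fix \<sigma> assume "I k \<sigma>"
    then show "\<not> bval (NLess (NV a_ag) (NGet (NConst 1))) \<sigma> \<and> I k \<sigma>" by (auto simp: I_def)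
  qed
  note loop = this
  show ?thesis
    apply (rule wp_time)
     apply (rule wp_Call, simp, simp only: P potential_code_def)
     apply (rule wp_Seq_exec, simp)
     apply (rule wp_mono[OF loop])
    subgoal by (simp add: I_def, rule st_exI, simp)
      apply (rule order_refl)
    subgoal by (auto simp: I_def potential_def)
    by (simp add: algebra_simps)
qed

text \<open>The frame condition of a call at level \<open>j\<close>: the stack entries of all
  callers, which have higher levels, survive, and so does everything that is neither stack nor
  scratch space of the recursion.\<close>

definition keeps :: "nat \<Rightarrow> (nat \<Rightarrow> nat \<Rightarrow> nat) \<Rightarrow> (nat \<Rightarrow> nat \<Rightarrow> real) \<Rightarrow> (nat \<Rightarrow> nat \<Rightarrow> nat) \<Rightarrow> (nat \<Rightarrow> nat \<Rightarrow> real) \<Rightarrow> bool" where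
  "keeps j N R N' R' \<longleftrightarrow>
    (\<forall>x. x \<notin> {a_len, a_walk, a_lev, a_dst, a_mid, a_arg, a_old, a_ag, a_off, a_pos} \<longrightarrow> N' x = N x) \<and>
    (\<forall>i>j. N' a_dst i = N a_dst i \<and> N' a_mid i = N a_mid i \<and> N' a_arg i = N a_arg i \<and>
       N' a_old i = N a_old i \<and> R' r_best i = R r_best i) \<and>
    (\<forall>x. x \<notin> {r_pot, r_prod, r_best} \<longrightarrow> R' x = R x)"

lemma keeps_trans: "\<lbrakk>keeps j N R N' R'; keeps j N' R' N'' R''\<rbrakk> \<Longrightarrow> keeps j N R N'' R''"
  by (simp add: keeps_def)

lemma keeps_mono: "\<lbrakk>keeps j N R N' R'; j \<le> j'\<rbrakk> \<Longrightarrow> keeps j' N R N' R'"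
  by (simp add: keeps_def)

lemma keeps_ready: "\<lbrakk>keeps j N R N' R'; ready N R\<rbrakk> \<Longrightarrow> ready N' R'"
  by (simp add: keeps_def ready_def)

lemma keeps_th: "keeps j N R N' R' \<Longrightarrow> R' r_th 0 = R r_th 0"
  by (simp add: keeps_def)

definition greedy_post where
  "greedy_post j xs N R zs \<sigma> \<longleftrightarrow>
     (\<exists>N' R'. \<sigma> = st N' R' \<and> keeps j N R N' R' \<and> walk N' zs \<and> N' a_lev 0 = N a_lev 0)"

text \<open>Ranges over all memories and walks so that it can be the induction hypothesis for both
  recursive calls. The bound \<open>B\<close> on the final length makes the time of every potential
  evaluation uniform.\<close>

definition greedy_correct :: "nat \<Rightarrow> nat \<Rightarrow> nat \<Rightarrow> bool" where
  "greedy_correct B T j \<longleftrightarrow> (\<forall>N R xs v. ready N R \<and> walk N xs \<and> xs \<noteq> [] \<and> length xs + 2 ^ j \<le> B \<and>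
     N a_lev 0 = j \<and> N a_dst j = v \<and> v < n \<longrightarrow>
     wp P (Call 1) T (greedy_post j xs N R (greedy (\<Phi> (R r_th 0)) n j xs v)) (st N R))"

lemma greedy_correctD:
  "\<lbrakk>greedy_correct B T j; ready N R; walk N xs; xs \<noteq> []; length xs + 2 ^ j \<le> B; N a_lev 0 = j;
    N a_dst j = v; v < n\<rbrakk> \<Longrightarrow> wp P (Call 1) T (greedy_post j xs N R (greedy (\<Phi> (R r_th 0)) n j xs v)) (st N R)"
  unfolding greedy_correct_def by blast

lemma greedy_correct_mono:
  assumes "greedy_correct B T j" "T \<le> T'"
  shows "greedy_correct B T' j"
  unfolding greedy_correct_def
  by (intro allI impI, elim conjE, rule wp_time[OF greedy_correctD[OF assms(1)] assms(2)])

lemma greedy_length: "length (greedy val n j xs v) = length xs + 2 ^ j"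
  and greedy_take: "take (length xs) (greedy val n j xs v) = xs"
  using greedy_extends[OF n, of val j xs v] by auto

lemma wp_try:
  assumes g: "greedy_correct B T j" and r: "ready N R" "walk N xs" "xs \<noteq> []"
    and B: "length xs + 2 ^ Suc j \<le> B" and lev: "N a_lev 0 = Suc j"
    and m: "N a_mid (Suc j) = m" "m < n" and v: "N a_dst (Suc j) = v" "v < n"
  shows "wp P try_code (2 * T + 10) (greedy_post j xs N R
    (let val = \<Phi> (R r_th 0) in greedy val n j (greedy val n j xs m) v)) (st N R)"
proof -
  let ?val = "\<Phi> (R r_th 0)"
  let ?ys = "greedy ?val n j xs m"
  define N1 where "N1 = N(a_dst := (N a_dst)(j := m), a_lev := (N a_lev)(0 := j))"
  have pre: "exec (Seq (set_NA a_dst (NSub (NV a_lev) (NConst 1)) (NA a_mid (NV a_lev)))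
      (set_NV a_lev (NSub (NV a_lev) (NConst 1)))) (st N R) = st N1 R"
    using lev m by (simp add: N1_def)
  have k1: "keeps j N R N1 R" by (simp add: N1_def keeps_def)
  have w1: "walk N1 xs" using r(2) by (simp add: N1_def walk_def)
  have c1: "wp P (Call 1) T (greedy_post j xs N1 R ?ys) (st N1 R)"
    by (rule greedy_correctD[OF g keeps_ready[OF k1 r(1)] w1 r(3)]) (use B m in \<open>simp_all add: N1_def\<close>)
  have c2: "wp P (Seq (set_NA a_dst (NV a_lev) (NA a_dst (NAdd (NV a_lev) (NConst 1))))
      (Seq (Call 1) (inc a_lev))) (2 + (Suc (T + 1))) (greedy_post j xs N R (greedy ?val n j ?ys v)) \<sigma>"
    if "greedy_post j xs N1 R ?ys \<sigma>" for \<sigma>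
  proof -
    obtain N2 R2 where 2: "\<sigma> = st N2 R2" "keeps j N1 R N2 R2" "walk N2 ?ys" "N2 a_lev 0 = N1 a_lev 0"
      using \<open>greedy_post j xs N1 R ?ys \<sigma>\<close> unfolding greedy_post_def by blast
    define N3 where "N3 = N2(a_dst := (N2 a_dst)(j := v))"
    have l2: "N2 a_lev 0 = j" using 2(4) by (simp add: N1_def)
    have "N2 a_dst (Suc j) = v" using 2(2) v by (simp add: keeps_def N1_def)
    then have pre2: "exec (set_NA a_dst (NV a_lev) (NA a_dst (NAdd (NV a_lev) (NConst 1)))) \<sigma> = st N3 R2"
      using l2 by (simp add: 2(1) N3_def)
    have k3: "keeps j N R N3 R2"
      by (rule keeps_trans[OF k1], rule keeps_trans[OF 2(2)]) (simp add: N3_def keeps_def)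
    have w3: "walk N3 ?ys" using 2(3) by (simp add: N3_def walk_def)
    have th: "R2 r_th 0 = R r_th 0" using keeps_th[OF k3] .
    have c3: "wp P (Call 1) T (greedy_post j ?ys N3 R2 (greedy ?val n j ?ys v)) (st N3 R2)"
    proof -
      have len: "length ?ys = length xs + 2 ^ j" by (rule greedy_length)
      then have "?ys \<noteq> []" using r(3) by auto
      moreover have "length ?ys + 2 ^ j \<le> B" using B len by simp
      moreover have "N3 a_lev 0 = j" "N3 a_dst j = v" using l2 by (simp_all add: N3_def)
      ultimately show ?thesis
        using greedy_correctD[OF g keeps_ready[OF k3 r(1)] w3, of v] v(2) unfolding th by blast
    qed
    have "wp P (inc a_lev) 1 (greedy_post j xs N R (greedy ?val n j ?ys v)) \<sigma>'"
      if "greedy_post j ?ys N3 R2 (greedy ?val n j ?ys v) \<sigma>'" for \<sigma>'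
    proof -
      obtain N4 R4 where 4: "\<sigma>' = st N4 R4" "keeps j N3 R2 N4 R4" "walk N4 (greedy ?val n j ?ys v)"
        "N4 a_lev 0 = N3 a_lev 0"
        using \<open>greedy_post j ?ys N3 R2 (greedy ?val n j ?ys v) \<sigma>'\<close> unfolding greedy_post_def by blast
      have l4: "N4 a_lev 0 = j" using 4(4) l2 by (simp add: N3_def)
      define N5 where "N5 = N4(a_lev := (N4 a_lev)(0 := Suc j))"
      have k5: "keeps j N R N5 R4"
        by (rule keeps_trans[OF k3], rule keeps_trans[OF 4(2)]) (simp add: N5_def keeps_def)
      have "exec (inc a_lev) \<sigma>' = st N5 R4" using 4(1) l4 by (simp add: N5_def)
      moreover have "greedy_post j xs N R (greedy ?val n j ?ys v) (st N5 R4)"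
        using k5 4(3) lev unfolding greedy_post_def
        by (intro exI[of _ N5] exI[of _ R4]) (simp add: N5_def walk_def)
      ultimately show ?thesis using wp_exec[of "inc a_lev" _ \<sigma>' P] by simp
    qed
    then have "wp P (Seq (Call 1) (inc a_lev)) (Suc (T + 1)) (greedy_post j xs N R (greedy ?val n j ?ys v)) (st N3 R2)"
      by (rule wp_Seq_spec[OF c3])
    from wp_Seq_exec[of "set_NA a_dst (NV a_lev) (NA a_dst (NAdd (NV a_lev) (NConst 1)))", OF _ this[folded pre2]]
    show ?thesis by simp
  qed
  show ?thesis unfolding try_code_def Let_def
    apply (rule wp_time)
     apply (rule wp_Seq_exec, simp)
     apply (subst pre)
     apply (rule wp_Seq_spec[OF c1 c2], assumption)
    by simp
qed

text \<open>Each of the \<open>n\<close> trials costs two recursive calls and one potential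
  evaluation; two more calls rebuild the walk through the best midpoint.\<close>

lemma wp_greedy_step:
  assumes g: "greedy_correct B T j"
  shows "greedy_correct B (n * (2 * T + k * (10 * B + 21) + 40) + 2 * T + 40) (Suc j)"
  unfolding greedy_correct_def
proof (intro allI impI, elim conjE)
  fix N R xs v
  assume r: "ready N R" "walk N xs" "xs \<noteq> []" and B: "length xs + 2 ^ Suc j \<le> B"
    and lev: "N a_lev 0 = Suc j" and v: "N a_dst (Suc j) = v" "v < n"
  let ?val = "\<Phi> (R r_th 0)" and ?j = "Suc j"
  define f where "f m = greedy ?val n j (greedy ?val n j xs m) v" for m
  \<comment> \<open>The code replaces its record only on strict improvement, the same rule for ties
    as in \<open>first_argmin\<close>; so machine and function agree on the midpoint, not merely on
    the potential.\<close>
  define best where "best m = first_argmin (\<lambda>m. ?val (f m)) m" for m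
  define N1 where "N1 = N(a_old := (N a_old)(?j := length xs), a_arg := (N a_arg)(?j := 0), a_mid := (N a_mid)(?j := 0))"
  define I where "I m \<sigma> \<longleftrightarrow> (\<exists>N' R'. \<sigma> = st N' R' \<and> keeps ?j N R N' R' \<and> walk N' xs \<and> N' a_lev 0 = ?j \<and>
     N' a_dst ?j = v \<and> N' a_mid ?j = m \<and> N' a_old ?j = length xs \<and> N' a_arg ?j = best m \<and>
     (0 < m \<longrightarrow> R' r_best ?j = ?val (f (best m))))" for m \<sigma>
  have init: "exec (Seq (set_NA a_old (NV a_lev) (NV a_len))
      (Seq (set_NA a_arg (NV a_lev) (NConst 0)) (set_NA a_mid (NV a_lev) (NConst 0)))) (st N R) = st N1 R"
    using r(2) lev by (simp add: N1_def walk_def)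
  have I0: "I 0 (st N1 R)"
    unfolding I_def by (rule st_exI) (use r(2) lev v in \<open>simp add: N1_def keeps_def walk_def best_def\<close>)
  let ?body = "Seq try_code (Seq (Call 2) update_code)"
  have body: "wp P ?body (2 * T + k * (10 * B + 21) + 39) (I (Suc m)) \<sigma>" if m: "m < n" and I: "I m \<sigma>" for m \<sigma>
  proof -
    obtain N' R' where 1: "\<sigma> = st N' R'" "keeps ?j N R N' R'" "walk N' xs" "N' a_lev 0 = ?j"
      "N' a_dst ?j = v" "N' a_mid ?j = m" "N' a_old ?j = length xs" "N' a_arg ?j = best m"
      "0 < m \<longrightarrow> R' r_best ?j = ?val (f (best m))" using I by (auto simp: I_def)
    have try1: "wp P try_code (2 * T + 10) (greedy_post j xs N' R' (f m)) \<sigma>"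
      using wp_try[OF g keeps_ready[OF 1(2) r(1)] 1(3) r(3) B 1(4) 1(6) m 1(5) v(2)] keeps_th[OF 1(2)]
      by (simp add: Let_def f_def 1(1))
    have rest: "wp P (Seq (Call 2) update_code) (Suc (k * (10 * B + 21) + 10 + 8)) (I (Suc m)) \<sigma>2"
      if "greedy_post j xs N' R' (f m) \<sigma>2" for \<sigma>2
    proof -
      obtain N2 R2 where 2: "\<sigma>2 = st N2 R2" "keeps j N' R' N2 R2" "walk N2 (f m)" "N2 a_lev 0 = ?j"
        using \<open>greedy_post j xs N' R' (f m) \<sigma>2\<close> unfolding greedy_post_def 1(4) by blast
      have k2: "keeps ?j N R N2 R2" using keeps_trans[OF 1(2) keeps_mono[OF 2(2)]] by simp
      have fm: "f m \<noteq> []" "length (f m) \<le> B"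
        using r(3) B greedy_length[of ?val j "greedy ?val n j xs m" v] greedy_length[of ?val j xs m]
        by (auto simp: f_def)
      note pot = wp_potential[OF keeps_ready[OF k2 r(1)] 2(3) fm]
      show ?thesis unfolding 2(1)
      proof (rule wp_Seq_spec[OF pot])
        fix \<sigma>3 assume "\<exists>N' R'. \<sigma>3 = st N' R' \<and> (\<forall>x. x \<notin> {a_ag, a_off, a_pos} \<longrightarrow> N' x = N2 x) \<and>
          (\<forall>x. x \<notin> {r_pot, r_prod} \<longrightarrow> R' x = R2 x) \<and> R' r_pot 0 = \<Phi> (R2 r_th 0) (f m)"
        then obtain N3 R3 where 3: "\<sigma>3 = st N3 R3" "\<forall>x. x \<notin> {a_ag, a_off, a_pos} \<longrightarrow> N3 x = N2 x"
          "\<forall>x. x \<notin> {r_pot, r_prod} \<longrightarrow> R3 x = R2 x" "R3 r_pot 0 = \<Phi> (R2 r_th 0) (f m)" by blast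
        have p3: "R3 r_pot 0 = ?val (f m)" using 3(4) keeps_th[OF k2] by simp
        have k3: "keeps j N' R' N3 R3" using 2(2) 3(2,3) by (simp add: keeps_def)
        then have k3': "keeps ?j N R N3 R3" using keeps_trans[OF 1(2) keeps_mono[of j N' R' N3 R3]] by simp
        have l3: "N3 a_lev 0 = ?j" "N3 a_dst ?j = v" "N3 a_mid ?j = m" "N3 a_old ?j = length xs"
          "N3 a_arg ?j = best m" "0 < m \<longrightarrow> R3 r_best ?j = ?val (f (best m))"
          using 1 2(4) k3 3(2) by (simp_all add: keeps_def)
        \<comment> \<open>Both calls only append, so \<open>xs\<close> is still a prefix of the
          stored walk, and resetting the length restores it in constant time.\<close>
        have pre: "take (length xs) (f m) = xs"
          using greedy_take[of "greedy ?val n j xs m" ?val j v] greedy_take[of xs ?val j m]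
            greedy_length[of ?val j xs m] unfolding f_def
          by (metis le_add1 min.absorb1 take_take)
        have len: "length xs \<le> length (f m)" using pre by (metis length_take min.cobounded1)
        have w3: "N3 a_walk p = xs ! p" if "p < length xs" for p
        proof -
          have "N3 a_walk p = f m ! p" using 2(3) 3(2) that len by (simp add: walk_def)
          also have "\<dots> = xs ! p" using that by (subst pre[symmetric]) simp
          finally show ?thesis .
        qed
        have sub: "set xs \<subseteq> {..<n}" using 1(3) by (simp add: walk_def)
        have "I (Suc m) (exec update_code \<sigma>3)"
        proof (cases "0 < m \<and> \<not> ?val (f m) < ?val (f (best m))")
          case True
          have e: "exec update_code \<sigma>3 = st (N3(a_len := (N3 a_len)(0 := length xs), a_mid := (N3 a_mid)(?j := Suc m))) R3"
            using True p3 l3 by (simp add: update_code_def 3(1) nop_def)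
          have b: "best (Suc m) = best m" using True by (simp add: best_def)
          show ?thesis unfolding e I_def
            by (rule st_exI) (use True k3' l3 w3 b sub in \<open>simp add: keeps_def walk_def\<close>)
        next
          case False
          have e: "exec update_code \<sigma>3 = st (N3(a_arg := (N3 a_arg)(?j := m), a_len := (N3 a_len)(0 := length xs), a_mid := (N3 a_mid)(?j := Suc m)))
             (R3(r_best := (R3 r_best)(?j := ?val (f m))))"
            using False p3 l3 by (auto simp: update_code_def 3(1))
          have b: "best (Suc m) = m" using False by (auto simp: best_def)
          show ?thesis unfolding e I_def
            by (rule st_exI) (use False k3' l3 w3 b sub in \<open>simp add: keeps_def walk_def\<close>)
        qed
        moreover have "straight update_code" "duration update_code \<le> 8"
          by (simp_all add: update_code_def nop_def)
        ultimately show "wp P update_code 8 (I (Suc m)) \<sigma>3"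
          by (intro wp_time[OF wp_exec])
      qed
    qed
    show ?thesis by (rule wp_time[OF wp_Seq_spec[OF try1 rest]]) auto
  qed
  have loop: "wp P (While (NLess (NA a_mid (NV a_lev)) (NGet (NConst 0))) ?body)
      (n * Suc (2 * T + k * (10 * B + 21) + 39) + 1) (I n) (st N1 R)"
  proof (rule wp_While[of I, OF I0])
    fix m \<sigma> assume m: "m < n" "I m \<sigma>"
    then show "bval (NLess (NA a_mid (NV a_lev)) (NGet (NConst 0))) \<sigma> \<and>
        wp P ?body (2 * T + k * (10 * B + 21) + 39) (I (Suc m)) \<sigma>"
      using body[OF m] by (auto simp: I_def)
  next
    fix \<sigma> assume "I n \<sigma>"
    then show "\<not> bval (NLess (NA a_mid (NV a_lev)) (NGet (NConst 0))) \<sigma> \<and> I n \<sigma>" by (auto simp: I_def)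
  qed
  have bn: "best n < n" unfolding best_def by (rule first_argmin_less[OF n])
  have final: "wp P (Seq (set_NA a_mid (NV a_lev) (NA a_arg (NV a_lev))) try_code) (Suc (1 + (2 * T + 10)))
      (greedy_post ?j xs N R (greedy ?val n ?j xs v)) \<sigma>" if "I n \<sigma>" for \<sigma>
  proof -
    obtain N' R' where 1: "\<sigma> = st N' R'" "keeps ?j N R N' R'" "walk N' xs" "N' a_lev 0 = ?j"
      "N' a_dst ?j = v" "N' a_arg ?j = best n" using \<open>I n \<sigma>\<close> by (auto simp: I_def)
    define N2 where "N2 = N'(a_mid := (N' a_mid)(?j := best n))"
    have e: "exec (set_NA a_mid (NV a_lev) (NA a_arg (NV a_lev))) \<sigma> = st N2 R'"
      using 1 by (simp add: N2_def)
    have k2: "keeps ?j N R N2 R'" using 1(2) by (simp add: keeps_def N2_def)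
    have "wp P try_code (2 * T + 10) (greedy_post j xs N2 R' (f (best n))) (st N2 R')"
      using wp_try[OF g keeps_ready[OF k2 r(1)] _ r(3) B, of "best n" v] 1 bn v keeps_th[OF k2]
      by (simp add: Let_def f_def N2_def walk_def)
    then have "wp P try_code (2 * T + 10) (greedy_post ?j xs N R (greedy ?val n ?j xs v)) (st N2 R')"
    proof (rule wp_mono)
      fix \<sigma>' assume "greedy_post j xs N2 R' (f (best n)) \<sigma>'"
      then obtain N3 R3 where 3: "\<sigma>' = st N3 R3" "keeps j N2 R' N3 R3" "walk N3 (f (best n))"
        "N3 a_lev 0 = N2 a_lev 0" by (auto simp: greedy_post_def)
      have "keeps ?j N R N3 R3" using keeps_trans[OF k2 keeps_mono[OF 3(2)]] by simp
      moreover have "greedy ?val n ?j xs v = f (best n)" by (simp add: Let_def f_def best_def)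
      ultimately show "greedy_post ?j xs N R (greedy ?val n ?j xs v) \<sigma>'"
        using 3 1(4) lev unfolding greedy_post_def
        by (intro exI[of _ N3] exI[of _ R3]) (simp add: N2_def)
    qed simp
    from wp_Seq_exec[of "set_NA a_mid (NV a_lev) (NA a_arg (NV a_lev))", OF _ this[folded e]]
    show ?thesis by simp
  qed
  have test: "bval (NLess (NConst 0) (NV a_lev)) (st N R)" using lev by simp
  show "wp P (Call 1) (n * (2 * T + k * (10 * B + 21) + 40) + 2 * T + 40)
      (greedy_post ?j xs N R (greedy ?val n ?j xs v)) (st N R)"
    apply (rule wp_time)
     apply (rule wp_Call, rule P, simp only: P greedy_code_def)
     apply (rule wp_Cond, simp only: test if_True)
     apply (rule wp_Seq_exec, simp)
     apply (subst init)
     apply (rule wp_Seq_spec[OF loop final], assumption)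
    by (simp add: algebra_simps)
qed

lemma wp_greedy_base: "greedy_correct B 10 0"
  unfolding greedy_correct_def
proof (intro allI impI, elim conjE)
  fix N R xs v
  assume r: "ready N R" "walk N xs" "xs \<noteq> []" and lev: "N a_lev 0 = 0" and v: "N a_dst 0 = v" "v < n"
  let ?c = "Seq (set_NA a_walk (NV a_len) (NA a_dst (NConst 0))) (inc a_len)"
  have test: "\<not> bval (NLess (NConst 0) (NV a_lev)) (st N R)" using lev by simp
  have "greedy_post 0 xs N R (xs @ [v]) (exec ?c (st N R))"
    unfolding greedy_post_def using r lev v
    by (simp add: walk_def, intro st_exI) (auto simp: keeps_def nth_append)
  then have c: "wp P ?c (duration ?c) (greedy_post 0 xs N R (xs @ [v])) (st N R)"
    by (intro wp_exec) simp_all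
  show "wp P (Call 1) 10 (greedy_post 0 xs N R (greedy (\<Phi> (R r_th 0)) n 0 xs v)) (st N R)"
    apply (rule wp_time)
     apply (rule wp_Call, rule P, simp only: P greedy_code_def)
     apply (rule wp_Cond, simp only: test if_False greedy.simps)
     apply (rule c)
    by simp
qed

text \<open>With X the time of one potential evaluation (up to constants), a level takes (2 n + 2) T
  + n X + 40 for T of the level below. Since 40 \<le> X \<le> T, the factor 4 (n + 1) absorbs the
  additive terms.\<close>

lemma wp_greedy:
  "greedy_correct B ((4 * (n + 1)) ^ j * (k * (10 * B + 21) + 40)) j"
proof (induction j)
  case 0
  show ?case using greedy_correct_mono[OF wp_greedy_base] by simp
next
  case (Suc j)
  define X where "X = k * (10 * B + 21) + 40"
  define q where "q = 4 * (n + 1)"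
  define Y where "Y = q ^ j * X"
  have X: "X \<le> Y" by (simp add: q_def Y_def)
  have "n * (2 * Y + X) \<le> n * (3 * Y)" using X by (intro mult_le_mono) simp_all
  moreover have "q ^ Suc j * X = 4 * (n * Y) + 4 * Y" by (simp add: q_def Y_def algebra_simps)
  ultimately have le: "n * (2 * Y + k * (10 * B + 21) + 40) + 2 * Y + 40 \<le> q ^ Suc j * X"
    using X by (simp add: X_def algebra_simps)
  show ?case
    using greedy_correct_mono[OF wp_greedy_step[OF Suc[folded X_def q_def, folded Y_def]] le]
    unfolding X_def q_def .
qed

end


section \<open>Searching for the threshold\<close>

definition record_code :: com where
  "record_code =
    Seq (Cond (BAnd (RLess (RV r_pot) (RAdd (RV r_k) (RV r_k)))
                    (BNot (BAnd (NLess (NConst 0) (NV a_fnd)) (BNot (RLess (RV r_th) (RV r_bth))))))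
          (Seq (set_NV a_fnd (NConst 1)) (set_RV r_bth (RV r_th)))
          nop)
        (inc a_mult)"

text \<open>Adding the cost to \<open>r_th\<close> in each pass runs through its multiples without
  converting the counter into a real number.\<close>

definition threshold_code :: com where
  "threshold_code =
    Seq (set_RV r_th (RAdd (RV r_th) (RGet (NV a_cell)))) (Seq walk_code (Seq (Call 2) record_code))"

definition cell_code :: com where
  "cell_code =
    Seq (Seq (set_RV r_th (RConst 0)) (set_NV a_mult (NConst 0)))
   (Seq (While (NLess (NV a_mult) (NGet (NConst 0))) threshold_code)
        (inc a_cell))"

definition search_code :: com where
  "search_code = While (NLess (NV a_cell) (NGet (NConst 4))) cell_code"

text \<open>The search for the new vertex stops at its earlier occurrence or at the end of the list;
  writing the vertex there and cutting behind it handles both cases alike.\<close>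

definition erase_step_code :: com where
  "erase_step_code =
    Seq (set_NV a_pos (NConst 0))
   (Seq (While (BAnd (NLess (NV a_pos) (NV a_olen)) (unequal (NA a_out (NV a_pos)) (NA a_walk (NV a_src))))
          (inc a_pos))
        (Seq (set_NA a_out (NV a_pos) (NA a_walk (NV a_src)))
        (Seq (set_NV a_olen (NAdd (NV a_pos) (NConst 1))) (inc a_src))))"

definition erase_code :: com where
  "erase_code =
    Seq (Seq (set_NV a_olen (NConst 0)) (set_NV a_src (NConst 0)))
        (While (NLess (NV a_src) (NV a_len)) erase_step_code)"

text \<open>Chronological loop erasure: a return to \<open>v\<close> deletes the closed walk since
  its earlier visit. Waiting steps vanish as closed walks of length one.\<close>

definition loop_erase :: "nat list \<Rightarrow> nat list" where
  "loop_erase = foldl (\<lambda>zs v. takeWhile (\<lambda>u. u \<noteq> v) zs @ [v]) []"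

lemma erase_snoc: "loop_erase (xs @ [v]) = takeWhile (\<lambda>u. u \<noteq> v) (loop_erase xs) @ [v]"
  by (simp add: loop_erase_def)

lemma length_loop_erase: "length (loop_erase xs) \<le> length xs"
proof (induction xs rule: rev_induct)
  case (snoc v xs)
  then show ?case using length_takeWhile_le[of "\<lambda>u. u \<noteq> v" "loop_erase xs"] by (simp add: erase_snoc)
qed (simp add: loop_erase_def)

section \<open>Correctness of the threshold search and of loop erasure\<close>

context machine begin

abbreviation final_walk :: "real \<Rightarrow> nat list" where
  "final_walk \<theta> \<equiv> greedy (\<Phi> \<theta>) n L [s] t"

definition walk_time :: nat where
  "walk_time = (4 * (n + 1)) ^ L * (k * (10 * (2 ^ L + 1) + 21) + 40) + 10"

definition walk_post where
  "walk_post N R \<sigma> \<longleftrightarrow> (\<exists>N' R'. \<sigma> = st N' R' \<and>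
     (\<forall>x. x \<notin> {a_len, a_walk, a_lev, a_dst, a_mid, a_arg, a_old, a_ag, a_off, a_pos} \<longrightarrow> N' x = N x) \<and>
     (\<forall>x. x \<notin> {r_pot, r_prod, r_best} \<longrightarrow> R' x = R x) \<and> walk N' (final_walk (R r_th 0)))"

lemma wp_walk:
  assumes r: "ready N R"
  shows "wp P walk_code walk_time (walk_post N R) (st N R)"
proof -
  define N1 where "N1 = N(a_len := (N a_len)(0 := 1), a_walk := (N a_walk)(0 := s),
    a_lev := (N a_lev)(0 := L), a_dst := (N a_dst)(L := t))"
  let ?c = "Seq (set_NV a_len (NConst 1)) (Seq (set_NA a_walk (NConst 0) (NGet (NConst 2)))
        (Seq (set_NV a_lev (NV a_dep)) (set_NA a_dst (NV a_dep) (NV a_tgt))))"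
  have e: "exec ?c (st N R) = st N1 R" using r by (simp add: N1_def ready_def)
  have r1: "ready N1 R" using r by (simp add: N1_def ready_def)
  have w1: "walk N1 [s]" using s by (simp add: N1_def walk_def)
  have "wp P (Call 1) ((4 * (n + 1)) ^ L * (k * (10 * (2 ^ L + 1) + 21) + 40))
      (greedy_post L [s] N1 R (final_walk (R r_th 0))) (st N1 R)"
    by (rule greedy_correctD[OF wp_greedy r1 w1]) (use t in \<open>simp_all add: N1_def\<close>)
  then have "wp P (Call 1) ((4 * (n + 1)) ^ L * (k * (10 * (2 ^ L + 1) + 21) + 40)) (walk_post N R) (exec ?c (st N R))"
    unfolding e
  proof (rule wp_mono)
    fix \<sigma> assume "greedy_post L [s] N1 R (final_walk (R r_th 0)) \<sigma>"
    then obtain N' R' where "\<sigma> = st N' R'" "keeps L N1 R N' R'" "walk N' (final_walk (R r_th 0))"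
      unfolding greedy_post_def by blast
    then show "walk_post N R \<sigma>" unfolding walk_post_def
      by (intro exI[of _ N'] exI[of _ R']) (simp add: keeps_def N1_def)
  qed simp
  from wp_Seq_exec[of ?c, OF _ this] show ?thesis
    unfolding walk_code_def walk_time_def by (rule wp_time) simp_all
qed

text \<open>The thresholds tried before cell \<open>a\<close> has been taken \<open>m + 1\<close>
  times, so the set doubles as the invariant of the two nested loops. For
  \<open>candidates H 0\<close> these are the multiples 1 to \<open>n\<close> of all cost
  entries.\<close>

definition candidates :: "nat \<Rightarrow> nat \<Rightarrow> real set" where
  "candidates a m = {real (Suc j) * rlow b | b j. b < a \<and> j < n \<or> b = a \<and> j < m}"

lemma candidates_Suc: "candidates a (Suc m) = insert (real (Suc m) * rlow a) (candidates a m)"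
  by (auto simp: candidates_def less_Suc_eq)

lemma candidates_next: "candidates (Suc a) 0 = candidates a n"
  by (auto simp: candidates_def less_Suc_eq)

text \<open>The start walk \<open>[s]\<close> has potential \<open>k\<close>, so the potential must
  less than double.\<close>

definition good :: "real \<Rightarrow> bool" where
  "good \<theta> \<longleftrightarrow> \<Phi> \<theta> (final_walk \<theta>) < 2 * real k"

definition recorded :: "real set \<Rightarrow> (nat \<Rightarrow> nat \<Rightarrow> nat) \<Rightarrow> (nat \<Rightarrow> nat \<Rightarrow> real) \<Rightarrow> bool" where
  "recorded S N R \<longleftrightarrow> (if N a_fnd 0 = 0 then \<forall>\<theta>\<in>S. \<not> good \<theta>
     else good (R r_bth 0) \<and> (\<forall>\<theta>\<in>S. good \<theta> \<longrightarrow> R r_bth 0 \<le> \<theta>))"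

definition pot_time :: nat where
  "pot_time = k * (10 * (2 ^ L + 1) + 21) + 10"

definition try_post where
  "try_post a m \<sigma> \<longleftrightarrow> (\<exists>N R. \<sigma> = st N R \<and> ready N R \<and> N a_cell 0 = a \<and> N a_mult 0 = m \<and>
     R r_th 0 = real m * rlow a \<and> recorded (candidates a m) N R)"

lemma wp_threshold:
  assumes "try_post a m \<sigma>" "m < n" "a < H"
  shows "wp P threshold_code (walk_time + pot_time + 20) (try_post a (Suc m)) \<sigma>"
proof -
  obtain N R where 0: "\<sigma> = st N R" "ready N R" "N a_cell 0 = a" "N a_mult 0 = m"
    "R r_th 0 = real m * rlow a" "recorded (candidates a m) N R"
    using assms(1) unfolding try_post_def by blast
  define \<theta> where "\<theta> = real (Suc m) * rlow a"
  define R1 where "R1 = R(r_th := (R r_th)(0 := \<theta>))"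
  have e: "exec (set_RV r_th (RAdd (RV r_th) (RGet (NV a_cell)))) \<sigma> = st N R1"
    using 0 assms(3) by (simp add: R1_def \<theta>_def algebra_simps)
  have r1: "ready N R1" using 0(2) by (simp add: ready_def R1_def)
  have th: "R1 r_th 0 = \<theta>" by (simp add: R1_def)
  have rest: "wp P (Seq (Call 2) record_code) (Suc (pot_time + 10)) (try_post a (Suc m)) \<sigma>2"
    if post: "walk_post N R1 \<sigma>2" for \<sigma>2
  proof -
    obtain N2 R2 where 2: "\<sigma>2 = st N2 R2"
      "\<forall>x. x \<notin> {a_len, a_walk, a_lev, a_dst, a_mid, a_arg, a_old, a_ag, a_off, a_pos} \<longrightarrow> N2 x = N x"
      "\<forall>x. x \<notin> {r_pot, r_prod, r_best} \<longrightarrow> R2 x = R1 x" "walk N2 (final_walk \<theta>)"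
      using post unfolding walk_post_def th by blast
    have r2: "ready N2 R2" using r1 2(2,3) by (simp add: ready_def)
    have th2: "R2 r_th 0 = \<theta>" using 2(3) th by simp
    have len: "length (final_walk \<theta>) = 2 ^ L + 1" using greedy_length[of "\<Phi> \<theta>" L "[s]" t] by simp
    then have ne: "final_walk \<theta> \<noteq> []" by auto
    have "wp P (Call 2) pot_time (\<lambda>\<sigma>. \<exists>N' R'. \<sigma> = st N' R' \<and>
       (\<forall>x. x \<notin> {a_ag, a_off, a_pos} \<longrightarrow> N' x = N2 x) \<and> (\<forall>x. x \<notin> {r_pot, r_prod} \<longrightarrow> R' x = R2 x) \<and>
       R' r_pot 0 = \<Phi> \<theta> (final_walk \<theta>)) \<sigma>2"
      using wp_potential[OF r2 2(4) ne, of "2 ^ L + 1"] len unfolding pot_time_def 2(1) th2 by simp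
    then show ?thesis
    proof (rule wp_Seq_spec)
      fix \<sigma>3 assume "\<exists>N' R'. \<sigma>3 = st N' R' \<and>
       (\<forall>x. x \<notin> {a_ag, a_off, a_pos} \<longrightarrow> N' x = N2 x) \<and> (\<forall>x. x \<notin> {r_pot, r_prod} \<longrightarrow> R' x = R2 x) \<and>
       R' r_pot 0 = \<Phi> \<theta> (final_walk \<theta>)"
      then obtain N3 R3 where 3: "\<sigma>3 = st N3 R3" "\<forall>x. x \<notin> {a_ag, a_off, a_pos} \<longrightarrow> N3 x = N2 x"
        "\<forall>x. x \<notin> {r_pot, r_prod} \<longrightarrow> R3 x = R2 x" "R3 r_pot 0 = \<Phi> \<theta> (final_walk \<theta>)" by blast
      have r3: "ready N3 R3" using r2 3(2,3) by (simp add: ready_def)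
      have th3: "R3 r_th 0 = \<theta>" using th2 3(3) by simp
      have l3: "N3 a_cell 0 = a" "N3 a_mult 0 = m" "N3 a_fnd = N a_fnd" "R3 r_bth = R r_bth"
        using 3(2,3) 2(2,3) 0(3,4) by (simp_all add: R1_def)
      have rec: "recorded (candidates a m) N3 R3" using 0(6) l3(3,4) by (simp add: recorded_def)
      have kk: "R3 r_k 0 = real k" using r3 by (simp add: ready_def)
      have "try_post a (Suc m) (exec record_code \<sigma>3)"
      proof (cases "good \<theta> \<and> \<not> (0 < N3 a_fnd 0 \<and> \<not> \<theta> < R3 r_bth 0)")
        case True
        have e3: "exec record_code \<sigma>3 = st (N3(a_fnd := (N3 a_fnd)(0 := 1), a_mult := (N3 a_mult)(0 := Suc m)))
           (R3(r_bth := (R3 r_bth)(0 := \<theta>)))"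
          using True 3(4) l3(2) th3 kk by (simp add: record_code_def 3(1) good_def)
        show ?thesis unfolding e3 try_post_def
          by (rule st_exI) (use True r3 l3 rec th3 in \<open>auto simp: ready_def recorded_def candidates_Suc \<theta>_def[symmetric] simp del: of_nat_Suc split: if_splits\<close>)
      next
        case False
        have e3: "exec record_code \<sigma>3 = st (N3(a_mult := (N3 a_mult)(0 := Suc m))) R3"
          using False 3(4) l3(2) th3 kk by (auto simp: record_code_def 3(1) good_def nop_def)
        show ?thesis unfolding e3 try_post_def
          by (rule st_exI) (use False r3 l3 rec th3 in \<open>auto simp: ready_def recorded_def candidates_Suc \<theta>_def[symmetric] simp del: of_nat_Suc split: if_splits\<close>)
      qed
      moreover have "straight record_code" "duration record_code \<le> 10"
        by (simp_all add: record_code_def nop_def)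
      ultimately show "wp P record_code 10 (try_post a (Suc m)) \<sigma>3" by (intro wp_time[OF wp_exec])
    qed
  qed
  show ?thesis unfolding threshold_code_def
    apply (rule wp_time)
     apply (rule wp_Seq_exec, simp)
     apply (subst e)
     apply (rule wp_Seq_spec[OF wp_walk[OF r1] rest], assumption)
    by simp
qed

definition cell_post where
  "cell_post a \<sigma> \<longleftrightarrow> (\<exists>N R. \<sigma> = st N R \<and> ready N R \<and> N a_cell 0 = a \<and> recorded (candidates a 0) N R)"

lemma wp_search:
  assumes "cell_post 0 \<sigma>"
  shows "wp P search_code (H * (n * (walk_time + pot_time + 21) + 20) + 1) (cell_post H) \<sigma>"
proof -
  have cell: "wp P cell_code (n * (walk_time + pot_time + 21) + 10) (cell_post (Suc a)) \<sigma>"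
    if a: "a < H" and post: "cell_post a \<sigma>" for a \<sigma>
  proof -
    obtain N R where 0: "\<sigma> = st N R" "ready N R" "N a_cell 0 = a" "recorded (candidates a 0) N R"
      using post unfolding cell_post_def by blast
    have start: "try_post a 0 (exec (Seq (set_RV r_th (RConst 0)) (set_NV a_mult (NConst 0))) \<sigma>)"
      using 0 by (simp add: try_post_def, intro st_exI) (simp add: ready_def recorded_def)
    have loop: "wp P (While (NLess (NV a_mult) (NGet (NConst 0))) threshold_code)
        (n * Suc (walk_time + pot_time + 20) + 1) (try_post a n) \<sigma>1" if "try_post a 0 \<sigma>1" for \<sigma>1
    proof (rule wp_While[of "try_post a", OF that])
      fix m \<sigma> assume m: "m < n" "try_post a m \<sigma>"
      then show "bval (NLess (NV a_mult) (NGet (NConst 0))) \<sigma> \<and>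
          wp P threshold_code (walk_time + pot_time + 20) (try_post a (Suc m)) \<sigma>"
        using wp_threshold[OF m(2,1) a] by (auto simp: try_post_def)
    next
      fix \<sigma> assume "try_post a n \<sigma>"
      then show "\<not> bval (NLess (NV a_mult) (NGet (NConst 0))) \<sigma> \<and> try_post a n \<sigma>" by (auto simp: try_post_def)
    qed
    have last: "wp P (inc a_cell) 1 (cell_post (Suc a)) \<sigma>2" if post2: "try_post a n \<sigma>2" for \<sigma>2
    proof -
      obtain N R where 2: "\<sigma>2 = st N R" "ready N R" "N a_cell 0 = a" "recorded (candidates a n) N R"
        using post2 unfolding try_post_def by blast
      have "cell_post (Suc a) (exec (inc a_cell) \<sigma>2)"
        using 2 by (simp add: cell_post_def, intro st_exI) (simp add: ready_def recorded_def candidates_next)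
      then show ?thesis using wp_exec[of "inc a_cell" _ \<sigma>2 P] by simp
    qed
    show ?thesis unfolding cell_code_def
      apply (rule wp_time)
       apply (rule wp_Seq_exec, simp)
       apply (rule wp_Seq_spec[OF loop[OF start] last], assumption)
      by (simp add: algebra_simps)
  qed
  have loop: "wp P search_code (H * Suc (n * (walk_time + pot_time + 21) + 10) + 1) (cell_post H) \<sigma>"
    unfolding search_code_def
  proof (rule wp_While[of cell_post, OF assms])
    fix a \<sigma> assume a: "a < H" "cell_post a \<sigma>"
    then show "bval (NLess (NV a_cell) (NGet (NConst 4))) \<sigma> \<and>
        wp P cell_code (n * (walk_time + pot_time + 21) + 10) (cell_post (Suc a)) \<sigma>"
      using cell[OF a] by (auto simp: cell_post_def)
  next
    fix \<sigma> assume "cell_post H \<sigma>"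
    then show "\<not> bval (NLess (NV a_cell) (NGet (NConst 4))) \<sigma> \<and> cell_post H \<sigma>" by (auto simp: cell_post_def)
  qed
  show ?thesis by (rule wp_time[OF loop]) (simp add: algebra_simps)
qed

definition erase_post where
  "erase_post xs q \<sigma> \<longleftrightarrow> (\<exists>N R. \<sigma> = st N R \<and> walk N xs \<and> N a_src 0 = q \<and>
     N a_olen 0 = length (loop_erase (take q xs)) \<and>
     (\<forall>p<length (loop_erase (take q xs)). N a_out p = loop_erase (take q xs) ! p))"

lemma wp_erase:
  assumes "walk N xs"
  shows "wp P erase_code (length xs * (2 * length xs + 20) + 10) (erase_post xs (length xs)) (st N R)"
proof -
  have body: "wp P erase_step_code (2 * length xs + 10) (erase_post xs (Suc q)) \<sigma>"
    if q: "q < length xs" and post: "erase_post xs q \<sigma>" for q \<sigma>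
  proof -
    define zs where "zs = loop_erase (take q xs)"
    define v where "v = xs ! q"
    obtain N R where 0: "\<sigma> = st N R" "walk N xs" "N a_src 0 = q" "N a_olen 0 = length zs"
      "\<forall>p<length zs. N a_out p = zs ! p" using post unfolding erase_post_def zs_def by blast
    have v: "N a_walk q = v" using 0(2) q by (simp add: walk_def v_def)
    define m where "m = length (takeWhile (\<lambda>u. u \<noteq> v) zs)"
    have m: "m \<le> length zs" by (simp add: m_def length_takeWhile_le)
    have zl: "length zs \<le> length xs" using length_loop_erase[of "take q xs"] by (simp add: zs_def)
    define NI where "NI p = N(a_pos := (N a_pos)(0 := p))" for p
    define I where "I p \<sigma> \<longleftrightarrow> \<sigma> = st (NI p) R" for p \<sigma>
    let ?b = "BAnd (NLess (NV a_pos) (NV a_olen)) (unequal (NA a_out (NV a_pos)) (NA a_walk (NV a_src)))"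
    have loop: "wp P (While ?b (inc a_pos)) (m * Suc 1 + 1) (I m) (st (NI 0) R)"
    proof (rule wp_While)
      show "I 0 (st (NI 0) R)" by (simp add: I_def)
    next
      fix p \<sigma> assume p: "p < m" "I p \<sigma>"
      have "zs ! p \<noteq> v" using p(1) nth_mem[of p "takeWhile (\<lambda>u. u \<noteq> v) zs"] takeWhile_nth[of p "\<lambda>u. u \<noteq> v" zs]
        by (auto simp: m_def dest: set_takeWhileD)
      moreover have "I (Suc p) (exec (inc a_pos) \<sigma>)" using p by (simp add: I_def NI_def)
      ultimately show "bval ?b \<sigma> \<and> wp P (inc a_pos) 1 (I (Suc p)) \<sigma>"
        using p m 0 v wp_exec[of "inc a_pos" "I (Suc p)" \<sigma> P] by (auto simp: I_def NI_def)
    next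
      fix \<sigma> assume "I m \<sigma>"
      moreover have "m < length zs \<Longrightarrow> zs ! m = v"
        using nth_length_takeWhile[of "\<lambda>u. u \<noteq> v" zs] by (simp add: m_def)
      ultimately show "\<not> bval ?b \<sigma> \<and> I m \<sigma>" using 0 v by (auto simp: I_def NI_def)
    qed
    have e: "exec (set_NV a_pos (NConst 0)) \<sigma> = st (NI 0) R" by (simp add: 0(1) NI_def)
    let ?c = "Seq (set_NA a_out (NV a_pos) (NA a_walk (NV a_src)))
      (Seq (set_NV a_olen (NAdd (NV a_pos) (NConst 1))) (inc a_src))"
    have new: "loop_erase (take (Suc q) xs) = take m zs @ [v]"
      using q by (simp add: take_Suc_conv_app_nth erase_snoc zs_def v_def m_def takeWhile_eq_take[symmetric])
    have "erase_post xs (Suc q) (exec ?c (st (NI m) R))"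
    proof -
      have "exec ?c (st (NI m) R) = st ((NI m)(a_out := (N a_out)(m := v), a_olen := (N a_olen)(0 := Suc m), a_src := (N a_src)(0 := Suc q))) R"
        using 0(3) v by (simp add: NI_def)
      moreover have "erase_post xs (Suc q) \<dots>"
        unfolding erase_post_def new
        by (rule st_exI) (use 0 m in \<open>auto simp: NI_def walk_def nth_append less_Suc_eq\<close>)
      ultimately show ?thesis by simp
    qed
    then have last: "wp P ?c 5 (erase_post xs (Suc q)) (st (NI m) R)"
      by (intro wp_time[OF wp_exec]) simp_all
    show ?thesis unfolding erase_step_code_def
      apply (rule wp_time)
       apply (rule wp_Seq_exec, simp)
       apply (subst e)
       apply (rule wp_Seq_spec[OF loop])
       apply (simp only: I_def, rule last)
      using m zl by simp
  qed
  have start: "erase_post xs 0 (exec (Seq (set_NV a_olen (NConst 0)) (set_NV a_src (NConst 0))) (st N R))"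
  proof -
    have "exec (Seq (set_NV a_olen (NConst 0)) (set_NV a_src (NConst 0))) (st N R) =
        st (N(a_olen := (N a_olen)(0 := 0), a_src := (N a_src)(0 := 0))) R" by simp
    moreover have "erase_post xs 0 \<dots>"
      unfolding erase_post_def by (rule st_exI) (use assms in \<open>simp add: walk_def loop_erase_def\<close>)
    ultimately show ?thesis by simp
  qed
  have loop: "wp P (While (NLess (NV a_src) (NV a_len)) erase_step_code)
      (length xs * Suc (2 * length xs + 10) + 1) (erase_post xs (length xs)) \<sigma>" if "erase_post xs 0 \<sigma>" for \<sigma>
  proof (rule wp_While[of "erase_post xs", OF that])
    fix q \<sigma> assume q: "q < length xs" "erase_post xs q \<sigma>"
    then show "bval (NLess (NV a_src) (NV a_len)) \<sigma> \<and>
        wp P erase_step_code (2 * length xs + 10) (erase_post xs (Suc q)) \<sigma>"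
      using body[OF q] by (auto simp: erase_post_def walk_def)
  next
    fix \<sigma> assume "erase_post xs (length xs) \<sigma>"
    then show "\<not> bval (NLess (NV a_src) (NV a_len)) \<sigma> \<and> erase_post xs (length xs) \<sigma>"
      by (auto simp: erase_post_def walk_def)
  qed
  show ?thesis unfolding erase_code_def
    apply (rule wp_time)
     apply (rule wp_Seq_exec, simp)
     apply (rule loop[OF start])
    by (simp add: algebra_simps)
qed

end


section \<open>Output and initialization\<close>

definition output_step_code :: com where
  "output_step_code =
    Seq (NSet (NAdd (NV a_pos) (NConst 1)) (NA a_out (NV a_pos)))
        (set_NV a_pos (NSub (NV a_pos) (NConst 1)))"

text \<open>
  The output overwrites cell \<open>3\<close>, which is needed to address the frame; so it is written from
  the end of the path, and cell \<open>3\<close> comes last.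
\<close>

definition output_code :: com where
  "output_code =
    Seq (set_NV a_pos (NSub (NV a_olen) (NConst 1)))
   (Seq (While (NLess (NConst 2) (NV a_pos)) output_step_code)
        (Seq (NSet (NConst 1) (NA a_out (NConst 0)))
        (Seq (NSet (NConst 2) (NA a_out (NConst 1)))
        (Seq (NSet (NConst 0) (NSub (NV a_olen) (NConst 1)))
             (NSet (NConst 3) (NA a_out (NConst 2)))))))"

text \<open>At this point no address outside the input is known, so n * n has to be computed inside
  it. Cell 4 keeps a copy of \<open>n\<close>, cell 0 counts down, and cell 3 accumulates on top of
  its content \<open>t\<close>, ending with F = t + 4 + n * n. Now the frame is addressable.
  Subtracting \<open>n\<close> repeatedly from F - 4 recovers \<open>t\<close> while cell 0 counts
  up again, which restores \<open>n\<close>.\<close>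

definition base_code :: com where
  "base_code =
    Seq (Seq (NSet (NConst 4) (NGet (NConst 0))) (NSet (NConst 3) (NAdd (NGet (NConst 3)) (NConst 4))))
   (Seq (While (NLess (NConst 0) (NGet (NConst 0)))
          (Seq (NSet (NConst 3) (NAdd (NGet (NConst 3)) (NGet (NConst 4))))
               (NSet (NConst 0) (NSub (NGet (NConst 0)) (NConst 1)))))
   (Seq (set_NV a_tgt (NSub (NGet (NConst 3)) (NConst 4)))
        (While (NLess (NGet (NConst 0)) (NGet (NConst 4)))
          (Seq (set_NV a_tgt (NSub (NV a_tgt) (NGet (NConst 4))))
               (NSet (NConst 0) (NAdd (NGet (NConst 0)) (NConst 1)))))))"

definition row_code :: com where
  "row_code =
    While (NLess (NV a_pos) (NGet (NConst 0)))
      (Seq (set_NA a_row (NAdd (NV a_pos) (NConst 1)) (NAdd (NA a_row (NV a_pos)) (NGet (NConst 0))))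
           (inc a_pos))"

text \<open>H = k * (n * n) is summed up from entry \<open>n\<close> of the row table. Only when
  cell 4 has received it do the real arrays become addressable.\<close>

definition cells_code :: com where
  "cells_code =
    Seq (While (NLess (NV a_ag) (NGet (NConst 1)))
          (Seq (set_NV a_acc (NAdd (NV a_acc) (NA a_row (NGet (NConst 0))))) (inc a_ag)))
        (NSet (NConst 4) (NV a_acc))"

text \<open>The machine cannot convert natural numbers into reals, so \<open>k\<close> is counted
  once more in a real cell.\<close>

definition agents_code :: com where
  "agents_code =
    Seq (set_NV a_ag (NConst 0))
        (While (NLess (NV a_ag) (NGet (NConst 1)))
          (Seq (set_RV r_k (RAdd (RV r_k) (RConst 1))) (inc a_ag)))"

text \<open>Doubling finds the least L with n \<le> 2^L, and the scale 4 L is accumulated along the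
  way as a real number.\<close>

definition depth_code :: com where
  "depth_code =
    Seq (set_NV a_acc (NConst 1))
        (While (NLess (NV a_acc) (NGet (NConst 0)))
          (Seq (set_NV a_acc (NAdd (NV a_acc) (NV a_acc)))
          (Seq (inc a_dep) (set_RV r_den (RAdd (RV r_den) (RConst 4))))))"

definition main_code :: com where
  "main_code =
    Seq base_code (Seq row_code (Seq cells_code (Seq agents_code (Seq depth_code (Seq search_code
      (Seq (set_RV r_th (RV r_bth)) (Seq walk_code (Seq erase_code output_code))))))))"

section \<open>Correctness of initialization, output and the whole program\<close>

context machine begin

definition outputs :: "nat list \<Rightarrow> mem \<Rightarrow> bool" where
  "outputs zs \<sigma> \<longleftrightarrow> nmem \<sigma> 0 = length zs - 1 \<and> (\<forall>p<length zs. nmem \<sigma> (Suc p) = zs ! p)"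

text \<open>A path with at most \<open>n\<close> vertices fits into the cells below F, so writing it
  never touches the array being read. The loop leaves cell 3 intact, because it stops when position
  2 is reached.\<close>

lemma wp_output:
  assumes zs: "0 < length zs" "length zs \<le> n"
    and N: "N a_olen 0 = length zs" "\<forall>p<length zs. N a_out p = zs ! p"
  shows "wp P output_code (4 * n + 20) (outputs zs) (st N R)"
proof -
  define l where "l = length zs - 1"
  have F'': "p + 1 < F" if "p < length zs" for p
  proof -
    have "n \<le> n * n" using n by simp
    then show ?thesis using F(2) that zs(2) by linarith
  qed
  define M where "M low' p = layout F H rlow low' (N(a_pos := (N a_pos)(0 := p))) R" for low' p
  define I where "I i \<sigma> \<longleftrightarrow> (\<exists>low'. \<sigma> = M low' (l - i) \<and> low' 3 = F \<and>
    (\<forall>p. l - i < p \<and> p \<le> l \<longrightarrow> low' (Suc p) = zs ! p))" for i \<sigma>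
  have e: "exec (set_NV a_pos (NSub (NV a_olen) (NConst 1))) (st N R) = M low l"
    using N by (simp add: M_def l_def)
  have I0: "I 0 (M low l)" by (auto simp: I_def)
  have loop: "wp P (While (NLess (NConst 2) (NV a_pos)) output_step_code) ((l - 2) * Suc 3 + 1) (I (l - 2)) (M low l)"
  proof (rule wp_While[of I, OF I0])
    fix i \<sigma> assume i: "i < l - 2" "I i \<sigma>"
    then obtain low' where 1: "\<sigma> = M low' (l - i)" "low' 3 = F"
      "\<forall>p. l - i < p \<and> p \<le> l \<longrightarrow> low' (Suc p) = zs ! p" by (auto simp: I_def)
    have p: "l - i < length zs" "2 < l - i" using i(1) zs(1) by (auto simp: l_def)
    have "exec output_step_code \<sigma> = M (low'(Suc (l - i) := zs ! (l - i))) (l - Suc i)"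
      using 1(2) p F''[OF p(1)] N(2) by (simp add: output_step_code_def 1(1) M_def)
    moreover have "I (Suc i) \<dots>" unfolding I_def
    proof (intro exI[of _ "low'(Suc (l - i) := zs ! (l - i))"] conjI allI impI)
      show "(low'(Suc (l - i) := zs ! (l - i))) 3 = F" using 1(2) p by simp
      fix q assume q: "l - Suc i < q \<and> q \<le> l"
      show "(low'(Suc (l - i) := zs ! (l - i))) (Suc q) = zs ! q"
      proof (cases "q = l - i")
        case False
        then have "l - i < q" using q p by linarith
        then show ?thesis using 1(3) q by simp
      qed simp
    qed simp
    ultimately have "I (Suc i) (exec output_step_code \<sigma>)" by simp
    moreover have "straight output_step_code" "duration output_step_code \<le> 3"
      by (simp_all add: output_step_code_def)
    ultimately have "wp P output_step_code 3 (I (Suc i)) \<sigma>" by (intro wp_time[OF wp_exec])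
    then show "bval (NLess (NConst 2) (NV a_pos)) \<sigma> \<and> wp P output_step_code 3 (I (Suc i)) \<sigma>"
      using 1(1,2) p by (simp add: M_def)
  next
    fix \<sigma> assume "I (l - 2) \<sigma>"
    moreover from this obtain low' where "\<sigma> = M low' (l - (l - 2))" "low' 3 = F" unfolding I_def by blast
    ultimately show "\<not> bval (NLess (NConst 2) (NV a_pos)) \<sigma> \<and> I (l - 2) \<sigma>" by (simp add: M_def)
  qed
  \<comment> \<open>With fewer than three vertices, cells 2 and 3 may receive arbitrary values;
    \<open>outputs\<close> constrains positions below the length only.\<close>
  let ?c = "Seq (NSet (NConst 1) (NA a_out (NConst 0)))
        (Seq (NSet (NConst 2) (NA a_out (NConst 1)))
        (Seq (NSet (NConst 0) (NSub (NV a_olen) (NConst 1)))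
             (NSet (NConst 3) (NA a_out (NConst 2)))))"
  have last: "wp P ?c 8 (outputs zs) \<sigma>" if "I (l - 2) \<sigma>" for \<sigma>
  proof -
    obtain low' where 1: "\<sigma> = M low' (l - (l - 2))" "low' 3 = F"
      "\<forall>p. l - (l - 2) < p \<and> p \<le> l \<longrightarrow> low' (Suc p) = zs ! p"
      using \<open>I (l - 2) \<sigma>\<close> unfolding I_def by blast
    define low2 where "low2 = low'(1 := N a_out 0, 2 := N a_out 1, 0 := l, 3 := N a_out 2)"
    have e2: "exec ?c \<sigma> = M low2 (l - (l - 2))"
      using 1(2) N(1) by (simp add: 1(1) M_def low2_def l_def)
    have "low2 (Suc p) = zs ! p" if p: "p < length zs" for p
    proof -
      consider "p = 0" | "p = 1" | "p = 2" | "2 < p" by linarith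
      then show ?thesis
      proof cases
        case 4
        then have "low' (Suc p) = zs ! p" using 1(3) p by (simp add: l_def)
        then show ?thesis using 4 by (simp add: low2_def)
      qed (use p N(2) in \<open>simp_all add: low2_def eval_nat_numeral\<close>)
    qed
    moreover have "low2 0 = l" by (simp add: low2_def)
    ultimately have "outputs zs (exec ?c \<sigma>)"
      using F'' unfolding e2 outputs_def by (simp add: M_def l_def)
    then show ?thesis by (intro wp_time[OF wp_exec]) simp_all
  qed
  show ?thesis unfolding output_code_def
    apply (rule wp_time)
     apply (rule wp_Seq_exec, simp)
     apply (subst e)
     apply (rule wp_Seq_spec[OF loop last], assumption)
    using zs by (simp add: l_def)
qed

text \<open>Cell 4 is left open: it is scratch space until it receives H.\<close>

definition based where
  "based low' N \<longleftrightarrow> low' 3 = F \<and> (\<forall>x. x \<noteq> 4 \<longrightarrow> low' x = low x) \<and> N a_tgt 0 = t"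

abbreviation st0 where
  "st0 low' N \<equiv> layout F H rlow low' N (\<lambda>_ _. 0)"

lemma wp_base:
  assumes F_eq: "F = t + 4 + n * n"
    and low0: "low0 3 = t" "\<And>x. x \<noteq> 3 \<Longrightarrow> x \<noteq> 4 \<Longrightarrow> low0 x = low x"
  shows "wp P base_code (8 * n + 20)
    (\<lambda>\<sigma>. \<exists>low' N. \<sigma> = st0 low' N \<and> based low' N \<and> (\<forall>x. x \<noteq> a_tgt \<longrightarrow> N x = (\<lambda>_. 0)))
    (st0 low0 (\<lambda>_ _. 0))"
proof -
  define A where "A i = low0(4 := n, 3 := t + 4 + i * n, 0 := n - i)" for i
  define I where "I i \<sigma> \<longleftrightarrow> \<sigma> = st0 (A i) (\<lambda>_ _. 0)" for i \<sigma>
  have l0: "low0 0 = n" using low0(2)[of 0] by simp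
  have e: "exec (Seq (NSet (NConst 4) (NGet (NConst 0))) (NSet (NConst 3) (NAdd (NGet (NConst 3)) (NConst 4))))
      (st0 low0 (\<lambda>_ _. 0)) = st0 (A 0) (\<lambda>_ _. 0)"
    using low0(1) l0 by (auto simp: A_def layout_def fun_eq_iff nput_def)
  have loop1: "wp P (While (NLess (NConst 0) (NGet (NConst 0)))
          (Seq (NSet (NConst 3) (NAdd (NGet (NConst 3)) (NGet (NConst 4))))
               (NSet (NConst 0) (NSub (NGet (NConst 0)) (NConst 1))))) (n * Suc 3 + 1) (I n) (st0 (A 0) (\<lambda>_ _. 0))"
  proof (rule wp_While)
    show "I 0 (st0 (A 0) (\<lambda>_ _. 0))" by (simp add: I_def)
  next
    fix i \<sigma> assume i: "i < n" "I i \<sigma>"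
    let ?b = "Seq (NSet (NConst 3) (NAdd (NGet (NConst 3)) (NGet (NConst 4))))
               (NSet (NConst 0) (NSub (NGet (NConst 0)) (NConst 1)))"
    have "(A i)(3 := A i 3 + A i 4, 0 := A i 0 - 1) = A (Suc i)" by (auto simp: A_def fun_eq_iff)
    then have "I (Suc i) (exec ?b \<sigma>)" using i by (simp add: I_def)
    then show "bval (NLess (NConst 0) (NGet (NConst 0))) \<sigma> \<and> wp P ?b 3 (I (Suc i)) \<sigma>"
      using i by (intro conjI wp_time[OF wp_exec]) (simp_all add: I_def A_def)
  next
    fix \<sigma> assume "I n \<sigma>"
    then show "\<not> bval (NLess (NConst 0) (NGet (NConst 0))) \<sigma> \<and> I n \<sigma>" by (simp add: I_def A_def)
  qed
  define low1 where "low1 i = low0(4 := n, 3 := F, 0 := i)" for i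
  define NT where "NT i = (\<lambda>(_::nat) (_::nat). 0::nat)(a_tgt := (\<lambda>_. 0)(0 := t + (n - i) * n))" for i
  define J where "J i \<sigma> \<longleftrightarrow> \<sigma> = st0 (low1 i) (NT i)" for i \<sigma>
  have An: "A n = low1 0" by (simp add: A_def low1_def F_eq)
  have e2: "exec (set_NV a_tgt (NSub (NGet (NConst 3)) (NConst 4))) (st0 (low1 0) (\<lambda>_ _. 0)) = st0 (low1 0) (NT 0)"
    by (simp add: low1_def NT_def F_eq)
  have loop2: "wp P (While (NLess (NGet (NConst 0)) (NGet (NConst 4)))
          (Seq (set_NV a_tgt (NSub (NV a_tgt) (NGet (NConst 4))))
               (NSet (NConst 0) (NAdd (NGet (NConst 0)) (NConst 1))))) (n * Suc 3 + 1) (J n) (st0 (low1 0) (NT 0))"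
  proof (rule wp_While)
    show "J 0 (st0 (low1 0) (NT 0))" by (simp add: J_def)
  next
    fix i \<sigma> assume i: "i < n" "J i \<sigma>"
    let ?b = "Seq (set_NV a_tgt (NSub (NV a_tgt) (NGet (NConst 4))))
               (NSet (NConst 0) (NAdd (NGet (NConst 0)) (NConst 1)))"
    have 1: "(NT i)(a_tgt := (NT i a_tgt)(0 := NT i a_tgt 0 - n)) = NT (Suc i)"
    proof -
      have "n - i = Suc (n - Suc i)" using i(1) by simp
      then show ?thesis by (simp add: NT_def)
    qed
    have 2: "(low1 i)(0 := low1 i 0 + 1) = low1 (Suc i)" by (simp add: low1_def)
    have 3: "low1 i 3 = F" "low1 i 4 = n" "low1 i 0 = i" by (simp_all add: low1_def)
    have "J (Suc i) (exec ?b \<sigma>)" using i 1 2 3 by (simp add: J_def)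
    then show "bval (NLess (NGet (NConst 0)) (NGet (NConst 4))) \<sigma> \<and> wp P ?b 3 (J (Suc i)) \<sigma>"
      using i by (intro conjI wp_time[OF wp_exec]) (simp_all add: J_def low1_def)
  next
    fix \<sigma> assume "J n \<sigma>"
    then show "\<not> bval (NLess (NGet (NConst 0)) (NGet (NConst 4))) \<sigma> \<and> J n \<sigma>" by (simp add: J_def low1_def)
  qed
  have post: "\<exists>low' N. \<sigma> = st0 low' N \<and> based low' N \<and> (\<forall>x. x \<noteq> a_tgt \<longrightarrow> N x = (\<lambda>_. 0))" if "J n \<sigma>" for \<sigma>
    using that low0(2) by (intro exI[of _ "low1 n"] exI[of _ "NT n"]) (simp add: J_def based_def low1_def NT_def)
  show ?thesis unfolding base_code_def
    apply (rule wp_time)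
     apply (rule wp_Seq_exec, simp)
     apply (subst e)
     apply (rule wp_Seq_spec[OF loop1])
     apply (simp only: I_def An)
     apply (rule wp_Seq_exec, simp)
     apply (subst e2)
     apply (rule wp_mono[OF loop2 order_refl post], assumption)
    by simp
qed

lemma wp_rows:
  assumes b: "based low' N" "\<And>x. x \<noteq> a_tgt \<Longrightarrow> N x = (\<lambda>_. 0)"
  shows "wp P row_code (4 * n + 1)
    (\<lambda>\<sigma>. \<exists>N'. \<sigma> = st0 low' N' \<and> based low' N' \<and> (\<forall>u\<le>n. N' a_row u = u * n) \<and>
       (\<forall>x. x \<notin> {a_tgt, a_row, a_pos} \<longrightarrow> N' x 0 = 0)) (st0 low' N)"
proof -
  have l: "low' 3 = F" "low' 0 = n" using b(1) by (auto simp: based_def)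
  define I where "I i \<sigma> \<longleftrightarrow> (\<exists>N'. \<sigma> = st0 low' N' \<and> based low' N' \<and> N' a_pos 0 = i \<and> (\<forall>u\<le>i. N' a_row u = u * n) \<and>
       (\<forall>x. x \<notin> {a_tgt, a_row, a_pos} \<longrightarrow> N' x 0 = 0))" for i \<sigma>
  have I0: "I 0 (st0 low' N)" unfolding I_def by (rule exI[of _ N]) (use b in simp)
  have loop: "wp P row_code (n * Suc 3 + 1) (I n) (st0 low' N)" unfolding row_code_def
  proof (rule wp_While[of I, OF I0])
    fix i \<sigma> assume i: "i < n" "I i \<sigma>"
    then obtain N' where 1: "\<sigma> = st0 low' N'" "based low' N'" "N' a_pos 0 = i" "\<forall>u\<le>i. N' a_row u = u * n"
       "\<forall>x. x \<notin> {a_tgt, a_row, a_pos} \<longrightarrow> N' x 0 = 0" unfolding I_def by blast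
    let ?b = "Seq (set_NA a_row (NAdd (NV a_pos) (NConst 1)) (NAdd (NA a_row (NV a_pos)) (NGet (NConst 0)))) (inc a_pos)"
    define N2 where "N2 = N'(a_row := (N' a_row)(Suc i := Suc i * n), a_pos := (N' a_pos)(0 := Suc i))"
    have "exec ?b \<sigma> = st0 low' N2" using 1(3,4) l by (simp add: 1(1) N2_def add.commute)
    moreover have "I (Suc i) (st0 low' N2)" unfolding I_def
      by (rule exI[of _ N2]) (use 1 in \<open>auto simp: N2_def based_def le_Suc_eq\<close>)
    ultimately have "I (Suc i) (exec ?b \<sigma>)" by simp
    then show "bval (NLess (NV a_pos) (NGet (NConst 0))) \<sigma> \<and> wp P ?b 3 (I (Suc i)) \<sigma>"
      using 1(1,3) l i(1) by (intro conjI wp_time[OF wp_exec]) simp_all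
  next
    fix \<sigma> assume "I n \<sigma>"
    moreover from this obtain N' where "\<sigma> = st0 low' N'" "N' a_pos 0 = n" unfolding I_def by blast
    ultimately show "\<not> bval (NLess (NV a_pos) (NGet (NConst 0))) \<sigma> \<and> I n \<sigma>" using l by simp
  qed
  show ?thesis
    by (rule wp_mono[OF loop]) (auto simp: I_def)
qed

lemma wp_cells:
  assumes b: "based low' N" "\<forall>u\<le>n. N a_row u = u * n" "\<forall>x. x \<notin> {a_tgt, a_row, a_pos} \<longrightarrow> N x 0 = 0"
  shows "wp P cells_code (4 * k + 5)
    (\<lambda>\<sigma>. \<exists>N'. \<sigma> = st0 low N' \<and> N' a_tgt 0 = t \<and> (\<forall>u\<le>n. N' a_row u = u * n) \<and>
       N' a_dep 0 = 0 \<and> N' a_cell 0 = 0 \<and> N' a_fnd 0 = 0) (st0 low' N)"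
proof -
  have l: "low' 3 = F" "low' 0 = n" "low' (Suc 0) = k" using b(1) by (auto simp: based_def)
  have low4: "low'(4 := H) = low" using b(1) by (auto simp: based_def fun_eq_iff)
  define NI where "NI i = N(a_acc := (N a_acc)(0 := i * (n * n)), a_ag := (N a_ag)(0 := i))" for i
  define I where "I i \<sigma> \<longleftrightarrow> \<sigma> = st0 low' (NI i)" for i \<sigma>
  have "(N a_acc)(0 := 0) = N a_acc" "(N a_ag)(0 := 0) = N a_ag" using b(3) by (simp_all add: fun_upd_idem)
  then have N0: "NI 0 = N" by (simp add: NI_def)
  let ?b = "Seq (set_NV a_acc (NAdd (NV a_acc) (NA a_row (NGet (NConst 0))))) (inc a_ag)"
  have loop: "wp P (While (NLess (NV a_ag) (NGet (NConst 1))) ?b) (k * Suc 3 + 1) (I k) (st0 low' N)"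
  proof (rule wp_While)
    show "I 0 (st0 low' N)" by (simp add: I_def N0)
  next
    fix i \<sigma> assume i: "i < k" "I i \<sigma>"
    have "exec ?b \<sigma> = st0 low' (NI (Suc i))"
      using i(2) l b(2) by (simp add: I_def NI_def add.commute fun_upd_twist)
    then have "I (Suc i) (exec ?b \<sigma>)" by (simp add: I_def)
    then show "bval (NLess (NV a_ag) (NGet (NConst 1))) \<sigma> \<and> wp P ?b 3 (I (Suc i)) \<sigma>"
      using l i by (intro conjI wp_time[OF wp_exec]) (simp_all add: I_def NI_def)
  next
    fix \<sigma> assume "I k \<sigma>"
    then show "\<not> bval (NLess (NV a_ag) (NGet (NConst 1))) \<sigma> \<and> I k \<sigma>" using l by (simp add: I_def NI_def)
  qed
  have "exec (NSet (NConst 4) (NV a_acc)) (st0 low' (NI k)) = st0 low (NI k)"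
    using l low4 by (simp add: NI_def H)
  moreover have "\<exists>N'. st0 low (NI k) = st0 low N' \<and> N' a_tgt 0 = t \<and> (\<forall>u\<le>n. N' a_row u = u * n) \<and>
       N' a_dep 0 = 0 \<and> N' a_cell 0 = 0 \<and> N' a_fnd 0 = 0"
    by (rule exI[of _ "NI k"]) (use b in \<open>simp add: NI_def based_def\<close>)
  ultimately have last: "wp P (NSet (NConst 4) (NV a_acc)) 1 (\<lambda>\<sigma>. \<exists>N'. \<sigma> = st0 low N' \<and> N' a_tgt 0 = t \<and> (\<forall>u\<le>n. N' a_row u = u * n) \<and>
       N' a_dep 0 = 0 \<and> N' a_cell 0 = 0 \<and> N' a_fnd 0 = 0) (st0 low' (NI k))"
    by (intro wp_time[OF wp_exec]) simp_all
  show ?thesis unfolding cells_code_def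
    apply (rule wp_time)
     apply (rule wp_Seq_spec[OF loop])
     apply (simp only: I_def, rule last)
    by simp
qed

lemma wp_agents:
  "wp P agents_code (4 * k + 10) (\<lambda>\<sigma>. \<exists>N' R. \<sigma> = st N' R \<and> (\<forall>x. x \<noteq> a_ag \<longrightarrow> N' x = N x) \<and>
     R r_k 0 = real k \<and> R r_den 0 = 0) (st0 low N)"
proof -
  define NI where "NI i = N(a_ag := (N a_ag)(0 := i))" for i
  define RI where "RI i = (\<lambda>(_::nat) (_::nat). 0::real)(r_k := (\<lambda>_. 0)(0 := real i))" for i
  define I where "I i \<sigma> \<longleftrightarrow> \<sigma> = st (NI i) (RI i)" for i \<sigma>
  have e: "exec (set_NV a_ag (NConst 0)) (st0 low N) = st (NI 0) (RI 0)"
    by (simp add: NI_def RI_def fun_upd_idem)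
  let ?b = "Seq (set_RV r_k (RAdd (RV r_k) (RConst 1))) (inc a_ag)"
  have loop: "wp P (While (NLess (NV a_ag) (NGet (NConst 1))) ?b) (k * Suc 3 + 1) (I k) (st (NI 0) (RI 0))"
  proof (rule wp_While)
    show "I 0 (st (NI 0) (RI 0))" by (simp add: I_def)
  next
    fix i \<sigma> assume i: "i < k" "I i \<sigma>"
    then have "I (Suc i) (exec ?b \<sigma>)" by (simp add: I_def NI_def RI_def add.commute)
    then show "bval (NLess (NV a_ag) (NGet (NConst 1))) \<sigma> \<and> wp P ?b 3 (I (Suc i)) \<sigma>"
      using i by (intro conjI wp_time[OF wp_exec]) (simp_all add: I_def NI_def)
  next
    fix \<sigma> assume "I k \<sigma>"
    then show "\<not> bval (NLess (NV a_ag) (NGet (NConst 1))) \<sigma> \<and> I k \<sigma>" by (simp add: I_def NI_def)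
  qed
  show ?thesis unfolding agents_code_def
    apply (rule wp_time)
     apply (rule wp_Seq_exec, simp)
     apply (subst e)
     apply (rule wp_mono[OF loop order_refl])
    subgoal by (simp only: I_def, rule st_exI) (simp add: NI_def RI_def)
    by simp
qed

lemma wp_depth:
  assumes L: "n \<le> 2 ^ L" "\<And>i. i < L \<Longrightarrow> 2 ^ i < n" and D: "D = 4 * real L"
    and N: "N a_tgt 0 = t" "\<forall>u\<le>n. N a_row u = u * n" "N a_dep 0 = 0" "N a_cell 0 = 0" "N a_fnd 0 = 0"
    and R: "R r_k 0 = real k" "R r_den 0 = 0"
  shows "wp P depth_code (6 * L + 10) (cell_post 0) (st N R)"
proof -
  define NI where "NI i = N(a_acc := (N a_acc)(0 := 2 ^ i), a_dep := (N a_dep)(0 := i))" for i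
  define RI where "RI i = R(r_den := (R r_den)(0 := 4 * real i))" for i
  define I where "I i \<sigma> \<longleftrightarrow> \<sigma> = st (NI i) (RI i)" for i \<sigma>
  have e: "exec (set_NV a_acc (NConst 1)) (st N R) = st (NI 0) (RI 0)"
    using N(3) R(2) by (simp add: NI_def RI_def fun_upd_idem)
  let ?b = "Seq (set_NV a_acc (NAdd (NV a_acc) (NV a_acc)))
          (Seq (inc a_dep) (set_RV r_den (RAdd (RV r_den) (RConst 4))))"
  have loop: "wp P (While (NLess (NV a_acc) (NGet (NConst 0))) ?b) (L * Suc 5 + 1) (I L) (st (NI 0) (RI 0))"
  proof (rule wp_While)
    show "I 0 (st (NI 0) (RI 0))" by (simp add: I_def)
  next
    fix i \<sigma> assume i: "i < L" "I i \<sigma>"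
    have "exec ?b \<sigma> = st (NI (Suc i)) (RI (Suc i))"
      using i(2) by (simp add: I_def NI_def RI_def fun_upd_twist mult_2 add.commute)
    then have "I (Suc i) (exec ?b \<sigma>)" by (simp add: I_def)
    then show "bval (NLess (NV a_acc) (NGet (NConst 0))) \<sigma> \<and> wp P ?b 5 (I (Suc i)) \<sigma>"
      using i L(2) by (intro conjI wp_time[OF wp_exec]) (simp_all add: I_def NI_def)
  next
    fix \<sigma> assume "I L \<sigma>"
    then show "\<not> bval (NLess (NV a_acc) (NGet (NConst 0))) \<sigma> \<and> I L \<sigma>" using L(1) by (simp add: I_def NI_def)
  qed
  have post: "cell_post 0 (st (NI L) (RI L))"
    unfolding cell_post_def
    by (rule st_exI)
      (use N R in \<open>simp add: NI_def RI_def ready_def recorded_def candidates_def D[symmetric]\<close>)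
  show ?thesis unfolding depth_code_def
    apply (rule wp_time)
     apply (rule wp_Seq_exec, simp)
     apply (subst e)
     apply (rule wp_mono[OF loop order_refl])
    subgoal by (simp only: I_def post)
    by simp
qed

definition total_time :: nat where
  "total_time = 12 * n + 8 * k + 6 * L + H * (n * (walk_time + pot_time + 21) + 20) + walk_time +
     (2 ^ L + 1) * (2 * (2 ^ L + 1) + 20) + 4 * n + 200"

text \<open>If no candidate passes the test, the program still outputs a loop-erased walk for some
  threshold, but nothing is claimed about that threshold.\<close>

definition best_output where
  "best_output \<sigma> \<longleftrightarrow> (\<exists>\<theta>. outputs (loop_erase (final_walk \<theta>)) \<sigma> \<and>
     ((\<exists>\<theta>'\<in>candidates H 0. good \<theta>') \<longrightarrow> good \<theta> \<and> (\<forall>\<theta>'\<in>candidates H 0. good \<theta>' \<longrightarrow> \<theta> \<le> \<theta>')))"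

lemma wp_finish:
  assumes post: "cell_post H \<sigma>"
    and len: "\<And>\<theta>. 0 < length (loop_erase (final_walk \<theta>))" "\<And>\<theta>. length (loop_erase (final_walk \<theta>)) \<le> n"
  shows "wp P (Seq (set_RV r_th (RV r_bth)) (Seq walk_code (Seq erase_code output_code)))
    (walk_time + (2 ^ L + 1) * (2 * (2 ^ L + 1) + 20) + 4 * n + 50) best_output \<sigma>"
proof -
  obtain N R where 0: "\<sigma> = st N R" "ready N R" "recorded (candidates H 0) N R"
    using post unfolding cell_post_def by blast
  define \<theta> where "\<theta> = R r_bth 0"
  define R1 where "R1 = R(r_th := (R r_th)(0 := \<theta>))"
  have e: "exec (set_RV r_th (RV r_bth)) \<sigma> = st N R1" by (simp add: 0(1) R1_def \<theta>_def)
  have r1: "ready N R1" using 0(2) by (simp add: ready_def R1_def)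
  have best: "(\<exists>\<theta>'\<in>candidates H 0. good \<theta>') \<longrightarrow> good \<theta> \<and> (\<forall>\<theta>'\<in>candidates H 0. good \<theta>' \<longrightarrow> \<theta> \<le> \<theta>')"
    using 0(3) by (auto simp: recorded_def \<theta>_def split: if_splits)
  let ?w = "final_walk \<theta>"
  have wl: "length ?w = 2 ^ L + 1" using greedy_length[of "\<Phi> \<theta>" L "[s]" t] by simp
  have out: "wp P output_code (4 * n + 20) best_output \<sigma>2" if ep: "erase_post ?w (length ?w) \<sigma>2" for \<sigma>2
  proof -
    obtain N2 R2 where 2: "\<sigma>2 = st N2 R2" "N2 a_olen 0 = length (loop_erase ?w)"
      "\<forall>p<length (loop_erase ?w). N2 a_out p = loop_erase ?w ! p" using ep by (auto simp: erase_post_def)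
    show ?thesis unfolding 2(1)
      by (rule wp_mono[OF wp_output[OF len 2(2,3)] order_refl]) (use best in \<open>auto simp: best_output_def\<close>)
  qed
  have rest: "wp P (Seq erase_code output_code) (Suc (length ?w * (2 * length ?w + 20) + 10 + (4 * n + 20))) best_output \<sigma>1"
    if "walk_post N R1 \<sigma>1" for \<sigma>1
  proof -
    obtain N1 R2 where 1: "\<sigma>1 = st N1 R2" "walk N1 (final_walk (R1 r_th 0))"
      using \<open>walk_post N R1 \<sigma>1\<close> unfolding walk_post_def by blast
    then have "walk N1 ?w" by (simp add: R1_def)
    then show ?thesis unfolding 1(1) by (intro wp_Seq_spec[OF wp_erase out])
  qed
  show ?thesis
    apply (rule wp_time)
     apply (rule wp_Seq_exec, simp)
     apply (subst e)
     apply (rule wp_Seq_spec[OF wp_walk[OF r1] rest], assumption)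
    unfolding wl by simp
qed

lemma wp_main:
  assumes F_eq: "F = t + 4 + n * n"
    and low0: "low0 3 = t" "\<And>x. x \<noteq> 3 \<Longrightarrow> x \<noteq> 4 \<Longrightarrow> low0 x = low x"
    and L: "n \<le> 2 ^ L" "\<And>i. i < L \<Longrightarrow> 2 ^ i < n" and D: "D = 4 * real L"
    and len: "\<And>\<theta>. 0 < length (loop_erase (final_walk \<theta>))" "\<And>\<theta>. length (loop_erase (final_walk \<theta>)) \<le> n"
  shows "wp P main_code total_time best_output (st0 low0 (\<lambda>_ _. 0))"
proof -
  \<comment> \<open>The phases are composed from the last to the first, so each meets a continuation
    already known to be correct.\<close>
  have 6: "wp P (Seq search_code (Seq (set_RV r_th (RV r_bth)) (Seq walk_code (Seq erase_code output_code))))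
      (Suc (H * (n * (walk_time + pot_time + 21) + 20) + 1 +
        (walk_time + (2 ^ L + 1) * (2 * (2 ^ L + 1) + 20) + 4 * n + 50))) best_output \<sigma>" (is "wp P ?c6 ?t6 _ _")
    if "cell_post 0 \<sigma>" for \<sigma>
    by (rule wp_Seq_spec[OF wp_search[OF that] wp_finish[OF _ len]])
  have 5: "wp P (Seq depth_code ?c6) (Suc (6 * L + 10 + ?t6)) best_output \<sigma>" (is "wp P ?c5 ?t5 _ _")
    if "\<exists>N R. \<sigma> = st N R \<and> N a_tgt 0 = t \<and> (\<forall>u\<le>n. N a_row u = u * n) \<and> N a_dep 0 = 0 \<and> N a_cell 0 = 0 \<and>
      N a_fnd 0 = 0 \<and> R r_k 0 = real k \<and> R r_den 0 = 0" for \<sigma>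
  proof -
    obtain N R where 1: "\<sigma> = st N R" and 2: "N a_tgt 0 = t" "\<forall>u\<le>n. N a_row u = u * n" "N a_dep 0 = 0" "N a_cell 0 = 0"
      "N a_fnd 0 = 0" "R r_k 0 = real k" "R r_den 0 = 0" using \<open>\<exists>N R. _\<close> by blast
    show ?thesis unfolding 1 by (rule wp_Seq_spec[OF wp_depth[where N = N and R = R, OF L D 2] 6])
  qed
  have 4: "wp P (Seq agents_code ?c5) (Suc (4 * k + 10 + ?t5)) best_output \<sigma>" (is "wp P ?c4 ?t4 _ _")
    if ex: "\<exists>N'. \<sigma> = st0 low N' \<and> N' a_tgt 0 = t \<and> (\<forall>u\<le>n. N' a_row u = u * n) \<and>
       N' a_dep 0 = 0 \<and> N' a_cell 0 = 0 \<and> N' a_fnd 0 = 0" for \<sigma>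
  proof -
    obtain N where 1: "\<sigma> = st0 low N" "N a_tgt 0 = t \<and> (\<forall>u\<le>n. N a_row u = u * n) \<and>
       N a_dep 0 = 0 \<and> N a_cell 0 = 0 \<and> N a_fnd 0 = 0" using ex by blast
    show ?thesis unfolding 1(1)
    proof (rule wp_Seq_spec[OF wp_agents 5], elim exE conjE)
      fix \<sigma>' N' R assume "\<sigma>' = st N' R" "\<forall>x. x \<noteq> a_ag \<longrightarrow> N' x = N x" "R r_k 0 = real k" "R r_den 0 = 0"
      then show "\<exists>N R. \<sigma>' = st N R \<and> N a_tgt 0 = t \<and> (\<forall>u\<le>n. N a_row u = u * n) \<and> N a_dep 0 = 0 \<and> N a_cell 0 = 0 \<and>
          N a_fnd 0 = 0 \<and> R r_k 0 = real k \<and> R r_den 0 = 0"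
        using 1(2) by (intro exI[of _ N'] exI[of _ R]) simp
    qed
  qed
  have 3: "wp P (Seq cells_code ?c4) (Suc (4 * k + 5 + ?t4)) best_output \<sigma>" (is "wp P ?c3 ?t3 _ _")
    if ex: "\<exists>low' N'. \<sigma> = st0 low' N' \<and> based low' N' \<and> (\<forall>u\<le>n. N' a_row u = u * n) \<and>
       (\<forall>x. x \<notin> {a_tgt, a_row, a_pos} \<longrightarrow> N' x 0 = 0)" for \<sigma>
  proof -
    obtain low' N where 1: "\<sigma> = st0 low' N" and 2: "based low' N" "\<forall>u\<le>n. N a_row u = u * n"
       "\<forall>x. x \<notin> {a_tgt, a_row, a_pos} \<longrightarrow> N x 0 = 0" using ex by blast
    show ?thesis unfolding 1 by (rule wp_Seq_spec[OF wp_cells[OF 2] 4])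
  qed
  have 2: "wp P (Seq row_code ?c3) (Suc (4 * n + 1 + ?t3)) best_output \<sigma>" (is "wp P ?c2 ?t2 _ _")
    if ex: "\<exists>low' N. \<sigma> = st0 low' N \<and> based low' N \<and> (\<forall>x. x \<noteq> a_tgt \<longrightarrow> N x = (\<lambda>_. 0))" for \<sigma>
  proof -
    obtain low' N where 1: "\<sigma> = st0 low' N" and 2: "based low' N" "\<forall>x. x \<noteq> a_tgt \<longrightarrow> N x = (\<lambda>_. 0)" using ex by blast
    show ?thesis unfolding 1
      by (rule wp_Seq_spec[OF wp_rows[OF 2(1)] 3]) (use 2(2) in blast)+
  qed
  have "wp P (Seq base_code ?c2) (Suc (8 * n + 20 + ?t2)) best_output (st0 low0 (\<lambda>_ _. 0))"
    by (rule wp_Seq_spec[OF wp_base[OF F_eq low0] 2])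
  then show ?thesis unfolding main_code_def total_time_def by (rule wp_time) simp
qed

end


section \<open>Approximation guarantee and running time\<close>

lemma pairs_append:
  "xs \<noteq> [] \<Longrightarrow> set (zip (xs @ [v]) (tl (xs @ [v]))) = insert (last xs, v) (set (zip xs (tl xs)))"
  by (induction xs rule: induct_list012) auto

lemma pairs_take: "set (zip (take m xs) (tl (take m xs))) \<subseteq> set (zip xs (tl xs))"
proof -
  have "zip (take m xs) (tl (take m xs)) = take (m - 1) (zip xs (tl xs))"
    by (intro nth_equalityI) (auto simp: nth_tl)
  then show ?thesis by (simp add: set_take_subset)
qed

text \<open>Appending \<open>v\<close> has two cases. If \<open>v\<close> was visited before, the
  result is a prefix of the previous list and gains no pair. If not, the only new pair is (last,
  \<open>v\<close>), a step of the walk because the erased list ends where the walk ends.\<close>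

lemma loop_erase_facts:
  assumes "xs \<noteq> []"
  shows "loop_erase xs \<noteq> [] \<and> hd (loop_erase xs) = hd xs \<and> last (loop_erase xs) = last xs \<and>
    distinct (loop_erase xs) \<and> set (loop_erase xs) \<subseteq> set xs \<and>
    set (zip (loop_erase xs) (tl (loop_erase xs))) \<subseteq> set (zip xs (tl xs))"
  using assms
proof (induction xs rule: rev_induct)
  case (snoc v xs)
  show ?case
  proof (cases "xs = []")
    case True
    then show ?thesis by (simp add: loop_erase_def)
  next
    case False
    define zs where "zs = loop_erase xs"
    define tw where "tw = takeWhile (\<lambda>u. u \<noteq> v) zs"
    have IH: "zs \<noteq> []" "hd zs = hd xs" "last zs = last xs" "distinct zs" "set zs \<subseteq> set xs"
      "set (zip zs (tl zs)) \<subseteq> set (zip xs (tl xs))" using snoc.IH[OF False] by (auto simp: zs_def)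
    have e: "loop_erase (xs @ [v]) = tw @ [v]" by (simp add: erase_snoc zs_def tw_def)
    have dist: "distinct (tw @ [v])" using IH(4) by (auto simp: tw_def dest: set_takeWhileD)
    have sub: "set tw \<subseteq> set xs" using IH(5) by (auto simp: tw_def dest: set_takeWhileD)
    have hd: "hd (tw @ [v]) = hd xs"
    proof (cases "hd zs = v")
      case True
      then have "tw = []" using IH(1) by (cases zs) (simp_all add: tw_def)
      then show ?thesis using True IH(2) by simp
    next
      case False
      then have "tw \<noteq> [] \<and> hd tw = hd zs" using IH(1) by (cases zs) (simp_all add: tw_def)
      then show ?thesis using IH(2) by simp
    qed
    have pairs: "set (zip (tw @ [v]) (tl (tw @ [v]))) \<subseteq> set (zip (xs @ [v]) (tl (xs @ [v])))"
    proof (cases "v \<in> set zs")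
      case True
      define m where "m = length tw"
      have take: "tw = take m zs" by (simp add: m_def tw_def takeWhile_eq_take[symmetric])
      have "tw \<noteq> zs" using True by (auto simp: tw_def takeWhile_eq_all_conv)
      then have m: "m < length zs" using take by (metis not_less take_all)
      then have "zs ! m = v" using nth_length_takeWhile[of "\<lambda>u. u \<noteq> v" zs] by (simp add: m_def tw_def)
      then have "tw @ [v] = take (Suc m) zs" using m take by (simp add: take_Suc_conv_app_nth)
      then show ?thesis using pairs_take[of "Suc m" zs] IH(6) pairs_append[OF False, of v] by auto
    next
      case False
      then have "tw = zs" by (auto simp: tw_def takeWhile_eq_all_conv)
      then show ?thesis using pairs_append[OF IH(1), of v] pairs_append[OF \<open>xs \<noteq> []\<close>, of v] IH(3,6) by auto
    qed
    show ?thesis using e dist sub hd pairs False by auto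
  qed
qed simp

text \<open>A walk may repeat a step, which a set of pairs counts only once.\<close>

lemma sum_pairs_le_step_sum:
  assumes "\<And>a b. 0 \<le> y a b" "A \<subseteq> set (zip xs (tl xs))"
  shows "(\<Sum>e\<in>A. y (fst e) (snd e)) \<le> step_sum y xs"
proof -
  have "(\<Sum>e\<in>set (zip xs (tl xs)). y (fst e) (snd e)) \<le> step_sum y xs"
  proof (induction xs rule: induct_list012)
    case (3 u v xs)
    then show ?case using assms(1)[of u v] by (auto simp: sum.insert_if)
  qed auto
  moreover have "(\<Sum>e\<in>A. y (fst e) (snd e)) \<le> (\<Sum>e\<in>set (zip xs (tl xs)). y (fst e) (snd e))"
    using assms by (intro sum_mono2) auto
  ultimately show ?thesis by linarith
qed

lemma st_paths_iff:
  "p \<in> st_paths G s t \<longleftrightarrow>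
    s \<in> pverts G \<and> set p \<subseteq> parcs G \<and> pcas s p t \<and> distinct (pawalk_verts s p)"
  by (simp add: st_paths_def pre_digraph.apath_def pre_digraph.awalk_def cas_with_proj_eq
      awalk_verts_with_proj_eq)

lemma pcas_verts: "pcas s p t \<Longrightarrow> pawalk_verts s p = s # map snd p \<and> last (s # map snd p) = t"
  by (induction p arbitrary: s) auto

lemma step_sum_pcas: "pcas s p t \<Longrightarrow> step_sum y (s # map snd p) = (\<Sum>e\<leftarrow>p. y (fst e) (snd e))"
  by (induction p arbitrary: s) auto

lemma step_sum_replicate: "(\<And>a. y a a = 0) \<Longrightarrow> step_sum y (v # replicate m v) = 0"
  by (induction m) auto

lemma pcas_pairs:
  "zs \<noteq> [] \<Longrightarrow> pcas (hd zs) (zip zs (tl zs)) (last zs) \<and> pawalk_verts (hd zs) (zip zs (tl zs)) = zs"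
  by (induction zs rule: induct_list012) auto

text \<open>Row-major addressing; applied once to the adjacency matrix and twice, nested, to the
  cost matrices.\<close>

lemma concat_uniform:
  assumes "\<And>i. i < m \<Longrightarrow> length (f i) = w"
  shows "length (concat (map f [0..<m])) = m * w \<and>
    (\<forall>i<m. \<forall>j<w. concat (map f [0..<m]) ! (i * w + j) = f i ! j)"
  using assms
proof (induction m)
  case (Suc m)
  have len: "length (concat (map f [0..<m])) = m * w" and
    nth: "\<And>i j. i < m \<Longrightarrow> j < w \<Longrightarrow> concat (map f [0..<m]) ! (i * w + j) = f i ! j"
    using Suc by auto
  have "i * w + j < m * w" if "i < m" "j < w" for i j
  proof -
    have "i * w + j < Suc i * w" using that by simp
    also have "\<dots> \<le> m * w" using that by (intro mult_le_mono1) simp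
    finally show ?thesis .
  qed
  then show ?case using len nth Suc.prems by (auto simp: nth_append less_Suc_eq)
qed simp

definition program :: prog where
  "program = [main_code, greedy_code, potential_code]"

section \<open>The machine on the input of a given instance\<close>

locale robust =
  fixes G :: "nat pair_pre_digraph" and s t k :: nat and c :: "nat \<Rightarrow> nat \<times> nat \<Rightarrow> real"
  assumes inst: "robust_instance G s t k c"
begin

definition n :: nat where "n = card (pverts G)"
definition L :: nat where "L = (LEAST L. n \<le> 2 ^ L)"
definition F :: nat where "F = t + 4 + n * n"
definition H :: nat where "H = k * (n * n)"
definition low0 :: "nat \<Rightarrow> nat" where "low0 = nmem (input_mem G s t k c)"
definition low :: "nat \<Rightarrow> nat" where "low = low0(3 := F, 4 := H)"
definition rlow :: "nat \<Rightarrow> real" where "rlow = rmem (input_mem G s t k c)"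
definition cost :: "nat \<Rightarrow> nat \<Rightarrow> nat \<Rightarrow> real" where
  "cost i u v = (if i < k \<and> (u, v) \<in> parcs G then c i (u, v) else 0)"

lemma verts: "pverts G = {..<n}"
  and s_less: "s < n" and t_less: "t < n" and k_pos: "0 < k"
  and c_nonneg: "\<And>i e. i < k \<Longrightarrow> e \<in> parcs G \<Longrightarrow> 0 \<le> c i e"
  and fin_digraph: "pair_fin_digraph G"
proof -
  show v: "pverts G = {..<n}" using inst unfolding robust_instance_def n_def by blast
  show "s < n" "t < n" using inst v unfolding robust_instance_def by auto
qed (use inst in \<open>auto simp: robust_instance_def\<close>)

lemma arcs_less: "(u, v) \<in> parcs G \<Longrightarrow> u < n \<and> v < n"
  using pair_wf_digraph.in_arcsD1[of G u v] pair_wf_digraph.in_arcsD2[of G u v]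
    pair_fin_digraph.axioms(1)[OF fin_digraph] verts by auto

lemma input_nat:
  "low0 0 = n" "low0 (Suc 0) = k" "low0 2 = s" "low0 3 = t"
  "\<And>u v. \<lbrakk>u < n; v < n\<rbrakk> \<Longrightarrow> low0 (4 + (u * n + v)) = of_bool ((u, v) \<in> parcs G)"
  "\<And>a. F \<le> a \<Longrightarrow> low0 a = 0"
proof -
  define f where "f = (\<lambda>u. map (\<lambda>v. of_bool ((u, v) \<in> parcs G) :: nat) [0..<n])"
  define xs where "xs = concat (map f [0..<n])"
  have low: "low0 = cells ([n, k, s, t] @ xs)"
    by (simp add: low0_def input_mem_def Let_def n_def xs_def f_def)
  have len: "length xs = n * n" and
    nth: "\<And>u v. u < n \<Longrightarrow> v < n \<Longrightarrow> xs ! (u * n + v) = of_bool ((u, v) \<in> parcs G)"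
    using concat_uniform[of n f n] unfolding xs_def by (simp_all add: f_def)
  show "low0 0 = n" "low0 (Suc 0) = k" "low0 2 = s" "low0 3 = t" by (simp_all add: low cells_def)
  show "low0 (4 + (u * n + v)) = of_bool ((u, v) \<in> parcs G)" if uv: "u < n" "v < n" for u v
  proof -
    have "u * n + v < Suc u * n" using uv by simp
    also have "\<dots> \<le> n * n" using uv by (intro mult_le_mono1) simp
    finally show ?thesis using nth[OF uv] len by (simp add: low cells_def)
  qed
  show "low0 a = 0" if "F \<le> a" for a using that len by (simp add: low cells_def F_def)
qed

lemma input_real:
  "\<And>i u v. \<lbrakk>i < k; u < n; v < n\<rbrakk> \<Longrightarrow>
    rlow (i * (n * n) + (u * n + v)) = (if (u, v) \<in> parcs G then cost i u v else 0)"
  "\<And>a. H \<le> a \<Longrightarrow> rlow a = 0"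
proof -
  define f where "f = (\<lambda>i u. map (\<lambda>v. if (u, v) \<in> parcs G then c i (u, v) else 0) [0..<n])"
  define g where "g = (\<lambda>i. concat (map (f i) [0..<n]))"
  define xs where "xs = concat (map g [0..<k])"
  have low: "rlow = cells xs"
    by (simp add: rlow_def input_mem_def Let_def n_def xs_def g_def f_def)
  have g: "length (g i) = n * n"
    "\<And>u v. u < n \<Longrightarrow> v < n \<Longrightarrow> g i ! (u * n + v) = (if (u, v) \<in> parcs G then c i (u, v) else 0)" for i
    using concat_uniform[of n "f i" n] unfolding g_def by (auto simp: f_def)
  have xs: "length xs = k * (n * n)" "\<And>i j. i < k \<Longrightarrow> j < n * n \<Longrightarrow> xs ! (i * (n * n) + j) = g i ! j"
    using concat_uniform[of k g "n * n"] g(1) unfolding xs_def by auto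
  show "rlow (i * (n * n) + (u * n + v)) = (if (u, v) \<in> parcs G then cost i u v else 0)"
    if iuv: "i < k" "u < n" "v < n" for i u v
  proof -
    have "u * n + v < Suc u * n" using iuv by simp
    also have "\<dots> \<le> n * n" using iuv by (intro mult_le_mono1) simp
    finally have uv: "u * n + v < n * n" .
    then have "i * (n * n) + (u * n + v) < Suc i * (n * n)" by simp
    also have "\<dots> \<le> k * (n * n)" using iuv by (intro mult_le_mono1) simp
    finally show ?thesis using uv iuv by (simp add: low cells_def xs g(2) cost_def)
  qed
  show "rlow a = 0" if "H \<le> a" for a using that xs(1) by (simp add: low cells_def H_def)
qed

lemma L_props: "n \<le> 2 ^ L" "\<And>i. i < L \<Longrightarrow> 2 ^ i < n"
proof -
  have "n \<le> 2 ^ n" by (simp add: less_imp_le)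
  then show "n \<le> 2 ^ L" unfolding L_def by (rule LeastI)
  show "2 ^ i < n" if "i < L" for i using not_less_Least[OF that[unfolded L_def]] by simp
qed

sublocale machine F H n k s t L "4 * real L" rlow low program "\<lambda>u v. (u, v) \<in> parcs G" cost
proof unfold_locales
  fix u v assume uv: "u < n" "v < n" "u \<noteq> v"
  \<comment> \<open>Only the loop at vertex 0 has row-major index 0, so distinct vertices never lead
    to the overwritten cell 4.\<close>
  then have "0 < u * n + v" by (cases "u = 0") auto
  then show "low (4 + (u * n + v)) = of_bool ((u, v) \<in> parcs G)" using input_nat(5)[OF uv(1,2)] by (auto simp: low_def)
qed (use s_less t_less input_nat input_real in \<open>simp_all add: F_def H_def low_def program_def\<close>)

lemma input_layout: "input_mem G s t k c = layout F H rlow low0 (\<lambda>_ _. 0) (\<lambda>_ _. 0)"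
proof -
  have "nmem (input_mem G s t k c) = (\<lambda>a. if a < F then low0 a else 0)"
    using input_nat(6) by (auto simp: fun_eq_iff low0_def)
  moreover have "rmem (input_mem G s t k c) = (\<lambda>a. if a < H then rlow a else 0)"
    using input_real(2) by (auto simp: fun_eq_iff rlow_def)
  ultimately show ?thesis by (simp add: layout_def)
qed

abbreviation y :: "real \<Rightarrow> nat \<Rightarrow> nat \<Rightarrow> nat \<Rightarrow> real" where
  "y \<equiv> step_cost (\<lambda>u v. (u, v) \<in> parcs G) cost k (4 * real L)"

lemma cost_nonneg: "0 \<le> cost i u v"
  using c_nonneg by (simp add: cost_def)

lemma y_nonneg: "0 \<le> y \<theta> i u v"
proof (cases "(u, v) \<in> parcs G \<and> cost i u v \<le> \<theta>")
  case True
  then have "0 \<le> \<theta>" using cost_nonneg[of i u v] by linarith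
  then show ?thesis using cost_nonneg[of i u v] by (simp add: step_cost_def)
qed (auto simp: step_cost_def)

lemma final_walk_facts:
  "final_walk \<theta> \<noteq> []" "hd (final_walk \<theta>) = s" "last (final_walk \<theta>) = t" "set (final_walk \<theta>) \<subseteq> {..<n}"
  using greedy_extends[OF n, of "\<Phi> \<theta>" L "[s]" t] s_less t_less by auto

definition route :: "real \<Rightarrow> nat list" where "route \<theta> = loop_erase (final_walk \<theta>)"

lemma route_facts:
  "route \<theta> \<noteq> []" "hd (route \<theta>) = s" "last (route \<theta>) = t" "distinct (route \<theta>)" "set (route \<theta>) \<subseteq> {..<n}"
  "set (zip (route \<theta>) (tl (route \<theta>))) \<subseteq> set (zip (final_walk \<theta>) (tl (final_walk \<theta>)))"
  using loop_erase_facts[OF final_walk_facts(1)[of \<theta>]] final_walk_facts[of \<theta>]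
  unfolding route_def by auto

lemma route_length: "0 < length (route \<theta>)" "length (route \<theta>) \<le> n"
  using route_facts(1) card_mono[OF _ route_facts(5)[of \<theta>]] distinct_card[OF route_facts(4)[of \<theta>]] by auto

lemma output_path_eq:
  assumes "outputs zs \<sigma>" "zs \<noteq> []"
  shows "output_path (K, \<sigma>) = zip zs (tl zs)"
  using assms by (intro nth_equalityI) (auto simp: output_path_def Let_def outputs_def nth_tl)

lemma route_distinct_ends:
  assumes "e \<in> set (zip (route \<theta>) (tl (route \<theta>)))"
  shows "fst e \<noteq> snd e"
proof -
  obtain j where "j < length (route \<theta>) - 1" "e = (route \<theta> ! j, route \<theta> ! Suc j)"
    using assms by (auto simp: set_zip nth_tl)
  then show ?thesis using route_facts(4)[of \<theta>] by (simp add: nth_eq_iff_index_eq)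
qed

lemma route_in_paths:
  assumes "\<And>e. e \<in> set (zip (route \<theta>) (tl (route \<theta>))) \<Longrightarrow> e \<in> parcs G"
  shows "zip (route \<theta>) (tl (route \<theta>)) \<in> st_paths G s t"
  using pcas_pairs[OF route_facts(1)[of \<theta>]] route_facts[of \<theta>] assms s_less verts
  by (auto simp: st_paths_iff)

text \<open>The test bounds each weight by \<open>k + 1\<close>. This excludes penalty steps, so the
  steps of the route are arcs of cost at most \<theta>; the remaining scaled costs are at most 1, so
  their sum is at most 2 ln (k + 1), and undoing the scale 4 L \<theta> gives the bound.\<close>

lemma good_route:
  assumes "good \<theta>" "1 \<le> L" "s \<noteq> t"
  shows "zip (route \<theta>) (tl (route \<theta>)) \<in> st_paths G s t"
    and "robust_cost k c (zip (route \<theta>) (tl (route \<theta>))) \<le> 8 * real L * \<theta> * ln (real k + 1)"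
proof -
  let ?w = "final_walk \<theta>" and ?A = "set (zip (route \<theta>) (tl (route \<theta>)))"
  have prod: "step_prod (y \<theta> i) ?w < real k + 1" if i: "i < k" for i
  proof -
    \<comment> \<open>The other k - 1 weights are at least 1, which leaves less than 2 k - (k - 1)
      for agent \<open>i\<close>.\<close>
    have "(\<Sum>j\<in>{..<k} - {i}. 1) \<le> (\<Sum>j\<in>{..<k} - {i}. step_prod (y \<theta> j) ?w)"
      using step_prod_ge_1[OF y_nonneg] by (intro sum_mono) auto
    moreover have "(\<Sum>j\<in>{..<k} - {i}. (1::real)) = real k - 1" using i by simp
    moreover have "\<Phi> \<theta> ?w = step_prod (y \<theta> i) ?w + (\<Sum>j\<in>{..<k} - {i}. step_prod (y \<theta> j) ?w)"
      using i by (simp add: potential_def sum.remove)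
    ultimately show ?thesis using assms(1) by (simp add: good_def)
  qed
  have step: "a = b \<or> (a, b) \<in> parcs G \<and> cost i a b \<le> \<theta>"
    if "(a, b) \<in> set (zip ?w (tl ?w))" "i < k" for a b i
  proof (rule ccontr)
    assume "\<not> ?thesis"
    then have "y \<theta> i a b = real k" by (auto simp: step_cost_def)
    moreover have "1 + y \<theta> i a b \<le> step_prod (y \<theta> i) ?w"
      by (rule step_prod_factor_le[OF y_nonneg that(1)])
    ultimately show False using prod[OF that(2)] by simp
  qed
  have arcs: "e \<in> parcs G" if "e \<in> ?A" for e
    using step[of "fst e" "snd e" 0] that route_facts(6)[of \<theta>] route_distinct_ends[OF that] k_pos by auto
  then show "zip (route \<theta>) (tl (route \<theta>)) \<in> st_paths G s t" by (rule route_in_paths)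
  have "path_cost (c i) (zip (route \<theta>) (tl (route \<theta>))) \<le> 8 * real L * \<theta> * ln (real k + 1)" if i: "i < k" for i
  proof -
    \<comment> \<open>As s and t differ, the route has an arc, and its cost of at most \<theta>
      forces \<theta> to be nonnegative.\<close>
    have "?A \<noteq> {}"
    proof
      assume "?A = {}"
      then have "tl (route \<theta>) = []" using route_facts(1)[of \<theta>] by (cases "route \<theta>"; cases "tl (route \<theta>)") auto
      then show False using route_facts(1-3)[of \<theta>] assms(3) by (cases "route \<theta>") auto
    qed
    then obtain e where e: "e \<in> ?A" by (metis ex_in_conv)
    have le: "cost i (fst e) (snd e) \<le> \<theta>" if "e \<in> ?A" for e
      using step[of "fst e" "snd e" i] that route_facts(6)[of \<theta>] route_distinct_ends[OF that] i by auto
    have th: "0 \<le> \<theta>" using le[OF e] cost_nonneg[of i "fst e" "snd e"] by linarith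
    have ye: "c i e = 4 * real L * \<theta> * y \<theta> i (fst e) (snd e)" if "e \<in> ?A" for e
    proof -
      have "y \<theta> i (fst e) (snd e) = c i e / (4 * real L * \<theta>)"
        using le[OF that] arcs[OF that] route_distinct_ends[OF that] i by (simp add: step_cost_def cost_def)
      \<comment> \<open>For \<theta> = 0 the scaled cost is a division by zero and cannot be scaled
        back; but then the arc is free anyway.\<close>
      moreover have "c i e = 0" if "\<theta> = 0"
        using le[OF \<open>e \<in> ?A\<close>] arcs[OF \<open>e \<in> ?A\<close>] c_nonneg[OF i arcs[OF \<open>e \<in> ?A\<close>]] that i by (simp add: cost_def)
      ultimately show ?thesis using assms(2) by auto
    qed
    have y1: "0 \<le> y \<theta> i a b \<and> y \<theta> i a b \<le> 1" if "(a, b) \<in> set (zip ?w (tl ?w))" for a b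
    proof (cases "a = b")
      case False
      then have 1: "cost i a b \<le> \<theta>" "(a, b) \<in> parcs G" using step[OF that i] by auto
      moreover have "\<theta> \<le> 4 * real L * \<theta>" using assms(2) th mult_right_mono[of 1 "4 * real L" \<theta>] by simp
      ultimately have "cost i a b \<le> 4 * real L * \<theta>" by linarith
      then have "y \<theta> i a b \<le> 1"
        using 1 th False assms(2) by (cases "\<theta> = 0") (simp_all add: step_cost_def)
      then show ?thesis using y_nonneg by simp
    qed (simp add: step_cost_def)
    have "exp (step_sum (y \<theta> i) ?w / 2) < real k + 1"
      by (rule le_less_trans[OF exp_half_step_sum_le[of ?w "y \<theta> i", OF y1] prod[OF i]])
    then have "ln (exp (step_sum (y \<theta> i) ?w / 2)) < ln (real k + 1)"
      by (subst ln_less_cancel_iff) auto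
    then have ss: "step_sum (y \<theta> i) ?w \<le> 2 * ln (real k + 1)" by simp
    have "path_cost (c i) (zip (route \<theta>) (tl (route \<theta>))) = (\<Sum>e\<in>?A. 4 * real L * \<theta> * y \<theta> i (fst e) (snd e))"
      unfolding path_cost_def using ye by (intro sum.cong) auto
    also have "\<dots> = 4 * real L * \<theta> * (\<Sum>e\<in>?A. y \<theta> i (fst e) (snd e))" by (simp add: sum_distrib_left)
    also have "\<dots> \<le> 4 * real L * \<theta> * (2 * ln (real k + 1))"
    proof (intro mult_left_mono)
      show "(\<Sum>e\<in>?A. y \<theta> i (fst e) (snd e)) \<le> 2 * ln (real k + 1)"
        by (rule order_trans[OF sum_pairs_le_step_sum[OF y_nonneg route_facts(6)] ss])
    qed (use th in simp)
    finally show ?thesis by (simp add: algebra_simps)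
  qed
  then show "robust_cost k c (zip (route \<theta>) (tl (route \<theta>))) \<le> 8 * real L * \<theta> * ln (real k + 1)"
    unfolding robust_cost_def using k_pos by (subst Max_le_iff) auto
qed

section \<open>Thresholds that reach the optimum pass the test\<close>

lemma paths_finite: "finite (st_paths G s t)"
proof -
  interpret pair_fin_digraph G by (rule fin_digraph)
  show ?thesis unfolding st_paths_def by (rule apaths_finite)
qed

lemma path_facts:
  assumes "p \<in> st_paths G s t"
  shows "distinct p" "length p < n" "set (map snd p) \<subseteq> {..<n}" "last (s # map snd p) = t"
    "\<And>y. step_sum y (s # map snd p) = (\<Sum>e\<in>set p. y (fst e) (snd e))"
proof -
  have p: "set p \<subseteq> parcs G" "pcas s p t" "distinct (pawalk_verts s p)"
    using assms by (auto simp: st_paths_iff)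
  note v = pcas_verts[OF p(2)]
  have d: "distinct (s # map snd p)" using p(3) v by simp
  then show dp: "distinct p" by (simp add: distinct_map)
  show sub: "set (map snd p) \<subseteq> {..<n}" using p(1) arcs_less by fastforce
  have "card (set (s # map snd p)) \<le> card {..<n}" using sub s_less by (intro card_mono) auto
  then show "length p < n" using distinct_card[OF d] by simp
  show "last (s # map snd p) = t" using v by simp
  show "step_sum y (s # map snd p) = (\<Sum>e\<in>set p. y (fst e) (snd e))" for y
    using step_sum_pcas[OF p(2)] dp by (simp add: sum_list_distinct_conv_sum_set)
qed

lemma path_cost_nonneg: "p \<in> st_paths G s t \<Longrightarrow> i < k \<Longrightarrow> 0 \<le> path_cost (c i) p"
  unfolding path_cost_def using c_nonneg by (intro sum_nonneg) (auto simp: st_paths_iff)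

lemma arc_le_path_cost:
  "p \<in> st_paths G s t \<Longrightarrow> i < k \<Longrightarrow> e \<in> set p \<Longrightarrow> c i e \<le> path_cost (c i) p"
  unfolding path_cost_def using c_nonneg by (intro member_le_sum) (auto simp: st_paths_iff)

text \<open>The reference walk for \<open>greedy_potential\<close> is the path, padded by waiting at
  \<open>t\<close> to exactly 2^L steps. No arc of it is penalized, since one arc costs at most the
  whole path, and its scaled cost is at most \<eta> = 1 / (4 L) for every agent.\<close>

lemma path_good:
  assumes p: "p \<in> st_paths G s t" and \<theta>: "\<And>i. i < k \<Longrightarrow> path_cost (c i) p \<le> \<theta>" and L: "1 \<le> L"
  shows "good \<theta>"
proof -
  define ys where "ys = map snd p @ replicate (2 ^ L - length p) t"
  have len: "length p < 2 ^ L" using path_facts(2)[OF p] L_props(1) by simp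
  then have ys: "length ys = 2 ^ L" "last ys = t" by (simp_all add: ys_def)
  have sub: "set ys \<subseteq> {..<n}" using path_facts(3)[OF p] t_less by (auto simp: ys_def)
  have sum: "step_sum (y \<theta> i) (last [s] # ys) \<le> 1 / (4 * real L)" if i: "i < k" for i
  proof -
    have th: "0 \<le> \<theta>" using \<theta>[OF i] path_cost_nonneg[OF p i] by linarith
    have ye: "y \<theta> i (fst e) (snd e) \<le> c i e / (4 * real L * \<theta>)" if "e \<in> set p" for e
    proof -
      have "e \<in> parcs G" using p that by (auto simp: st_paths_iff)
      moreover have "c i e \<le> \<theta>" using arc_le_path_cost[OF p i that] \<theta>[OF i] by linarith
      ultimately show ?thesis using c_nonneg[OF i] th i by (simp add: step_cost_def cost_def)
    qed
    have "step_sum (y \<theta> i) (s # ys) = step_sum (y \<theta> i) (s # map snd p)"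
      using step_sum_append[of "s # map snd p" "y \<theta> i" "replicate (2 ^ L - length p) t"] path_facts(4)[OF p]
        step_sum_replicate[of "y \<theta> i"] by (simp add: ys_def step_cost_def)
    also have "\<dots> = (\<Sum>e\<in>set p. y \<theta> i (fst e) (snd e))" by (rule path_facts(5)[OF p])
    also have "\<dots> \<le> (\<Sum>e\<in>set p. c i e / (4 * real L * \<theta>))" by (intro sum_mono ye)
    also have "\<dots> = path_cost (c i) p / (4 * real L * \<theta>)" by (simp add: path_cost_def sum_divide_distrib)
    also have "\<dots> \<le> \<theta> / (4 * real L * \<theta>)" using \<theta>[OF i] th by (intro divide_right_mono) auto
    also have "\<dots> \<le> 1 / (4 * real L)" by simp
    finally show ?thesis by simp
  qed
  have "\<Phi> \<theta> (final_walk \<theta>) - \<Phi> \<theta> [s]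
      \<le> (\<Sum>i<k. step_prod (y \<theta> i) [s] * step_sum (y \<theta> i) (last [s] # ys)) / (1 - real L * (1 / (4 * real L)))"
    using greedy_potential[of "y \<theta>" "1 / (4 * real L)" "[s]" ys L n k] y_nonneg ys sub sum L by simp
  also have "1 - real L * (1 / (4 * real L)) = 3 / 4" using L by simp
  also have "(\<Sum>i<k. step_prod (y \<theta> i) [s] * step_sum (y \<theta> i) (last [s] # ys)) / (3 / 4)
      \<le> (\<Sum>i<k. 1 / (4 * real L)) / (3 / 4)"
    using sum by (intro divide_right_mono sum_mono) auto
  also have "\<dots> = real k / (3 * real L)" by simp
  also have "\<dots> < real k" using L k_pos by (simp add: divide_less_eq)
  finally have "\<Phi> \<theta> (final_walk \<theta>) - \<Phi> \<theta> [s] < real k" .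
  then show ?thesis by (simp add: good_def potential_def)
qed

lemma robust_cost_ge: "i < k \<Longrightarrow> path_cost (c i) p \<le> robust_cost k c p"
  unfolding robust_cost_def by (intro Max_ge) auto

lemma OPT_path:
  assumes "st_paths G s t \<noteq> {}"
  obtains p where "p \<in> st_paths G s t" "robust_cost k c p = OPT G s t k c"
proof -
  have "OPT G s t k c \<in> robust_cost k c ` st_paths G s t"
    unfolding OPT_def using paths_finite assms by (intro Min_in) auto
  with that show ?thesis by auto
qed

text \<open>
  If \<open>M\<close> is the largest cost of an arc of an optimal path, then the optimum lies between \<open>M\<close> and
  \<open>n * M\<close>, so a multiple of \<open>M\<close> approximates it up to a factor of \<open>2\<close>.
\<close>

lemma good_candidate:
  assumes "st_paths G s t \<noteq> {}" "s \<noteq> t" "1 \<le> L"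
  obtains \<theta> where "\<theta> \<in> candidates H 0" "good \<theta>" "\<theta> \<le> 2 * OPT G s t k c"
proof -
  obtain p where p: "p \<in> st_paths G s t" "robust_cost k c p = OPT G s t k c" using OPT_path[OF assms(1)] .
  define opt where "opt = OPT G s t k c"
  have le_opt: "path_cost (c i) p \<le> opt" if "i < k" for i
    using robust_cost_ge[OF that, of p] p(2) by (simp add: opt_def)
  have "p \<noteq> []" using p(1) assms(2) by (auto simp: st_paths_iff)
  define V where "V = (\<lambda>(i, e). c i e) ` ({..<k} \<times> set p)"
  have V: "finite V" "V \<noteq> {}" using \<open>p \<noteq> []\<close> k_pos by (auto simp: V_def)
  obtain i e where ie: "i < k" "e \<in> set p" "c i e = Max V" using Max_in[OF V] by (auto simp: V_def)
  define M where "M = c i e"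
  have e: "e \<in> parcs G" using p(1) ie by (auto simp: st_paths_iff)
  have M0: "0 \<le> M" using c_nonneg[OF ie(1) e] by (simp add: M_def)
  have Mopt: "M \<le> opt" using arc_le_path_cost[OF p(1) ie(1,2)] le_opt[OF ie(1)] by (simp add: M_def)
  have "path_cost (c j) p \<le> real n * M" if j: "j < k" for j
  proof -
    have "path_cost (c j) p \<le> (\<Sum>e\<in>set p. M)"
      unfolding path_cost_def M_def ie(3) using j V(1) by (intro sum_mono Max_ge) (auto simp: V_def)
    also have "\<dots> = real (length p) * M" using distinct_card[OF path_facts(1)[OF p(1)]] by simp
    also have "\<dots> \<le> real n * M" using path_facts(2)[OF p(1)] M0 by (intro mult_right_mono) auto
    finally show ?thesis .
  qed
  then have "robust_cost k c p \<le> real n * M"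
    unfolding robust_cost_def using k_pos by (subst Max_le_iff) auto
  then have opt_le: "opt \<le> real n * M" using p(2) by (simp add: opt_def)
  \<comment> \<open>The least multiple of M that reaches the optimum exceeds it by less than M, and
    M is itself at most the optimum.\<close>
  obtain j where j: "j < n" "opt \<le> real (Suc j) * M" "real (Suc j) * M \<le> 2 * opt"
  proof (cases "opt \<le> M")
    case True
    then show ?thesis using that[of 0] n Mopt M0 by simp
  next
    case False
    define m where "m = (LEAST m. opt \<le> real m * M)"
    have m: "opt \<le> real m * M" unfolding m_def using opt_le by (rule LeastI)
    have mn: "m \<le> n" unfolding m_def using opt_le by (rule Least_le)
    have "m \<noteq> 0" using m False M0 Mopt by (intro notI) auto
    then obtain j where mj: "m = Suc j" by (cases m) auto
    have "\<not> opt \<le> real j * M" using not_less_Least[of j "\<lambda>m. opt \<le> real m * M"] mj by (simp add: m_def)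
    then have "real (Suc j) * M \<le> 2 * opt" using Mopt by (simp add: algebra_simps)
    then show ?thesis using that[of j] m mn mj by simp
  qed
  obtain u v where uv: "e = (u, v)" by (cases e)
  define b where "b = i * (n * n) + (u * n + v)"
  have uvn: "u < n" "v < n" using arcs_less e uv by auto
  have "b < Suc i * (n * n)" using cell_bound[OF uvn] by (simp add: b_def)
  also have "\<dots> \<le> H" using ie(1) unfolding H_def by (intro mult_le_mono1) simp
  finally have b: "b < H" .
  have "rlow b = M" using input_real(1)[OF ie(1) uvn] e uv ie(1) by (simp add: b_def M_def cost_def)
  then have "real (Suc j) * M \<in> candidates H 0" using b j(1) by (auto simp: candidates_def)
  moreover have "good (real (Suc j) * M)"
    using path_good[OF p(1) _ assms(3)] le_opt j(2) order_trans by blast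
  ultimately show ?thesis using that j(3) by (simp add: opt_def)
qed

text \<open>Minimality of L gives L - 1 \<le> log n; for two or more vertices log n is at least 1,
  so the factor 2 absorbs the rounding.\<close>

lemma L_le_log:
  assumes "2 \<le> n"
  shows "1 \<le> L" "real L \<le> 2 * log 2 (real n)"
proof -
  show "1 \<le> L" using L_props(1) assms by (cases L) auto
  then have "2 ^ (L - 1) < n" using L_props(2)[of "L - 1"] by simp
  then have "real (2 ^ (L - 1)) \<le> real n" by linarith
  then have "log 2 (2 ^ (L - 1)) \<le> log 2 (real n)" using assms by (subst log_le_cancel_iff) auto
  then have "real (L - 1) \<le> log 2 (real n)" by (simp add: log_nat_power)
  moreover have "1 \<le> log 2 (real n)" using assms by simp
  ultimately show "real L \<le> 2 * log 2 (real n)" using \<open>1 \<le> L\<close> by (simp add: of_nat_diff)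
qed

text \<open>The constant is 64 = 8 * 2 * 2 * 2: the 8 of \<open>good_route\<close>, then L \<le> 2
  log n, \<theta> \<le> 2 OPT and ln (k + 1) \<le> 2 log k. The last needs two agents. If s = t, the
  route is a single vertex and costs nothing.\<close>

lemma quality:
  assumes "best_output \<sigma>" "st_paths G s t \<noteq> {}" "2 \<le> k \<or> s = t"
  shows "output_path (K, \<sigma>) \<in> st_paths G s t \<and>
    robust_cost k c (output_path (K, \<sigma>)) \<le> 64 * log 2 (real n) * log 2 (real k) * OPT G s t k c"
proof -
  obtain \<theta> where \<theta>: "outputs (route \<theta>) \<sigma>"
    "(\<exists>\<theta>'\<in>candidates H 0. good \<theta>') \<longrightarrow> good \<theta> \<and> (\<forall>\<theta>'\<in>candidates H 0. good \<theta>' \<longrightarrow> \<theta> \<le> \<theta>')"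
    using assms(1) unfolding best_output_def route_def by blast
  have out: "output_path (K, \<sigma>) = zip (route \<theta>) (tl (route \<theta>))"
    by (rule output_path_eq[OF \<theta>(1) route_facts(1)])
  show ?thesis
  proof (cases "s = t")
    case True
    obtain p where p: "p \<in> st_paths G s t" "robust_cost k c p = OPT G s t k c" using OPT_path[OF assms(2)] .
    have "0 \<le> OPT G s t k c"
      using robust_cost_ge[OF k_pos, of p] path_cost_nonneg[OF p(1) k_pos] p(2) by linarith
    moreover have "0 \<le> log 2 (real n)" "0 \<le> log 2 (real k)" using n k_pos by simp_all
    ultimately have "0 \<le> 64 * log 2 (real n) * log 2 (real k) * OPT G s t k c" by simp
    moreover have "tl (route \<theta>) = []"
      using route_facts(1-4)[of \<theta>] True by (cases "route \<theta>") (auto split: if_splits)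
    moreover have "(\<lambda>i. path_cost (c i) []) ` {..<k} = {0}" using k_pos by (auto simp: path_cost_def)
    then have "robust_cost k c [] = 0" by (simp add: robust_cost_def)
    ultimately show ?thesis using True s_less verts unfolding out by (simp add: st_paths_iff)
  next
    case False
    then have n2: "2 \<le> n" using s_less t_less by linarith
    note L = L_le_log[OF n2]
    have k2: "2 \<le> k" using assms(3) False by simp
    obtain \<theta>' where \<theta>': "\<theta>' \<in> candidates H 0" "good \<theta>'" "\<theta>' \<le> 2 * OPT G s t k c"
      using good_candidate[OF assms(2) False L(1)] .
    have g: "good \<theta>" and le: "\<theta> \<le> 2 * OPT G s t k c" using \<theta>(2) \<theta>' by force+
    have opt0: "0 \<le> OPT G s t k c"
    proof -
      obtain p where p: "p \<in> st_paths G s t" "robust_cost k c p = OPT G s t k c" using OPT_path[OF assms(2)] .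
      then show ?thesis
        using robust_cost_ge[OF k_pos, of p] path_cost_nonneg[OF p(1) k_pos] by linarith
    qed
    have "ln (real k + 1) \<le> ln (real k ^ 2)"
    proof -
      have "real k + 1 \<le> real k * 2" using k2 by simp
      also have "\<dots> \<le> real k * real k" using k2 by (intro mult_left_mono) auto
      finally show ?thesis using k2 by (simp add: power2_eq_square)
    qed
    also have "\<dots> = 2 * ln (real k)" using k2 by (simp add: ln_realpow)
    also have "\<dots> \<le> 2 * log 2 (real k)"
    proof -
      have "ln (real k) * ln 2 \<le> ln (real k) * 1" using k2 ln_2_less_1 by (intro mult_left_mono) auto
      then show ?thesis by (simp add: log_def le_divide_eq)
    qed
    finally have lnk: "ln (real k + 1) \<le> 2 * log 2 (real k)" .
    have ln0: "0 \<le> ln (real k + 1)" by simp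
    have "robust_cost k c (zip (route \<theta>) (tl (route \<theta>))) \<le> 8 * real L * \<theta> * ln (real k + 1)"
      by (rule good_route(2)[OF g L(1) False])
    also have "\<dots> \<le> 8 * real L * (2 * OPT G s t k c) * ln (real k + 1)"
      using le ln0 by (intro mult_right_mono mult_left_mono) auto
    also have "\<dots> \<le> 8 * (2 * log 2 (real n)) * (2 * OPT G s t k c) * (2 * log 2 (real k))"
      using L opt0 lnk ln0 by (intro mult_mono) auto
    also have "\<dots> = 64 * log 2 (real n) * log 2 (real k) * OPT G s t k c" by simp
    finally show ?thesis using good_route(1)[OF g L(1) False] unfolding out by simp
  qed
qed

text \<open>Everything is measured by q N^4 with N = n k and q = (4 (n + 1))^L. The search
  dominates: at most N^2 cost cells, at most N multiples each, and time O(q N) per walk.\<close>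

lemma total_time_le:
  "real (Suc total_time) \<le> 1000 * (real n * real k) ^ 4 * real n powr (8 * log 2 (real n))"
proof -
  define q where "q = (4 * (n + 1)) ^ L"
  define N where "N = n * k"
  define Q where "Q = q * N ^ 4"
  have q1: "1 \<le> q" by (simp add: q_def)
  have N: "n \<le> N" "k \<le> N" "1 \<le> N" using n k_pos by (simp_all add: N_def)
  have two: "2 ^ L \<le> 2 * n"
  proof (cases L)
    case (Suc j)
    then show ?thesis using L_props(2)[of j] by simp
  qed (use n in simp)
  have LN: "L \<le> 2 * N" using less_exp[of L] two N(1) by linarith
  have pot: "pot_time \<le> 61 * N"
  proof -
    have "10 * (2 ^ L + 1) + 21 \<le> 10 * (2 * n + 1) + 21" using two by simp
    also have "\<dots> \<le> 51 * n" using n by simp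
    finally have "10 * (2 ^ L + 1) + 21 \<le> 51 * n" .
    then have "pot_time \<le> k * (51 * n) + 10" unfolding pot_time_def by (intro add_mono mult_le_mono2) auto
    also have "k * (51 * n) = 51 * N" by (simp add: N_def)
    finally show ?thesis using N(3) by linarith
  qed
  have walk: "walk_time \<le> 101 * (q * N)"
  proof -
    have "k * (10 * (2 ^ L + 1) + 21) + 40 \<le> 91 * N" using pot N(3) unfolding pot_time_def by linarith
    then have "walk_time \<le> q * (91 * N) + 10" unfolding walk_time_def q_def[symmetric] by simp
    moreover have "q * (91 * N) = 91 * (q * N)" by simp
    moreover have "1 \<le> q * N" using mult_le_mono[OF q1 N(3)] by simp
    ultimately show ?thesis by linarith
  qed
  have pow: "N ^ j \<le> N ^ 4" if "j \<le> 4" for j using that N(3) by (intro power_increasing) auto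
  have NQ: "N ^ j \<le> Q" if "j \<le> 4" for j
    using mult_le_mono[OF q1 pow[OF that]] by (simp add: Q_def)
  have qN: "q * N \<le> Q" using pow[of 1] by (simp add: Q_def)
  have search: "H * (n * (walk_time + pot_time + 21) + 20) \<le> 203 * Q"
  proof -
    have "H = N * n" by (simp add: H_def N_def)
    then have HN: "H \<le> N * N" using N(1) by simp
    have "1 * N \<le> q * N" using q1 by (intro mult_le_mono1)
    then have "walk_time + pot_time + 21 \<le> 183 * (q * N)" using walk pot N(3) by linarith
    then have "n * (walk_time + pot_time + 21) \<le> N * (183 * (q * N))" using N(1) by (intro mult_le_mono)
    moreover have "N * (183 * (q * N)) = 183 * (N * (q * N))" by simp
    moreover have "1 \<le> N * (q * N)" using mult_le_mono[OF N(3) mult_le_mono[OF q1 N(3)]] by simp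
    ultimately have "n * (walk_time + pot_time + 21) + 20 \<le> 203 * (N * (q * N))" by linarith
    then have "H * (n * (walk_time + pot_time + 21) + 20) \<le> (N * N) * (203 * (N * (q * N)))"
      using HN by (intro mult_le_mono)
    also have "\<dots> = 203 * Q" by (simp add: Q_def power4_eq_xxxx)
    finally show ?thesis .
  qed
  have erase: "(2 ^ L + 1) * (2 * (2 ^ L + 1) + 20) \<le> 78 * Q"
  proof -
    have 1: "2 ^ L + 1 \<le> 3 * N" using two N(1,3) by linarith
    moreover have "2 * (2 ^ L + 1) + 20 \<le> 2 * (3 * N) + 20 * N"
      using 1 N(3) by (intro add_mono mult_le_mono) simp_all
    then have "2 * (2 ^ L + 1) + 20 \<le> 26 * N" by simp
    ultimately    have "(2 ^ L + 1) * (2 * (2 ^ L + 1) + 20) \<le> (3 * N) * (26 * N)" by (intro mult_le_mono)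
    also have "\<dots> = 78 * N ^ 2" by (simp add: power2_eq_square)
    finally show ?thesis using NQ[of 2] by simp
  qed
  have "total_time \<le> 12 * Q + 8 * Q + 12 * Q + 203 * Q + 101 * Q + 78 * Q + 4 * Q + 200 * Q"
    using NQ[of 1] NQ[of 0] N LN search walk qN erase unfolding total_time_def by simp
  then have "Suc total_time \<le> 1000 * Q" using NQ[of 0] by simp
  then have "real (Suc total_time) \<le> real (1000 * Q)" by (rule of_nat_mono)
  also have "\<dots> = 1000 * (real n * real k) ^ 4 * real q" by (simp add: Q_def N_def)
  also have "\<dots> \<le> 1000 * (real n * real k) ^ 4 * real n powr (8 * log 2 (real n))"
  proof (rule mult_left_mono)
    show "real q \<le> real n powr (8 * log 2 (real n))"
    proof (cases "n = 1")
      case True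
      then have "L = 0" using L_props(2)[of 0] by (cases L) auto
      then show ?thesis using True by (simp add: q_def)
    next
      case False
      then have n2: "2 \<le> n" using n by linarith
      \<comment> \<open>So q is at most n^(4 L), and L \<le> 2 log n yields the exponent 8 log
        n.\<close>
      have "4 * (n + 1) \<le> 2 ^ 3 * n" using n2 by simp
      also have "\<dots> \<le> n ^ 3 * n" using n2 by (intro mult_le_mono1 power_mono) auto
      also have "\<dots> = n ^ 4" by (simp add: power4_eq_xxxx power3_eq_cube)
      finally have "q \<le> (n ^ 4) ^ L" unfolding q_def by (rule power_mono) simp
      then have "real q \<le> real ((n ^ 4) ^ L)" by (rule of_nat_mono)
      also have "\<dots> = real n ^ (4 * L)" by (simp add: power_mult)
      also have "\<dots> = real n powr (4 * real L)"
        using n by (subst powr_realpow[symmetric]) auto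
      also have "\<dots> \<le> real n powr (8 * log 2 (real n))"
        using L_le_log(2)[OF n2] n2 by (intro powr_mono) auto
      finally show ?thesis .
    qed
  qed simp
  finally show ?thesis .
qed

lemma run_program:
  obtains \<sigma> where "run program (input_mem G s t k c) (Suc total_time) = return_pmf ([], \<sigma>)" "best_output \<sigma>"
proof -
  have "wp program main_code total_time best_output (input_mem G s t k c)"
    unfolding input_layout
    by (rule wp_main[of low0, OF F_def input_nat(4) _ L_props refl route_length[unfolded route_def]])
      (simp_all add: low_def)
  then have "wp program (Call 0) (Suc total_time) best_output (input_mem G s t k c)"
    by (intro wp_Call) (simp_all add: program_def)
  then show ?thesis using that by (rule wp_run)
qed

end

theorem theorem5p1:
  shows "\<exists>(P :: prog) (A :: real) (B :: real) (C :: real) (d :: nat).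
    \<forall>(G :: nat pair_pre_digraph) (s :: nat) (t :: nat) (k :: nat) (c :: nat \<Rightarrow> nat \<times> nat \<Rightarrow> real) (n :: nat).
      robust_instance G s t k c \<and> n = card (pverts G) \<longrightarrow>
      (\<exists>T :: nat.
        real T \<le> A * (real n * real k) ^ d * real n powr (B * log 2 (real n)) \<and>
        halts_within P (input_mem G s t k c) T \<and>
        (st_paths G s t \<noteq> {} \<longrightarrow>
          measure_pmf.prob (run P (input_mem G s t k c) T)
            {\<kappa>. output_path \<kappa> \<in> st_paths G s t \<and>
                 robust_cost k c (output_path \<kappa>) \<le> C * log 2 (real n) * log 2 (real k) * OPT G s t k c}
          \<ge> 1 - (1 / real k + 1 / (real k * log 2 (real n)))))"
proof (rule exI[of _ program], rule exI[of _ 1000], rule exI[of _ 8], rule exI[of _ 64],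
    rule exI[of _ 4], intro allI impI, elim conjE)
  fix G s t k and c :: "nat \<Rightarrow> nat \<times> nat \<Rightarrow> real" and n :: nat
  assume "robust_instance G s t k c" and card: "n = card (pverts G)"
  then interpret robust G s t k c by unfold_locales
  have n_eq: "n = robust.n G" by (simp add: card n_def)
  let ?T = "Suc total_time" and ?\<sigma> = "input_mem G s t k c"
  let ?S = "{\<kappa>. output_path \<kappa> \<in> st_paths G s t \<and>
    robust_cost k c (output_path \<kappa>) \<le> 64 * log 2 (real n) * log 2 (real k) * OPT G s t k c}"
  obtain \<sigma> where \<sigma>: "run program ?\<sigma> ?T = return_pmf ([], \<sigma>)" "best_output \<sigma>" by (rule run_program)
  have n0: "0 < n" using s_less n_eq by simp
  \<comment> \<open>For a single vertex log n = 0, and the second term is 0 by the convention for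
    division by zero.\<close>
  have p0: "0 \<le> 1 / real k + 1 / (real k * log 2 (real n))" using n0 by simp
  have "1 - (1 / real k + 1 / (real k * log 2 (real n))) \<le> measure_pmf.prob (run program ?\<sigma> ?T) ?S"
    if "st_paths G s t \<noteq> {}"
  proof (cases "2 \<le> k \<or> s = t")
    case True
    have "([], \<sigma>) \<in> ?S" using quality[OF \<sigma>(2) that True, of "[]"] n_eq by simp
    then have "measure_pmf.prob (run program ?\<sigma> ?T) ?S = 1" unfolding \<sigma>(1) by (simp add: measure_return_pmf)
    then show ?thesis using p0 by linarith
  next
    case False
    \<comment> \<open>With one agent log k = 0, so the cost bound is 0 and may fail; but 1 / k = 1
      makes the required probability nonpositive.\<close>
    then have "k = 1" using k_pos by simp
    then have "1 - (1 / real k + 1 / (real k * log 2 (real n))) \<le> 0" using n0 by simp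
    then show ?thesis using measure_nonneg[of "measure_pmf (run program ?\<sigma> ?T)" ?S] by linarith
  qed
  moreover have "halts_within program ?\<sigma> ?T" by (simp add: halts_within_def \<sigma>(1))
  moreover have "real ?T \<le> 1000 * (real n * real k) ^ 4 * real n powr (8 * log 2 (real n))"
    using total_time_le unfolding n_eq .
  ultimately show "\<exists>T. real T \<le> 1000 * (real n * real k) ^ 4 * real n powr (8 * log 2 (real n)) \<and>
      halts_within program ?\<sigma> T \<and>
      (st_paths G s t \<noteq> {} \<longrightarrow> 1 - (1 / real k + 1 / (real k * log 2 (real n))) \<le>
        measure_pmf.prob (run program ?\<sigma> T) ?S)" by blast
qed

end
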